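(* Let $D$ be a positive integer and $(X,\mathbb{Z}^k,T)$ a dynamical system with the marker property. If $\mathrm{mdim}(X)<D/2^{k+1}$, then for a dense $G_\delta$ subset of $f\in C(X,[0,1]^{2D})$ the map $I_f:X\to([0,1]^{2D})^{\mathbb{Z}^k}$, $x\mapsto(f(T^nx))_{n\in\mathbb{Z}^k}$, is a topological embedding.
   Context: $C(X,[0,1]^{2D})$ carries the uniform topology. Marker property: for every finite $F\subset\mathbb{Z}^k$ there is an open $U$ with $X=\bigcup_nT^nU$ and $U\cap T^nU=\emptyset$ for nonzero $n\in F$. Mean dimension: with $[N]=\{0,\dots,N-1\}^k$, $d_\Omega(x,y)=\sup_{n\in\Omega}d(T^nx,T^ny)$, $\mathrm{widim}_\varepsilon(X,d)$ the minimal dimension of a finite simplicial complex admitting a continuous map with fibers of $d$-diameter $<\varepsilon$, $\mathrm{mdim}(X)=\lim_{\varepsilon\to0}\lim_NN^{-k}\mathrm{widim}_\varepsilon(X,d_{[N]})$. *)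

theory Defs
  imports "HOL-Analysis.Analysis"
begin

text \<open>Z^k is represented as int^'k, with k = CARD('k). The phase space X is the whole
  (compact metric) type 'a. T is a continuous Z^k-action.\<close>

definition zk_action :: "(int^'k \<Rightarrow> 'a::metric_space \<Rightarrow> 'a) \<Rightarrow> bool" where
  "zk_action T \<longleftrightarrow> T 0 = id \<and> (\<forall>m n. T (m + n) = T m \<circ> T n) \<and>
     (\<forall>n. continuous_on UNIV (T n))"

definition marker_property :: "(int^'k \<Rightarrow> 'a::metric_space \<Rightarrow> 'a) \<Rightarrow> bool" where
  "marker_property T \<longleftrightarrow>
     (\<forall>F::(int^'k) set. finite F \<longrightarrow>
        (\<exists>U. open U \<and> (\<Union>n. T n ` U) = UNIV \<and>
             (\<forall>n\<in>F. n \<noteq> 0 \<longrightarrow> U \<inter> T n ` U = {})))"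

text \<open>A finite (abstract) simplicial complex on vertices from nat; its geometric realisation
  is the set of barycentric coordinate functions nat \<Rightarrow> real supported on a simplex,
  with the (product = Euclidean on finitely many coordinates) topology.\<close>

definition simplicial_complex :: "nat set set \<Rightarrow> bool" where
  "simplicial_complex K \<longleftrightarrow> finite K \<and>
     (\<forall>\<sigma>\<in>K. finite \<sigma> \<and> \<sigma> \<noteq> {}) \<and>
     (\<forall>\<sigma>\<in>K. \<forall>\<tau>. \<tau> \<subseteq> \<sigma> \<and> \<tau> \<noteq> {} \<longrightarrow> \<tau> \<in> K)"

definition complex_dim :: "nat set set \<Rightarrow> nat" where
  "complex_dim K = (if K = {} then 0 else Max ((\<lambda>\<sigma>. card \<sigma> - 1) ` K))"

definition realization :: "nat set set \<Rightarrow> (nat \<Rightarrow> real) set" where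
  "realization K = {p. (\<forall>i. 0 \<le> p i) \<and> (\<exists>\<sigma>\<in>K. {i. p i \<noteq> 0} \<subseteq> \<sigma>) \<and>
                        (\<Sum>i\<in>{i. p i \<noteq> 0}. p i) = 1}"

definition ddiam :: "('a \<Rightarrow> 'a \<Rightarrow> real) \<Rightarrow> 'a set \<Rightarrow> real" where
  "ddiam d A = (if A = {} then 0 else (SUP p\<in>A \<times> A. d (fst p) (snd p)))"

definition widim :: "real \<Rightarrow> ('a::topological_space \<Rightarrow> 'a \<Rightarrow> real) \<Rightarrow> nat" where
  "widim \<epsilon> d = Inf {complex_dim K | K f. simplicial_complex K \<and>
       continuous_on (UNIV::'a set) (f :: 'a \<Rightarrow> nat \<Rightarrow> real) \<and> range f \<subseteq> realization K \<and>
       (\<forall>y. ddiam d {x. f x = y} < \<epsilon>)}"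

definition box_N :: "nat \<Rightarrow> (int^'k) set" where
  "box_N N = {n. \<forall>i. 0 \<le> n $ i \<and> n $ i < int N}"

definition dyn_dist :: "(int^'k \<Rightarrow> 'a::metric_space \<Rightarrow> 'a) \<Rightarrow> (int^'k) set \<Rightarrow> 'a \<Rightarrow> 'a \<Rightarrow> real" where
  "dyn_dist T \<Omega> x y = (SUP n\<in>\<Omega>. dist (T n x) (T n y))"

definition mdim :: "(int^'k \<Rightarrow> 'a::metric_space \<Rightarrow> 'a) \<Rightarrow> ereal" where
  "mdim T = Lim (at_right 0) (\<lambda>\<epsilon>::real. ereal (Lim sequentially
       (\<lambda>N. real (widim \<epsilon> (dyn_dist T (box_N N))) / real N ^ CARD('k))))"

definition cube_maps :: "('a::topological_space \<Rightarrow>\<^sub>C (real^'m)) set" where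
  "cube_maps = {f. \<forall>x i. 0 \<le> apply_bcontfun f x $ i \<and> apply_bcontfun f x $ i \<le> 1}"

definition orbit_map :: "(int^'k \<Rightarrow> 'a::topological_space \<Rightarrow> 'a) \<Rightarrow> ('a \<Rightarrow>\<^sub>C (real^'m)) \<Rightarrow> 'a \<Rightarrow> (int^'k \<Rightarrow> real^'m)" where
  "orbit_map T f x = (\<lambda>n. apply_bcontfun f (T n x))"

end

theory Submission
  imports Defs
begin

text \<open>By the Baire category theorem it suffices to approximate every \<open>f\<close> by some \<open>g\<close> whose orbit map has
  fibres of diameter less than \<open>\<epsilon>\<close>. Split the \<open>2 * D\<close> coordinates into two halves.

  The first half is perturbed so that a system of markers, separated by more than a prescribed distance along
  each orbit, can be read off from it. Such markers define a power diagram on \<open>\<int>\<^sup>k\<close> that depends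
  continuously on the point and can be read off as well.

  In each cell of the diagram, contracting cubes of side \<open>N\<close> towards the marker yields pairwise disjoint
  cubes of side \<open>N - 1\<close>. The second half of the coordinates, on a contracted cube, encodes injectively both
  itself (up to a small error) and the orbit along the original cube (up to \<open>\<epsilon>\<close>). In general position this needs
  \<open>2 * (widim (box N) + widim (box (N - 1))) < D * (N - 1) ^ k\<close>, which holds for large \<open>N\<close> when the mean
  dimension is less than \<open>D / 4\<close>. The original cubes cover \<open>\<int>\<^sup>k\<close>, so nothing is lost near the boundaries
  of the cells.\<close>

section \<open>General position for Lipschitz maps\<close>

text \<open>Perturbations are made one after another, and a later one must not undo an earlier one.
  So every separation carries a uniform margin \<open>\<tau>\<close>, obtained by counting: if
  points have covering exponent \<open>a\<close>, then pairs have exponent \<open>2 * a\<close>, and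
  more than \<open>2 * a\<close> Lipschitz functions of pairs can be moved away from zero
  simultaneously by arbitrarily small constants.

  The threshold \<open>D / 4\<close> arises twice. In the first half of the coordinates a pattern
  must differ from translates of patterns, and only about half of its positions can be perturbed
  independently of the translated ones. In the second half all positions are available, but the
  values must follow the orbit on the contracted cube while determining it on the original one, so
  the window is a union of two cubes and the bound on its width dimension doubles.

  The diagram has to be weighted because markers fade in and out continuously with the point: a
  marker loses its cell gradually as its weight grows, where an unweighted Voronoi cell would vanish
  at once.\<close>

definition l1dist :: "nat set \<Rightarrow> ('x \<Rightarrow> nat \<Rightarrow> real) \<Rightarrow> 'x \<Rightarrow> 'x \<Rightarrow> real" where
  "l1dist V P x y = (\<Sum>v\<in>V. \<bar>P x v - P y v\<bar>)"

lemma l1dist_nonneg: "0 \<le> l1dist V P x y"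
  by (simp add: l1dist_def sum_nonneg)

lemma l1dist_commute: "l1dist V P x y = l1dist V P y x"
  by (simp add: l1dist_def abs_minus_commute)

lemma l1dist_same [simp]: "l1dist V P x x = 0"
  by (simp add: l1dist_def)

lemma l1dist_triangle: "l1dist V P x z \<le> l1dist V P x y + l1dist V P y z"
  unfolding l1dist_def sum.distrib[symmetric] by (intro sum_mono) linarith

lemma coord_le_l1dist: "finite V \<Longrightarrow> v \<in> V \<Longrightarrow> \<bar>P x v - P y v\<bar> \<le> l1dist V P x y"
  unfolding l1dist_def by (rule member_le_sum) auto

text \<open>An upper bound \<open>a\<close> for the box dimension of the pseudometric
  \<open>d\<close>, with one constant for all scales \<open>1 / G\<close>. Cell counts survive
  Lipschitz maps, which the bare topological dimension of a complex does not.\<close>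

definition covering_exponent :: "('x \<Rightarrow> 'x \<Rightarrow> real) \<Rightarrow> nat \<Rightarrow> bool" where
  "covering_exponent d a \<longleftrightarrow> (\<exists>C>0. \<forall>G::nat. 0 < G \<longrightarrow>
     (\<exists>\<C>. finite \<C> \<and> real (card \<C>) \<le> C * real G ^ a \<and> \<Union>\<C> = UNIV \<and>
       (\<forall>S\<in>\<C>. \<forall>x\<in>S. \<forall>y\<in>S. d x y \<le> C / real G)))"

text \<open>Pigeonhole: \<open>Z\<close> splits into \<open>O(G ^ (2 * a))\<close> cells whose images are smaller than the mesh of a grid with
  a fixed multiple of \<open>G ^ card I\<close> points, so some grid point stays away from all the images.\<close>

lemma avoid_lipschitz_image:
  fixes \<Phi> :: "'i \<Rightarrow> 'x \<Rightarrow> 'x \<Rightarrow> real"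
  assumes d: "covering_exponent d a" and I: "finite I" "2 * a < card I"
    and "0 \<le> \<Lambda>" "0 < \<eta>"
    and lip: "\<And>i x y x' y'. i \<in> I \<Longrightarrow> Z x y \<Longrightarrow> Z x' y' \<Longrightarrow>
      \<bar>\<Phi> i x y - \<Phi> i x' y'\<bar> \<le> \<Lambda> * (d x x' + d y y')"
  shows "\<exists>c \<tau>. 0 < \<tau> \<and> (\<forall>i\<in>I. \<bar>c i\<bar> < \<eta>) \<and> (\<forall>x y. Z x y \<longrightarrow> (\<exists>i\<in>I. \<tau> \<le> \<bar>\<Phi> i x y - c i\<bar>))"
proof -
  obtain C where C: "0 < C" and cov: "\<And>G::nat. 0 < G \<Longrightarrow>
     (\<exists>\<C>. finite \<C> \<and> real (card \<C>) \<le> C * real G ^ a \<and> \<Union>\<C> = UNIV \<and>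
       (\<forall>S\<in>\<C>. \<forall>x\<in>S. \<forall>y\<in>S. d x y \<le> C / real G))"
    using d unfolding covering_exponent_def by blast
  \<comment> \<open>\<open>m\<close> refines the cells relative to the grid: over a pair of cells
    \<open>\<Phi>\<close> varies by at most \<open>\<eta> / (2 * M)\<close>, half the spacing
    \<open>\<eta> / M\<close> of the grid.\<close>
  obtain m0 :: nat where m0: "4 * \<Lambda> * C / \<eta> \<le> real m0"
    using real_arch_simple by blast
  define m where "m = Suc m0"
  have m: "0 < m" "4 * \<Lambda> * C / \<eta> \<le> real m" using m0 by (auto simp: m_def)
  \<comment> \<open>The grid has at least \<open>M ^ (2 * a + 1)\<close> points, and there are at
    most \<open>C^2 * m ^ (2 * a) * M ^ (2 * a)\<close> pairs of cells; the surplus factor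
    \<open>M\<close> absorbs the constant.\<close>
  obtain M0 :: nat where M0: "C^2 * real m ^ (2 * a) < real M0"
    using reals_Archimedean2 by blast
  define M where "M = Suc M0"
  have M: "0 < M" "C^2 * real m ^ (2 * a) < real M" using M0 unfolding M_def by linarith+
  obtain \<C> where \<C>: "finite \<C>" "real (card \<C>) \<le> C * real (m * M) ^ a" "\<Union>\<C> = UNIV"
    and diam: "\<And>S x y. S \<in> \<C> \<Longrightarrow> x \<in> S \<Longrightarrow> y \<in> S \<Longrightarrow> d x y \<le> C / real (m * M)"
  proof -
    have "0 < m * M" using m(1) M(1) by simp
    from cov[OF this] that show ?thesis by metis
  qed
  \<comment> \<open>With this margin \<open>\<eta> / (2 * M) + 2 * \<tau>\<close> stays below the
    spacing \<open>\<eta> / M\<close>.\<close>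
  define \<tau> where "\<tau> = \<eta> / (8 * real M)"
  define cc where "cc = (\<lambda>(\<alpha>::'i \<Rightarrow> nat) i. \<eta> * real (\<alpha> i) / real M)"
  define A where "A = PiE I (\<lambda>_. {..<M})"
  have \<tau>0: "0 < \<tau>" using \<open>0 < \<eta>\<close> M by (simp add: \<tau>_def)
  have "\<exists>\<alpha>\<in>A. \<forall>x y. Z x y \<longrightarrow> (\<exists>i\<in>I. \<tau> \<le> \<bar>\<Phi> i x y - cc \<alpha> i\<bar>)"
  proof (rule ccontr)
    assume "\<not> ?thesis"
    then have "\<forall>\<alpha>\<in>A. \<exists>x y. Z x y \<and> (\<forall>i\<in>I. \<bar>\<Phi> i x y - cc \<alpha> i\<bar> < \<tau>)"
      by (simp add: not_le)
    then have "\<forall>\<alpha>\<in>A. \<exists>p. Z (fst p) (snd p) \<and> (\<forall>i\<in>I. \<bar>\<Phi> i (fst p) (snd p) - cc \<alpha> i\<bar> < \<tau>)"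
      by simp
    from bchoice[OF this] obtain p where p: "\<And>\<alpha>. \<alpha> \<in> A \<Longrightarrow>
        Z (fst (p \<alpha>)) (snd (p \<alpha>)) \<and> (\<forall>i\<in>I. \<bar>\<Phi> i (fst (p \<alpha>)) (snd (p \<alpha>)) - cc \<alpha> i\<bar> < \<tau>)"
      by blast
    define X Y where "X \<alpha> = fst (p \<alpha>)" and "Y \<alpha> = snd (p \<alpha>)" for \<alpha>
    have XY: "\<And>\<alpha>. \<alpha> \<in> A \<Longrightarrow> Z (X \<alpha>) (Y \<alpha>)"
      "\<And>\<alpha> i. \<alpha> \<in> A \<Longrightarrow> i \<in> I \<Longrightarrow> \<bar>\<Phi> i (X \<alpha>) (Y \<alpha>) - cc \<alpha> i\<bar> < \<tau>"
      unfolding X_def Y_def using p by blast+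
    have "\<forall>x. \<exists>S. S \<in> \<C> \<and> x \<in> S" using \<C>(3) by auto
    from choice[OF this] obtain cell where cell: "\<And>x. cell x \<in> \<C>" "\<And>x. x \<in> cell x" by blast
    have "inj_on (\<lambda>\<alpha>. (cell (X \<alpha>), cell (Y \<alpha>))) A"
    proof (rule inj_onI)
      fix \<alpha> \<beta> assume ab: "\<alpha> \<in> A" "\<beta> \<in> A"
        and eq: "(cell (X \<alpha>), cell (Y \<alpha>)) = (cell (X \<beta>), cell (Y \<beta>))"
      have dX: "d (X \<alpha>) (X \<beta>) \<le> C / real (m * M)" and dY: "d (Y \<alpha>) (Y \<beta>) \<le> C / real (m * M)"
        using eq diam[OF cell(1)[of "X \<alpha>"], of "X \<alpha>" "X \<beta>"] cell(2)[of "X \<alpha>"] cell(2)[of "X \<beta>"]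
          diam[OF cell(1)[of "Y \<alpha>"], of "Y \<alpha>" "Y \<beta>"] cell(2)[of "Y \<alpha>"] cell(2)[of "Y \<beta>"]
        by simp_all
      have "\<alpha> i = \<beta> i" if i: "i \<in> I" for i
      proof -
        have "\<bar>\<Phi> i (X \<alpha>) (Y \<alpha>) - \<Phi> i (X \<beta>) (Y \<beta>)\<bar> \<le> \<Lambda> * (d (X \<alpha>) (X \<beta>) + d (Y \<alpha>) (Y \<beta>))"
          by (rule lip[OF i XY(1)[OF ab(1)] XY(1)[OF ab(2)]])
        also have "\<dots> \<le> \<Lambda> * (2 * (C / real (m * M)))"
          using mult_left_mono[OF add_mono[OF dX dY] \<open>0 \<le> \<Lambda>\<close>] by (simp only: mult_2)
        also have "\<dots> = 4 * \<Lambda> * C / \<eta> / real m * (\<eta> / (2 * real M))"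
          using m(1) M(1) \<open>0 < \<eta>\<close> by (simp add: field_simps)
        also have "\<dots> \<le> 1 * (\<eta> / (2 * real M))"
          using m M(1) \<open>0 < \<eta>\<close> by (intro mult_right_mono) (simp_all add: pos_divide_le_eq mult.commute)
        finally have "\<bar>cc \<alpha> i - cc \<beta> i\<bar> < \<eta> / (2 * real M) + 2 * \<tau>"
          using XY(2)[OF ab(1) i] XY(2)[OF ab(2) i] by linarith
        also have "\<dots> < \<eta> / real M" using M(1) \<open>0 < \<eta>\<close> by (simp add: \<tau>_def field_simps)
        also have "cc \<alpha> i - cc \<beta> i = (real (\<alpha> i) - real (\<beta> i)) * (\<eta> / real M)"
          by (simp add: cc_def diff_divide_distrib algebra_simps)
        finally have "\<bar>real (\<alpha> i) - real (\<beta> i)\<bar> * (\<eta> / real M) < 1 * (\<eta> / real M)"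
          using M(1) \<open>0 < \<eta>\<close> by (simp add: abs_mult)
        then have "\<bar>real (\<alpha> i) - real (\<beta> i)\<bar> < 1"
          using M(1) \<open>0 < \<eta>\<close> by (subst (asm) mult_less_cancel_right_pos) auto
        then show ?thesis by linarith
      qed
      then show "\<alpha> = \<beta>" using ab unfolding A_def by (intro PiE_ext) auto
    qed
    then have "card A \<le> card (\<C> \<times> \<C>)"
      using \<C>(1) cell by (intro card_inj_on_le) auto
    then have "M ^ card I \<le> card \<C> ^ 2"
      using I(1) by (simp add: A_def card_PiE card_cartesian_product power2_eq_square)
    then have "real M ^ card I \<le> real (card \<C>) ^ 2" by (metis of_nat_le_iff of_nat_power)
    also have "\<dots> \<le> (C * real (m * M) ^ a)^2" using \<C>(2) by (intro power_mono) auto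
    also have "\<dots> = C^2 * real m ^ (2 * a) * real M ^ (2 * a)"
      by (simp add: power_mult_distrib power_mult[symmetric] mult.commute)
    also have "\<dots> < real M * real M ^ (2 * a)" using M by (intro mult_strict_right_mono) simp_all
    also have "\<dots> = real M ^ Suc (2 * a)" by simp
    also have "\<dots> \<le> real M ^ card I" using M(1) I by (intro power_increasing) simp_all
    finally show False by simp
  qed
  then obtain \<alpha> where \<alpha>: "\<alpha> \<in> A" "\<And>x y. Z x y \<Longrightarrow> \<exists>i\<in>I. \<tau> \<le> \<bar>\<Phi> i x y - cc \<alpha> i\<bar>" by blast
  have "\<bar>cc \<alpha> i\<bar> < \<eta>" if "i \<in> I" for i
  proof -
    have "\<alpha> i < M" using \<alpha>(1) that by (auto simp: A_def)
    then show ?thesis using M(1) \<open>0 < \<eta>\<close> by (simp add: cc_def field_simps abs_mult)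
  qed
  then show ?thesis using \<tau>0 \<alpha>(2) by blast
qed

section \<open>Perturbing Lipschitz functions so that they separate\<close>

definition lipschitz_wrt :: "('x \<Rightarrow> 'x \<Rightarrow> real) \<Rightarrow> ('x \<Rightarrow> real) \<Rightarrow> bool" where
  "lipschitz_wrt d \<psi> \<longleftrightarrow> (\<exists>\<Lambda>\<ge>0. \<forall>x y. \<bar>\<psi> x - \<psi> y\<bar> \<le> \<Lambda> * d x y)"

lemma lipschitz_wrt_uniform:
  assumes "finite I" "\<And>i. i \<in> I \<Longrightarrow> lipschitz_wrt d (\<psi> i)" "\<And>x y. 0 \<le> d x y"
  obtains \<Lambda> where "0 \<le> \<Lambda>" "\<And>i x y. i \<in> I \<Longrightarrow> \<bar>\<psi> i x - \<psi> i y\<bar> \<le> \<Lambda> * d x y"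
proof -
  obtain L where L: "\<And>i. i \<in> I \<Longrightarrow> 0 \<le> L i" "\<And>i x y. i \<in> I \<Longrightarrow> \<bar>\<psi> i x - \<psi> i y\<bar> \<le> L i * d x y"
    using assms(2) unfolding lipschitz_wrt_def by metis
  show ?thesis
  proof
    show "0 \<le> sum L I" using L(1) by (simp add: sum_nonneg)
    fix i x y assume i: "i \<in> I"
    have "L i \<le> sum L I" using i assms(1) L(1) by (intro member_le_sum) auto
    then show "\<bar>\<psi> i x - \<psi> i y\<bar> \<le> sum L I * d x y"
      using L(2)[OF i, of x y] mult_right_mono[OF _ assms(3)[of x y]] by (meson order_trans)
  qed
qed

lemma lipschitz_wrt_add_const: "lipschitz_wrt d \<psi> \<Longrightarrow> lipschitz_wrt d (\<lambda>x. \<psi> x + c)"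
  unfolding lipschitz_wrt_def by simp

lemma lipschitz_wrt_add_mult:
  assumes "lipschitz_wrt d \<psi>" "lipschitz_wrt d \<phi>" "\<And>x y. 0 \<le> d x y"
  shows "lipschitz_wrt d (\<lambda>x. \<psi> x + c * \<phi> x)"
proof -
  obtain L M where "0 \<le> L" "\<And>x y. \<bar>\<psi> x - \<psi> y\<bar> \<le> L * d x y" "0 \<le> M" "\<And>x y. \<bar>\<phi> x - \<phi> y\<bar> \<le> M * d x y"
    using assms unfolding lipschitz_wrt_def by metis
  note LM = this
  have "\<bar>(\<psi> x + c * \<phi> x) - (\<psi> y + c * \<phi> y)\<bar> \<le> (L + \<bar>c\<bar> * M) * d x y" for x y
  proof -
    have "\<bar>c * (\<phi> x - \<phi> y)\<bar> \<le> \<bar>c\<bar> * (M * d x y)"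
      using LM(4)[of x y] by (simp add: abs_mult mult_left_mono)
    then show ?thesis using LM(2)[of x y] by (simp add: algebra_simps)
  qed
  then show ?thesis unfolding lipschitz_wrt_def using LM(1,3) by (intro exI[of _ "L + \<bar>c\<bar> * M"]) auto
qed

lemma separate_shifted_single:
  fixes \<psi> :: "'i \<Rightarrow> 'x \<Rightarrow> real"
  assumes d: "covering_exponent d a" "\<And>x y. 0 \<le> d x y"
    and lip: "\<And>i. i \<in> I \<Longrightarrow> lipschitz_wrt d (\<psi> i)"
    and I: "finite I" "J \<subseteq> I" "\<sigma> ` J \<subseteq> I" "inj_on \<sigma> J" "J \<inter> \<sigma> ` J = {}" "2 * a < card J"
    and "0 < \<eta>"
  shows "\<exists>c \<tau>. 0 < \<tau> \<and> (\<forall>i. \<bar>c i\<bar> < \<eta>) \<and>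
    (\<forall>x y. \<exists>j\<in>J. \<tau> \<le> \<bar>(\<psi> (\<sigma> j) x + c (\<sigma> j)) - (\<psi> j y + c j)\<bar>)"
proof -
  obtain \<Lambda> where \<Lambda>: "0 \<le> \<Lambda>" "\<And>i x y. i \<in> I \<Longrightarrow> \<bar>\<psi> i x - \<psi> i y\<bar> \<le> \<Lambda> * d x y"
    using lipschitz_wrt_uniform[where \<psi>=\<psi>, OF I(1) lip d(2)] by blast
  have fJ: "finite J" using I finite_subset by blast
  have "\<exists>c \<tau>. 0 < \<tau> \<and> (\<forall>i\<in>J. \<bar>c i\<bar> < \<eta>) \<and>
     (\<forall>x y. True \<longrightarrow> (\<exists>i\<in>J. \<tau> \<le> \<bar>(\<psi> i y - \<psi> (\<sigma> i) x) - c i\<bar>))"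
  proof (rule avoid_lipschitz_image[OF d(1) fJ I(6) \<Lambda>(1) \<open>0 < \<eta>\<close>])
    fix i x y x' y' assume i: "i \<in> J"
    have "\<bar>\<psi> i y - \<psi> i y'\<bar> \<le> \<Lambda> * d y y'" "\<bar>\<psi> (\<sigma> i) x - \<psi> (\<sigma> i) x'\<bar> \<le> \<Lambda> * d x x'"
      using \<Lambda>(2)[of i y y'] \<Lambda>(2)[of "\<sigma> i" x x'] i I(2,3) by auto
    then show "\<bar>\<psi> i y - \<psi> (\<sigma> i) x - (\<psi> i y' - \<psi> (\<sigma> i) x')\<bar> \<le> \<Lambda> * (d x x' + d y y')"
      by (simp add: distrib_left)
  qed
  then obtain c \<tau> where c: "0 < \<tau>" "\<And>i. i \<in> J \<Longrightarrow> \<bar>c i\<bar> < \<eta>"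
    "\<And>x y. \<exists>i\<in>J. \<tau> \<le> \<bar>(\<psi> i y - \<psi> (\<sigma> i) x) - c i\<bar>" by blast
  define c' where "c' i = (if i \<in> \<sigma> ` J then c (the_inv_into J \<sigma> i) else 0)" for i
  have c'1: "c' (\<sigma> j) = c j" "c' j = 0" if "j \<in> J" for j
  proof -
    show "c' (\<sigma> j) = c j" using that by (simp add: c'_def the_inv_into_f_f[OF I(4)])
    have "j \<notin> \<sigma> ` J" using that I(5) by blast
    then show "c' j = 0" by (simp add: c'_def)
  qed
  have "\<bar>c' i\<bar> < \<eta>" for i
  proof (cases "i \<in> \<sigma> ` J")
    case True
    then obtain j where "j \<in> J" "i = \<sigma> j" by blast
    then show ?thesis using c(2) c'1(1) by simp
  next
    case False
    then show ?thesis using \<open>0 < \<eta>\<close> by (simp add: c'_def)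
  qed
  moreover have "\<exists>j\<in>J. \<tau> \<le> \<bar>(\<psi> (\<sigma> j) x + c' (\<sigma> j)) - (\<psi> j y + c' j)\<bar>" for x y
  proof -
    obtain j where j: "j \<in> J" "\<tau> \<le> \<bar>\<psi> j y - \<psi> (\<sigma> j) x - c j\<bar>" using c(3) by blast
    show ?thesis by (rule bexI[OF _ j(1)]) (use j(2) c'1[OF j(1)] in linarith)
  qed
  ultimately show ?thesis using c(1) by (intro exI[of _ c'] exI[of _ \<tau>]) auto
qed

lemma separate_shifted:
  fixes \<psi> :: "'i \<Rightarrow> 'x \<Rightarrow> real" and J :: "'n \<Rightarrow> 'i set"
  assumes d: "covering_exponent d a" "\<And>x y. 0 \<le> d x y"
    and lip: "\<And>i. i \<in> I \<Longrightarrow> lipschitz_wrt d (\<psi> i)"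
    and I: "finite I" and "finite F"
    and J: "\<And>n. n \<in> F \<Longrightarrow> J n \<subseteq> I \<and> \<sigma> n ` J n \<subseteq> I \<and> inj_on (\<sigma> n) (J n) \<and>
      J n \<inter> \<sigma> n ` J n = {} \<and> 2 * a < card (J n)"
    and "0 < \<eta>"
  shows "\<exists>c \<tau>. 0 < \<tau> \<and> (\<forall>i. \<bar>c i\<bar> < \<eta>) \<and>
    (\<forall>n\<in>F. \<forall>x y. \<exists>j\<in>J n. \<tau> \<le> \<bar>(\<psi> (\<sigma> n j) x + c (\<sigma> n j)) - (\<psi> j y + c j)\<bar>)"
  using \<open>finite F\<close> J
proof (induction F rule: finite_induct)
  case empty
  show ?case by (rule exI[of _ "\<lambda>_. 0"], rule exI[of _ 1]) (use \<open>0 < \<eta>\<close> in auto)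
next
  case (insert m F)
  have prem: "\<And>n. n \<in> insert m F \<Longrightarrow> J n \<subseteq> I \<and> \<sigma> n ` J n \<subseteq> I \<and> inj_on (\<sigma> n) (J n) \<and>
      J n \<inter> \<sigma> n ` J n = {} \<and> 2 * a < card (J n)" using insert.prems by blast
  obtain c \<tau> where c: "0 < \<tau>" "\<And>i. \<bar>c i\<bar> < \<eta>"
    "\<And>n x y. n \<in> F \<Longrightarrow> \<exists>j\<in>J n. \<tau> \<le> \<bar>(\<psi> (\<sigma> n j) x + c (\<sigma> n j)) - (\<psi> j y + c j)\<bar>"
    using insert.IH[OF prem] by blast
  \<comment> \<open>Two constants enter each comparison, so changing each by less than
    \<open>\<tau> / 4\<close> leaves the margin \<open>\<tau> / 2\<close>. The other bound keeps the
    accumulated constants below \<open>\<eta>\<close>.\<close>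
  define \<eta>' where "\<eta>' = min (\<tau> / 4) (Min (insert \<eta> ((\<lambda>i. \<eta> - \<bar>c i\<bar>) ` I)))"
  have \<eta>': "0 < \<eta>'" using c(1,2) I \<open>0 < \<eta>\<close> by (simp add: \<eta>'_def)
  have \<eta>'1: "\<eta>' \<le> \<tau> / 4" "\<And>i. i \<in> I \<Longrightarrow> \<eta>' \<le> \<eta> - \<bar>c i\<bar>"
    using I by (auto simp: \<eta>'_def min_le_iff_disj)
  have P: "J m \<subseteq> I" "\<sigma> m ` J m \<subseteq> I" "inj_on (\<sigma> m) (J m)" "J m \<inter> \<sigma> m ` J m = {}" "2 * a < card (J m)"
    using prem[of m] by auto
  have lip': "\<And>i. i \<in> I \<Longrightarrow> lipschitz_wrt d (\<lambda>x. \<psi> i x + c i)"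
    by (intro lipschitz_wrt_add_const lip)
  obtain c1 \<tau>1 where c1: "0 < \<tau>1" "\<And>i. \<bar>c1 i\<bar> < \<eta>'"
    "\<And>x y. \<exists>j\<in>J m. \<tau>1 \<le> \<bar>((\<psi> (\<sigma> m j) x + c (\<sigma> m j)) + c1 (\<sigma> m j)) - ((\<psi> j y + c j) + c1 j)\<bar>"
    using separate_shifted_single[where \<psi>="\<lambda>i x. \<psi> i x + c i", OF d lip' I P \<eta>'] by blast
  define c2 where "c2 i = (if i \<in> I then c i + c1 i else 0)" for i
  define \<tau>2 where "\<tau>2 = min \<tau>1 (\<tau>/2)"
  have "\<bar>c2 i\<bar> < \<eta>" for i
    using \<eta>'1(2)[of i] c1(2)[of i] \<open>0 < \<eta>\<close> by (auto simp: c2_def)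
  moreover have "\<exists>j\<in>J n. \<tau>2 \<le> \<bar>(\<psi> (\<sigma> n j) x + c2 (\<sigma> n j)) - (\<psi> j y + c2 j)\<bar>"
    if n: "n \<in> insert m F" for n x y
  proof (cases "n = m")
    case True
    obtain j where "j \<in> J m" "\<tau>1 \<le> \<bar>((\<psi> (\<sigma> m j) x + c (\<sigma> m j)) + c1 (\<sigma> m j)) - ((\<psi> j y + c j) + c1 j)\<bar>"
      using c1(3) by blast
    then show ?thesis using True P by (intro bexI[of _ j]) (auto simp: c2_def \<tau>2_def algebra_simps)
  next
    case False
    then have nF: "n \<in> F" using n by simp
    obtain j where j: "j \<in> J n" "\<tau> \<le> \<bar>(\<psi> (\<sigma> n j) x + c (\<sigma> n j)) - (\<psi> j y + c j)\<bar>"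
      using c(3)[OF nF] by blast
    have "j \<in> I" "\<sigma> n j \<in> I" using prem[OF n] j by auto
    then show ?thesis using j c1(2)[of j] c1(2)[of "\<sigma> n j"] \<eta>'1(1)
      by (intro bexI[of _ j]) (auto simp: c2_def \<tau>2_def)
  qed
  ultimately show ?case using c1(1) c(1)
    by (intro exI[of _ c2] exI[of _ \<tau>2]) (auto simp: \<tau>2_def)
qed


text \<open>On the pairs with \<open>\<kappa> \<le> \<bar>\<phi> x - \<phi> y\<bar>\<close>, the equation \<open>\<psi> x + c * \<phi> x = \<psi> y + c * \<phi> y\<close> determines
  \<open>c\<close> as a Lipschitz function of \<open>(x, y)\<close>.\<close>

lemma separate_points_single:
  fixes \<psi> :: "'i \<Rightarrow> 'x \<Rightarrow> real"
  assumes d: "covering_exponent d a" "\<And>x y. 0 \<le> d x y" and I: "finite I" "2 * a < card I"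
    and lip: "\<And>i. i \<in> I \<Longrightarrow> lipschitz_wrt d (\<psi> i)" "lipschitz_wrt d \<phi>"
    and bd: "\<And>x. \<bar>\<phi> x\<bar> \<le> 1" "\<And>i x. i \<in> I \<Longrightarrow> \<bar>\<psi> i x\<bar> \<le> B"
    and "0 < \<kappa>" "0 < \<eta>"
  shows "\<exists>c \<tau>. 0 < \<tau> \<and> (\<forall>i\<in>I. \<bar>c i\<bar> < \<eta>) \<and>
    (\<forall>x y. \<kappa> \<le> \<bar>\<phi> x - \<phi> y\<bar> \<longrightarrow> (\<exists>i\<in>I. \<tau> \<le> \<bar>(\<psi> i x + c i * \<phi> x) - (\<psi> i y + c i * \<phi> y)\<bar>))"
proof -
  obtain \<Lambda> where \<Lambda>: "0 \<le> \<Lambda>" "\<And>i x y. i \<in> I \<Longrightarrow> \<bar>\<psi> i x - \<psi> i y\<bar> \<le> \<Lambda> * d x y"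
    using lipschitz_wrt_uniform[where \<psi>=\<psi>, OF I(1) lip(1) d(2)] by blast
  obtain M where M: "0 \<le> M" "\<And>x y. \<bar>\<phi> x - \<phi> y\<bar> \<le> M * d x y"
    using lip(2) unfolding lipschitz_wrt_def by blast
  define \<Phi> where "\<Phi> i x y = (\<psi> i y - \<psi> i x) / (\<phi> x - \<phi> y)" for i x y
  define Z where "Z x y \<longleftrightarrow> \<kappa> \<le> \<bar>\<phi> x - \<phi> y\<bar>" for x y
  \<comment> \<open>The Lipschitz constant of the quotient rule: the denominators are at least
    \<open>\<kappa>\<close> in absolute value, differences of \<open>\<phi>\<close> are at most 2
    and differences of \<open>\<psi> i\<close> at most \<open>2 * |B|\<close>.\<close>
  define \<Gamma> where "\<Gamma> = (2 * \<Lambda> + 2 * \<bar>B\<bar> * M) / \<kappa>^2"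
  have "\<exists>c \<tau>. 0 < \<tau> \<and> (\<forall>i\<in>I. \<bar>c i\<bar> < \<eta>) \<and> (\<forall>x y. Z x y \<longrightarrow> (\<exists>i\<in>I. \<tau> \<le> \<bar>\<Phi> i x y - c i\<bar>))"
  proof (rule avoid_lipschitz_image[OF d(1) I _ \<open>0 < \<eta>\<close>])
    show "0 \<le> \<Gamma>" using \<Lambda>(1) M(1) by (simp add: \<Gamma>_def)
    fix i x y x' y' assume i: "i \<in> I" and Z: "Z x y" "Z x' y'"
    define n n' q q' s where "n = \<psi> i y - \<psi> i x" and "n' = \<psi> i y' - \<psi> i x'"
      and "q = \<phi> x - \<phi> y" and "q' = \<phi> x' - \<phi> y'" and "s = d x x' + d y y'"
    have q: "\<kappa> \<le> \<bar>q\<bar>" "\<kappa> \<le> \<bar>q'\<bar>" using Z by (auto simp: Z_def q_def q'_def)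
    then have q0: "q \<noteq> 0" "q' \<noteq> 0" using \<open>0 < \<kappa>\<close> by auto
    have q2: "\<bar>q'\<bar> \<le> 2" using bd(1)[of x'] bd(1)[of y'] by (simp add: q'_def)
    have n2: "\<bar>n'\<bar> \<le> 2 * \<bar>B\<bar>" using bd(2)[OF i, of x'] bd(2)[OF i, of y'] by (simp add: n'_def)
    have nn: "\<bar>n - n'\<bar> \<le> \<Lambda> * s"
      using \<Lambda>(2)[OF i, of x x'] \<Lambda>(2)[OF i, of y y'] by (simp add: n_def n'_def s_def distrib_left)
    have qq: "\<bar>q' - q\<bar> \<le> M * s"
      using M(2)[of x x'] M(2)[of y y'] by (simp add: q_def q'_def s_def distrib_left)
    have "\<bar>n / q - n' / q'\<bar> = \<bar>(n - n') * q' + n' * (q' - q)\<bar> / (\<bar>q\<bar> * \<bar>q'\<bar>)"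
      using q0 by (simp add: field_simps flip: abs_mult abs_divide)
    also have "\<dots> \<le> (\<Lambda> * s * 2 + 2 * \<bar>B\<bar> * (M * s)) / (\<bar>q\<bar> * \<bar>q'\<bar>)"
    proof (rule divide_right_mono)
      have "\<bar>(n - n') * q'\<bar> \<le> \<Lambda> * s * 2"
        unfolding abs_mult using nn q2 by (intro mult_mono) auto
      moreover have "\<bar>n' * (q' - q)\<bar> \<le> 2 * \<bar>B\<bar> * (M * s)"
        unfolding abs_mult using n2 qq by (intro mult_mono) auto
      ultimately show "\<bar>(n - n') * q' + n' * (q' - q)\<bar> \<le> \<Lambda> * s * 2 + 2 * \<bar>B\<bar> * (M * s)" by linarith
    qed simp
    also have "\<dots> \<le> (\<Lambda> * s * 2 + 2 * \<bar>B\<bar> * (M * s)) / (\<kappa> * \<kappa>)"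
    proof (rule divide_left_mono)
      show "\<kappa> * \<kappa> \<le> \<bar>q\<bar> * \<bar>q'\<bar>" using q \<open>0 < \<kappa>\<close> by (intro mult_mono) auto
      show "0 \<le> \<Lambda> * s * 2 + 2 * \<bar>B\<bar> * (M * s)" using \<Lambda>(1) M(1) d(2) by (simp add: s_def)
      show "0 < \<bar>q\<bar> * \<bar>q'\<bar> * (\<kappa> * \<kappa>)" using q0 \<open>0 < \<kappa>\<close> by simp
    qed
    also have "\<dots> = \<Gamma> * s" by (simp add: \<Gamma>_def power2_eq_square algebra_simps)
    finally show "\<bar>\<Phi> i x y - \<Phi> i x' y'\<bar> \<le> \<Gamma> * (d x x' + d y y')"
      by (simp add: \<Phi>_def n_def n'_def q_def q'_def s_def)
  qed
  then obtain c \<tau> where c: "0 < \<tau>" "\<And>i. i \<in> I \<Longrightarrow> \<bar>c i\<bar> < \<eta>"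
    "\<And>x y. Z x y \<Longrightarrow> \<exists>i\<in>I. \<tau> \<le> \<bar>\<Phi> i x y - c i\<bar>" by blast
  have "\<exists>i\<in>I. \<kappa> * \<tau> \<le> \<bar>(\<psi> i x + c i * \<phi> x) - (\<psi> i y + c i * \<phi> y)\<bar>" if xy: "\<kappa> \<le> \<bar>\<phi> x - \<phi> y\<bar>" for x y
  proof -
    obtain i where i: "i \<in> I" "\<tau> \<le> \<bar>\<Phi> i x y - c i\<bar>" using c(3)[of x y] xy unfolding Z_def by blast
    have "\<phi> x - \<phi> y \<noteq> 0" using xy \<open>0 < \<kappa>\<close> by auto
    then have e: "(\<phi> x - \<phi> y) * \<Phi> i x y = \<psi> i y - \<psi> i x" by (simp add: \<Phi>_def)
    have "(\<psi> i x + c i * \<phi> x) - (\<psi> i y + c i * \<phi> y) = - ((\<phi> x - \<phi> y) * (\<Phi> i x y - c i))"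
      unfolding right_diff_distrib e by (simp add: algebra_simps)
    then have "\<bar>(\<psi> i x + c i * \<phi> x) - (\<psi> i y + c i * \<phi> y)\<bar> = \<bar>\<phi> x - \<phi> y\<bar> * \<bar>\<Phi> i x y - c i\<bar>"
      by (simp only: abs_minus_cancel abs_mult)
    moreover have "\<kappa> * \<tau> \<le> \<bar>\<phi> x - \<phi> y\<bar> * \<bar>\<Phi> i x y - c i\<bar>"
      using xy i c(1) \<open>0 < \<kappa>\<close> by (intro mult_mono) auto
    ultimately show ?thesis using i(1) by (intro bexI[of _ i]) simp_all
  qed
  then show ?thesis using c(1,2) \<open>0 < \<kappa>\<close> by (intro exI[of _ c] exI[of _ "\<kappa> * \<tau>"]) auto
qed

text \<open>Induction over the coordinates: adding a small multiple of \<open>P x w\<close>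
  separates the pairs that differ in coordinate \<open>w\<close>. As \<open>|P x w| \<le> 1\<close>,
  the correction is uniformly small and costs at most half of the margin won for the earlier
  coordinates.\<close>

lemma separate_points_coords:
  fixes \<psi> :: "'i \<Rightarrow> 'x \<Rightarrow> real" and P :: "'x \<Rightarrow> nat \<Rightarrow> real"
  assumes d: "covering_exponent d a" "\<And>x y. 0 \<le> d x y" and I: "finite I" "2 * a < card I"
    and lip: "\<And>i. i \<in> I \<Longrightarrow> lipschitz_wrt d (\<psi> i)" "\<And>v. v \<in> V \<Longrightarrow> lipschitz_wrt d (\<lambda>x. P x v)"
    and bd: "\<And>x v. \<bar>P x v\<bar> \<le> 1" "\<And>i x. i \<in> I \<Longrightarrow> \<bar>\<psi> i x\<bar> \<le> B"
    and "finite V" "0 < \<kappa>" "0 < \<eta>"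
  shows "\<exists>\<psi>' \<tau>. 0 < \<tau> \<and> (\<forall>i\<in>I. lipschitz_wrt d (\<psi>' i) \<and> (\<forall>x. \<bar>\<psi>' i x - \<psi> i x\<bar> < \<eta>)) \<and>
    (\<forall>v\<in>V. \<forall>x y. \<kappa> \<le> \<bar>P x v - P y v\<bar> \<longrightarrow> (\<exists>i\<in>I. \<tau> \<le> \<bar>\<psi>' i x - \<psi>' i y\<bar>))"
  using \<open>finite V\<close> lip(2) \<open>0 < \<eta>\<close>
proof (induction V arbitrary: \<eta> rule: finite_induct)
  case empty
  show ?case by (rule exI[of _ \<psi>], rule exI[of _ 1]) (use lip(1) empty in auto)
next
  case (insert w V)
  have "0 < \<eta> / 2" using insert.prems by simp
  from insert.IH[OF insert.prems(1) this]
  obtain \<psi>1 \<tau>1 where "0 < \<tau>1 \<and> (\<forall>i\<in>I. lipschitz_wrt d (\<psi>1 i) \<and> (\<forall>x. \<bar>\<psi>1 i x - \<psi> i x\<bar> < \<eta> / 2)) \<and>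
    (\<forall>v\<in>V. \<forall>x y. \<kappa> \<le> \<bar>P x v - P y v\<bar> \<longrightarrow> (\<exists>i\<in>I. \<tau>1 \<le> \<bar>\<psi>1 i x - \<psi>1 i y\<bar>))"
    by auto
  then have 1: "0 < \<tau>1" "\<And>i. i \<in> I \<Longrightarrow> lipschitz_wrt d (\<psi>1 i)"
    "\<And>i x. i \<in> I \<Longrightarrow> \<bar>\<psi>1 i x - \<psi> i x\<bar> < \<eta> / 2" 
    "\<And>v x y. v \<in> V \<Longrightarrow> \<kappa> \<le> \<bar>P x v - P y v\<bar> \<Longrightarrow> \<exists>i\<in>I. \<tau>1 \<le> \<bar>\<psi>1 i x - \<psi>1 i y\<bar>"
    by blast+
  have bd1: "\<bar>\<psi>1 i x\<bar> \<le> B + \<eta>" if "i \<in> I" for i x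
    using 1(3)[OF that, of x] bd(2)[OF that, of x] insert.prems(2) by linarith
  define \<eta>' where "\<eta>' = min (\<eta> / 2) (\<tau>1 / 4)"
  have \<eta>': "0 < \<eta>'" "\<eta>' \<le> \<eta> / 2" "\<eta>' \<le> \<tau>1 / 4" using 1(1) insert.prems(2) by (auto simp: \<eta>'_def)
  have lipw: "lipschitz_wrt d (\<lambda>x. P x w)" using insert.prems(1) by blast
  from separate_points_single[where \<psi>=\<psi>1 and \<phi>="\<lambda>x. P x w", OF d I 1(2) lipw bd(1) bd1 \<open>0 < \<kappa>\<close> \<eta>'(1)]
  obtain c \<tau> where "0 < \<tau> \<and> (\<forall>i\<in>I. \<bar>c i\<bar> < \<eta>') \<and>
    (\<forall>x y. \<kappa> \<le> \<bar>P x w - P y w\<bar> \<longrightarrow>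
       (\<exists>i\<in>I. \<tau> \<le> \<bar>(\<psi>1 i x + c i * P x w) - (\<psi>1 i y + c i * P y w)\<bar>))"
    by auto
  then have c: "0 < \<tau>" "\<And>i. i \<in> I \<Longrightarrow> \<bar>c i\<bar> < \<eta>'"
    "\<And>x y. \<kappa> \<le> \<bar>P x w - P y w\<bar> \<Longrightarrow>
       \<exists>i\<in>I. \<tau> \<le> \<bar>(\<psi>1 i x + c i * P x w) - (\<psi>1 i y + c i * P y w)\<bar>"
    by blast+
  have cP: "\<bar>c i * P x w\<bar> < \<eta>'" if "i \<in> I" for i x
  proof -
    have "\<bar>c i * P x w\<bar> \<le> \<bar>c i\<bar> * 1" unfolding abs_mult by (intro mult_left_mono bd(1)) auto
    then show ?thesis using c(2)[OF that] by linarith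
  qed
  define \<psi>' where "\<psi>' i x = \<psi>1 i x + c i * P x w" for i x
  define \<tau>' where "\<tau>' = min \<tau> (\<tau>1 / 2)"
  have "lipschitz_wrt d (\<psi>' i)" if "i \<in> I" for i
    unfolding \<psi>'_def by (rule lipschitz_wrt_add_mult[OF 1(2)[OF that] lipw d(2)])
  moreover have "\<bar>\<psi>' i x - \<psi> i x\<bar> < \<eta>" if "i \<in> I" for i x
    using cP[OF that, of x] 1(3)[OF that, of x] \<eta>'(2) unfolding \<psi>'_def by linarith
  moreover have "\<exists>i\<in>I. \<tau>' \<le> \<bar>\<psi>' i x - \<psi>' i y\<bar>"
    if v: "v \<in> insert w V" and xy: "\<kappa> \<le> \<bar>P x v - P y v\<bar>" for v x y
  proof (cases "v = w")
    case True
    then obtain i where "i \<in> I" "\<tau> \<le> \<bar>(\<psi>1 i x + c i * P x w) - (\<psi>1 i y + c i * P y w)\<bar>"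
      using c(3)[of x y] xy by blast
    then show ?thesis by (intro bexI[of _ i]) (auto simp: \<psi>'_def \<tau>'_def)
  next
    case False
    then obtain i where i: "i \<in> I" "\<tau>1 \<le> \<bar>\<psi>1 i x - \<psi>1 i y\<bar>" using 1(4)[of v x y] v xy by blast
    have "\<tau>1 / 2 \<le> \<bar>\<psi>' i x - \<psi>' i y\<bar>"
      using cP[OF i(1), of x] cP[OF i(1), of y] i(2) \<eta>'(3) unfolding \<psi>'_def by linarith
    moreover have "\<tau>' \<le> \<tau>1 / 2" by (simp add: \<tau>'_def)
    ultimately show ?thesis using i(1) by (intro bexI[of _ i]) linarith+
  qed
  ultimately show ?case using c(1) 1(1)
    by (intro exI[of _ \<psi>'] exI[of _ \<tau>']) (auto simp: \<tau>'_def)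
qed

text \<open>The witness is the inf-convolution of \<open>\<phi>\<close> with \<open>d / \<rho>\<close>.\<close>

lemma lipschitz_regularization:
  fixes d :: "'x \<Rightarrow> 'x \<Rightarrow> real"
  assumes d: "\<And>x y. 0 \<le> d x y" "\<And>x. d x x = 0" "\<And>x y. d x y = d y x"
      "\<And>x y z. d x z \<le> d x y + d y z"
    and \<phi>: "\<And>x. 0 \<le> \<phi> x" "\<And>x. \<phi> x \<le> 1"
    and "0 < \<rho>" "0 \<le> \<eta>" "\<And>x y. d x y < \<rho> \<Longrightarrow> \<bar>\<phi> x - \<phi> y\<bar> \<le> \<eta>"
  shows "\<exists>\<psi>. lipschitz_wrt d \<psi> \<and> (\<forall>x. \<bar>\<psi> x - \<phi> x\<bar> \<le> \<eta>)"
proof -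
  define \<psi> where "\<psi> x = (INF y. \<phi> y + d x y / \<rho>)" for x
  have bb: "bdd_below (range (\<lambda>y. \<phi> y + d x y / \<rho>))" for x
    by (rule bdd_belowI2[of _ 0]) (use d(1) \<phi>(1) \<open>0 < \<rho>\<close> in auto)
  have up: "\<psi> x \<le> \<phi> y + d x y / \<rho>" for x y
    unfolding \<psi>_def by (rule cINF_lower[OF bb]) simp
  have le: "\<psi> x \<le> \<psi> z + d x z / \<rho>" for x z
  proof -
    have "\<psi> x - d x z / \<rho> \<le> \<psi> z"
      unfolding \<psi>_def[of z]
    proof (rule cINF_greatest)
      fix y
      have "d x y / \<rho> \<le> d x z / \<rho> + d z y / \<rho>"
        using d(4)[of x y z] \<open>0 < \<rho>\<close> by (simp add: divide_right_mono flip: add_divide_distrib)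
      then show "\<psi> x - d x z / \<rho> \<le> \<phi> y + d z y / \<rho>" using up[of x y] by linarith
    qed simp
    then show ?thesis by linarith
  qed
  have "\<bar>\<psi> x - \<psi> z\<bar> \<le> d x z / \<rho>" for x z
    using le[of x z] le[of z x] by (simp add: d(3)[of z x] abs_le_iff)
  then have "lipschitz_wrt d \<psi>"
    unfolding lipschitz_wrt_def using \<open>0 < \<rho>\<close> by (intro exI[of _ "1 / \<rho>"]) auto
  moreover have "\<bar>\<psi> x - \<phi> x\<bar> \<le> \<eta>" for x
  proof -
    have "\<phi> x - \<eta> \<le> \<psi> x" unfolding \<psi>_def
    proof (rule cINF_greatest)
      fix y
      \<comment> \<open>Within distance \<open>\<rho>\<close> the function \<open>\<phi>\<close>
        changes by at most \<open>\<eta>\<close>; beyond it the penalty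
        \<open>d x y / \<rho>\<close> is at least 1, the whole range of
        \<open>\<phi>\<close>.\<close>
      show "\<phi> x - \<eta> \<le> \<phi> y + d x y / \<rho>"
      proof (cases "d x y < \<rho>")
        case True
        have "0 \<le> d x y / \<rho>" using d(1) \<open>0 < \<rho>\<close> by simp
        then show ?thesis using assms(9)[OF True] by linarith
      next
        case False
        then have "1 \<le> d x y / \<rho>" using \<open>0 < \<rho>\<close> by simp
        then show ?thesis using \<phi>(1)[of y] \<phi>(2)[of x] \<open>0 \<le> \<eta>\<close> by linarith
      qed
    qed simp
    moreover have "\<psi> x \<le> \<phi> x" using up[of x x] d(2) by simp
    ultimately show ?thesis using \<open>0 \<le> \<eta>\<close> by linarith
  qed
  ultimately show ?thesis by blast
qed

section \<open>Simplicial complexes and width dimension\<close>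

lemma realization_zero:
  assumes "p \<in> realization K" "i \<notin> \<Union>K"
  shows "p i = 0"
  using assms unfolding realization_def by blast

lemma support_in_complex:
  assumes K: "simplicial_complex K" and p: "p \<in> realization K"
  shows "{i. p i \<noteq> 0} \<in> K"
proof -
  obtain \<sigma> where \<sigma>: "\<sigma> \<in> K" "{i. p i \<noteq> 0} \<subseteq> \<sigma>" using p unfolding realization_def by blast
  have "{i. p i \<noteq> 0} \<noteq> {}"
  proof
    assume e: "{i. p i \<noteq> 0} = {}"
    have "(\<Sum>i\<in>{i. p i \<noteq> 0}. p i) = 1" using p unfolding realization_def by blast
    then show False unfolding e by simp
  qed
  then show ?thesis using \<sigma> K unfolding simplicial_complex_def by blast
qed

lemma realization_nonneg: "p \<in> realization K \<Longrightarrow> 0 \<le> p i"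
  unfolding realization_def by blast

lemma simplex_finite: "simplicial_complex K \<Longrightarrow> \<sigma> \<in> K \<Longrightarrow> finite \<sigma> \<and> \<sigma> \<noteq> {}"
  unfolding simplicial_complex_def by blast

lemma simplex_face: "simplicial_complex K \<Longrightarrow> \<sigma> \<in> K \<Longrightarrow> \<tau> \<subseteq> \<sigma> \<Longrightarrow> \<tau> \<noteq> {} \<Longrightarrow> \<tau> \<in> K"
  unfolding simplicial_complex_def by blast

lemma finite_vertices: "simplicial_complex K \<Longrightarrow> finite (\<Union>K)"
  unfolding simplicial_complex_def by blast

lemma realization_sum:
  assumes "p \<in> realization K" "finite V" "{i. p i \<noteq> 0} \<subseteq> V"
  shows "sum p V = 1"
proof -
  have "sum p V = (\<Sum>i\<in>{i. p i \<noteq> 0}. p i)"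
    by (rule sum.mono_neutral_right) (use assms in auto)
  then show ?thesis using assms(1) unfolding realization_def by simp
qed

lemma realization_le_1:
  assumes K: "simplicial_complex K" and p: "p \<in> realization K"
  shows "p i \<le> 1"
proof (cases "p i = 0")
  case False
  have f: "finite (\<Union>K)" by (rule finite_vertices[OF K])
  have sub: "{i. p i \<noteq> 0} \<subseteq> \<Union>K" using support_in_complex[OF K p] by blast
  have "p i \<le> sum p (\<Union>K)"
    by (rule member_le_sum) (use False sub f realization_nonneg[OF p] in auto)
  then show ?thesis using realization_sum[OF p f sub] by simp
qed simp

lemma card_simplex_le:
  assumes "simplicial_complex K" "\<sigma> \<in> K"
  shows "card \<sigma> \<le> Suc (complex_dim K)"
proof -
  have "finite K" using assms unfolding simplicial_complex_def by blast
  then have "card \<sigma> - 1 \<le> complex_dim K"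
    using assms unfolding complex_dim_def by (auto intro!: Max_ge)
  then show ?thesis by linarith
qed

lemma complex_dim_le:
  assumes "simplicial_complex K" "\<And>\<sigma>. \<sigma> \<in> K \<Longrightarrow> card \<sigma> \<le> Suc a"
  shows "complex_dim K \<le> a"
proof (cases "K = {}")
  case False
  have "finite K" using assms unfolding simplicial_complex_def by blast
  moreover have "card \<sigma> - 1 \<le> a" if "\<sigma> \<in> K" for \<sigma> using assms(2)[OF that] by linarith
  ultimately show ?thesis using False unfolding complex_dim_def by (auto intro!: Max.boundedI)
qed (simp add: complex_dim_def)

text \<open>A point of a simplex is determined up to \<open>O(1/G)\<close> by the integer parts of \<open>G\<close> times all but
  one of its barycentric coordinates.\<close>

lemma covering_exponent_realization:
  fixes f :: "'x \<Rightarrow> nat \<Rightarrow> real"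
  assumes K: "simplicial_complex K" and f: "range f \<subseteq> realization K"
  shows "covering_exponent (l1dist (\<Union>K) f) (complex_dim K)"
proof -
  define a where "a = complex_dim K"
  define V where "V = \<Union>K"
  have fV: "finite V" unfolding V_def by (rule finite_vertices[OF K])
  have fK: "finite K" using K unfolding simplicial_complex_def by blast
  have fr: "f x \<in> realization K" for x using f by blast
  define C where "C = real (card K) * 2 ^ a + 2 * real (card V) + 1"
  define S where "S x = {i. f x i \<noteq> 0}" for x
  define cod where "cod G x = (S x, restrict (\<lambda>i. nat \<lfloor>real G * f x i\<rfloor>) (S x - {Min (S x)}))" for G x
  have SK: "S x \<in> K" for x unfolding S_def by (rule support_in_complex[OF K fr])
  have S: "finite (S x)" "S x \<noteq> {}" "S x \<subseteq> V" for x
    using SK[of x] K unfolding simplicial_complex_def V_def by blast+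
  have "\<exists>\<C>. finite \<C> \<and> real (card \<C>) \<le> C * real G ^ a \<and> \<Union>\<C> = UNIV \<and>
       (\<forall>A\<in>\<C>. \<forall>x\<in>A. \<forall>y\<in>A. l1dist V f x y \<le> C / real G)" if G: "0 < G" for G :: nat
  proof -
    define Cod where "Cod = Sigma K (\<lambda>\<sigma>. PiE (\<sigma> - {Min \<sigma>}) (\<lambda>_. {..G}))"
    have fS: "finite \<sigma>" if "\<sigma> \<in> K" for \<sigma> using that K unfolding simplicial_complex_def by blast
    have fCod: "finite Cod" unfolding Cod_def by (intro finite_SigmaI fK finite_PiE) (auto simp: fS)
    have "card Cod = (\<Sum>\<sigma>\<in>K. Suc G ^ card (\<sigma> - {Min \<sigma>}))"
      unfolding Cod_def using fS fK by (subst card_SigmaI) (auto intro!: finite_PiE simp: card_PiE)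
    also have "\<dots> \<le> (\<Sum>\<sigma>\<in>K. Suc G ^ a)"
    proof (intro sum_mono power_increasing)
      fix \<sigma> assume \<sigma>: "\<sigma> \<in> K"
      have "\<sigma> \<noteq> {}" using \<sigma> K unfolding simplicial_complex_def by blast
      then have "card (\<sigma> - {Min \<sigma>}) = card \<sigma> - 1" using fS[OF \<sigma>] by (simp add: card_Diff_singleton)
      then show "card (\<sigma> - {Min \<sigma>}) \<le> a" using card_simplex_le[OF K \<sigma>] unfolding a_def by linarith
    qed simp
    also have "\<dots> = card K * Suc G ^ a" by simp
    also have "\<dots> \<le> card K * (2 * G) ^ a" using G by (intro mult_left_mono power_mono) auto
    finally have "real (card Cod) \<le> real (card K * (2 * G) ^ a)" by (simp only: of_nat_le_iff)
    also have "\<dots> = real (card K) * 2 ^ a * real G ^ a" by (simp add: power_mult_distrib)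
    also have "\<dots> \<le> C * real G ^ a" by (intro mult_right_mono) (auto simp: C_def)
    finally have cCod: "real (card Cod) \<le> C * real G ^ a" .
    have inCod: "cod G x \<in> Cod" for x
    proof -
      have "nat \<lfloor>real G * f x i\<rfloor> \<le> G" for i
      proof -
        have "real G * f x i \<le> real G * 1" using realization_le_1[OF K fr] by (intro mult_left_mono) auto
        then have "\<lfloor>real G * f x i\<rfloor> \<le> int G" by (simp add: floor_le_iff)
        then show ?thesis by simp
      qed
      then show ?thesis using SK by (auto simp: cod_def Cod_def)
    qed
    define \<C> where "\<C> = (\<lambda>c. {x. cod G x = c}) ` Cod"
    have "finite \<C>" unfolding \<C>_def using fCod by simp
    moreover have "real (card \<C>) \<le> C * real G ^ a"
      using card_image_le[OF fCod, of "\<lambda>c. {x. cod G x = c}"] cCod unfolding \<C>_def by linarith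
    moreover have "\<Union>\<C> = UNIV" unfolding \<C>_def using inCod by blast
    moreover have "l1dist V f x y \<le> C / real G" if xy: "cod G x = cod G y" for x y
    proof -
      define m where "m = Min (S x)"
      have SS: "S y = S x" using xy by (simp add: cod_def)
      have m: "m \<in> S x" unfolding m_def using S by (simp add: Min_in)
      have out: "f x i = 0" "f y i = 0" if "i \<notin> S x" for i
        using that SS unfolding S_def by blast+
      have near: "\<bar>f x i - f y i\<bar> \<le> 1 / real G" if i: "i \<noteq> m" for i
      proof (cases "i \<in> S x")
        case True
        then have "nat \<lfloor>real G * f x i\<rfloor> = nat \<lfloor>real G * f y i\<rfloor>"
          using xy i SS unfolding cod_def m_def by (auto dest: fun_cong[of _ _ i])
        moreover have "0 \<le> \<lfloor>real G * f x i\<rfloor>" "0 \<le> \<lfloor>real G * f y i\<rfloor>"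
          using realization_nonneg[OF fr] by auto
        ultimately have "\<bar>real G * f x i - real G * f y i\<bar> \<le> 1" by linarith
        then have "\<bar>f x i - f y i\<bar> * real G \<le> 1"
          by (metis abs_mult abs_of_nat mult.commute right_diff_distrib)
        then show ?thesis using G by (simp add: pos_le_divide_eq)
      next
        case False
        then show ?thesis using out by simp
      qed
      have mV: "m \<in> V" using m S by blast
      have s1: "f x m + sum (f x) (V - {m}) = 1" "f y m + sum (f y) (V - {m}) = 1"
        using realization_sum[OF fr fV, of x] realization_sum[OF fr fV, of y] S(3)[of x] S(3)[of y]
          sum.remove[OF fV mV, of "f x"] sum.remove[OF fV mV, of "f y"] unfolding S_def by simp_all
      have le: "(\<Sum>i\<in>V - {m}. \<bar>f x i - f y i\<bar>) \<le> real (card V) * (1 / real G)"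
      proof -
        have "(\<Sum>i\<in>V - {m}. \<bar>f x i - f y i\<bar>) \<le> real (card (V - {m})) * (1 / real G)"
          by (rule sum_bounded_above) (use near in auto)
        also have "\<dots> \<le> real (card V) * (1 / real G)"
          by (intro mult_right_mono) (auto intro!: card_mono fV)
        finally show ?thesis .
      qed
      \<comment> \<open>The coordinate missing from the code is one minus the others, so its error
        is at most the sum of theirs.\<close>
      have "f x m - f y m = (\<Sum>i\<in>V - {m}. f y i - f x i)" using s1 by (simp add: sum_subtractf)
      then have "\<bar>f x m - f y m\<bar> \<le> (\<Sum>i\<in>V - {m}. \<bar>f x i - f y i\<bar>)"
        using sum_abs[of "\<lambda>i. f y i - f x i" "V - {m}"] by (simp add: abs_minus_commute)
      then have "l1dist V f x y \<le> 2 * (real (card V) * (1 / real G))"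
        unfolding l1dist_def using le sum.remove[OF fV mV, of "\<lambda>i. \<bar>f x i - f y i\<bar>"] by linarith
      also have "\<dots> = 2 * real (card V) / real G" by simp
      also have "\<dots> \<le> C / real G" by (intro divide_right_mono) (auto simp: C_def)
      finally show ?thesis .
    qed
    ultimately show ?thesis unfolding \<C>_def by (intro exI[of _ \<C>]) (auto simp: \<C>_def)
  qed
  moreover have "0 < C" unfolding C_def by (simp add: add_nonneg_pos)
  ultimately show ?thesis unfolding covering_exponent_def V_def[symmetric] a_def[symmetric] by blast
qed

text \<open>The product of two realizations is triangulated by chains of pairs of vertices. The weight of
  the vertex \<open>(i, j)\<close> is the length of the intersection of the \<open>i\<close>-th interval of the partition of
  \<open>[0, 1]\<close> given by the first point with the \<open>j\<close>-th interval given by the second point.\<close>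

definition prod_weight :: "(nat \<Rightarrow> real) \<Rightarrow> (nat \<Rightarrow> real) \<Rightarrow> nat \<times> nat \<Rightarrow> real" where
  "prod_weight p q = (\<lambda>(i, j). max 0 (min (sum p {..i}) (sum q {..j}) - max (sum p {..<i}) (sum q {..<j})))"

definition prod_complex :: "nat set set \<Rightarrow> nat set set \<Rightarrow> nat set set" where
  "prod_complex K L = {prod_encode ` \<tau> | \<tau>. fst ` \<tau> \<in> K \<and> snd ` \<tau> \<in> L \<and>
     (\<forall>(i, j)\<in>\<tau>. \<forall>(i', j')\<in>\<tau>. i < i' \<longrightarrow> j \<le> j')}"

lemma finite_chain:
  assumes "finite (fst ` \<tau>)" "finite (snd ` \<tau>)"
  shows "finite \<tau>"
  by (rule finite_subset[of _ "fst ` \<tau> \<times> snd ` \<tau>"]) (use assms in force)+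

text \<open>The sum of the ranks of both coordinates increases strictly along a chain, and it takes
  at most \<open>card (fst\<close> \<tau>) + card (snd \<open>\<tau>) - 1\<close> values. This makes
  dimensions add up in the product triangulation.\<close>

lemma card_chain:
  fixes \<tau> :: "(nat \<times> nat) set"
  assumes f: "finite (fst ` \<tau>)" "finite (snd ` \<tau>)" and "\<tau> \<noteq> {}"
    and ch: "\<And>i j i' j'. (i, j) \<in> \<tau> \<Longrightarrow> (i', j') \<in> \<tau> \<Longrightarrow> i < i' \<Longrightarrow> j \<le> j'"
  shows "Suc (card \<tau>) \<le> card (fst ` \<tau>) + card (snd ` \<tau>)"
proof -
  define r where "r A i = card {i'\<in>A. i' < i}" for A :: "nat set" and i
  have rm: "r A i \<le> r A i'" if "i \<le> i'" "finite A" for A i i'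
    unfolding r_def using that by (intro card_mono) auto
  have rs: "r A i < r A i'" if "i < i'" "i \<in> A" "finite A" for A i i'
    unfolding r_def using that by (intro psubset_card_mono) auto
  have rl: "r A i < card A" if "i \<in> A" "finite A" for A i
    unfolding r_def using that by (intro psubset_card_mono) auto
  define R where "R = (\<lambda>(i, j). r (fst ` \<tau>) i + r (snd ` \<tau>) j)"
  have "inj_on R \<tau>"
  proof (rule inj_onI)
    fix u v assume u: "u \<in> \<tau>" and v: "v \<in> \<tau>" and e: "R u = R v"
    obtain i j i' j' where uv: "u = (i, j)" "v = (i', j')" by (cases u, cases v) auto
    have mem: "i \<in> fst ` \<tau>" "i' \<in> fst ` \<tau>" "j \<in> snd ` \<tau>" "j' \<in> snd ` \<tau>" using u v uv by force+
    have lt: "R u < R v" if "(i < i' \<and> j \<le> j') \<or> (i \<le> i' \<and> j < j')"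
      using that rs[of i i' "fst ` \<tau>"] rm[of j j' "snd ` \<tau>"] rm[of i i' "fst ` \<tau>"] rs[of j j' "snd ` \<tau>"] mem f
      by (auto simp: R_def uv intro: add_less_le_mono add_le_less_mono)
    have gt: "R v < R u" if "(i' < i \<and> j' \<le> j) \<or> (i' \<le> i \<and> j' < j)"
      using that rs[of i' i "fst ` \<tau>"] rm[of j' j "snd ` \<tau>"] rm[of i' i "fst ` \<tau>"] rs[of j' j "snd ` \<tau>"] mem f
      by (auto simp: R_def uv intro: add_less_le_mono add_le_less_mono)
    have c1: "i < i' \<Longrightarrow> j \<le> j'" and c2: "i' < i \<Longrightarrow> j' \<le> j" using ch u v uv by blast+
    show "u = v"
    proof (rule ccontr)
      assume "u \<noteq> v"
      then have "i < i' \<or> i' < i \<or> (i = i' \<and> j < j') \<or> (i = i' \<and> j' < j)" unfolding uv by auto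
      then show False using lt gt c1 c2 e by auto
    qed
  qed
  moreover have "R ` \<tau> \<subseteq> {..<card (fst ` \<tau>) + card (snd ` \<tau>) - 1}"
  proof
    fix w assume "w \<in> R ` \<tau>"
    then obtain i j where ij: "(i, j) \<in> \<tau>" "w = r (fst ` \<tau>) i + r (snd ` \<tau>) j" by (auto simp: R_def)
    have "i \<in> fst ` \<tau>" "j \<in> snd ` \<tau>" using ij by force+
    then show "w \<in> {..<card (fst ` \<tau>) + card (snd ` \<tau>) - 1}"
      using rl[of i "fst ` \<tau>"] rl[of j "snd ` \<tau>"] f ij(2) by auto
  qed
  ultimately have "card \<tau> \<le> card (fst ` \<tau>) + card (snd ` \<tau>) - 1"
    by (metis card_inj_on_le card_lessThan finite_lessThan)
  moreover have "0 < card (fst ` \<tau>)" using f(1) \<open>\<tau> \<noteq> {}\<close> by (simp add: card_gt_0_iff)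
  ultimately show ?thesis by linarith
qed

lemma simplicial_complex_prod:
  assumes K: "simplicial_complex K" and L: "simplicial_complex L"
  shows "simplicial_complex (prod_complex K L)" "complex_dim (prod_complex K L) \<le> complex_dim K + complex_dim L"
proof -
  have fin: "finite (fst ` \<tau>)" "finite (snd ` \<tau>)" "\<tau> \<noteq> {}"
    if t: "fst ` \<tau> \<in> K" "snd ` \<tau> \<in> L" for \<tau>
    using simplex_finite[OF K t(1)] simplex_finite[OF L t(2)] by auto
  show sc: "simplicial_complex (prod_complex K L)"
    unfolding simplicial_complex_def
  proof (intro conjI ballI allI impI)
    have "prod_complex K L \<subseteq> (\<lambda>\<tau>. prod_encode ` \<tau>) ` Pow (\<Union>K \<times> \<Union>L)"
    proof
      fix \<sigma> assume "\<sigma> \<in> prod_complex K L"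
      then obtain \<tau> where \<tau>: "\<sigma> = prod_encode ` \<tau>" "fst ` \<tau> \<in> K" "snd ` \<tau> \<in> L"
        unfolding prod_complex_def by blast
      have "\<tau> \<subseteq> fst ` \<tau> \<times> snd ` \<tau>" by force
      also have "\<dots> \<subseteq> \<Union>K \<times> \<Union>L" using \<tau>(2,3) by (intro Sigma_mono) auto
      finally show "\<sigma> \<in> (\<lambda>\<tau>. prod_encode ` \<tau>) ` Pow (\<Union>K \<times> \<Union>L)" using \<tau>(1) by blast
    qed
    then show "finite (prod_complex K L)"
      by (rule finite_subset) (use finite_vertices[OF K] finite_vertices[OF L] in auto)
  next
    fix \<sigma> assume "\<sigma> \<in> prod_complex K L"
    then obtain \<tau> where \<tau>: "\<sigma> = prod_encode ` \<tau>" "fst ` \<tau> \<in> K" "snd ` \<tau> \<in> L"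
      unfolding prod_complex_def by blast
    show "finite \<sigma>" "\<sigma> \<noteq> {}"
      using finite_chain[OF fin(1,2)[OF \<tau>(2,3)]] fin(3)[OF \<tau>(2,3)] unfolding \<tau>(1) by simp_all
  next
    fix \<sigma> \<rho> assume "\<sigma> \<in> prod_complex K L" and \<rho>: "\<rho> \<subseteq> \<sigma> \<and> \<rho> \<noteq> {}"
    then obtain \<tau> where \<tau>: "\<sigma> = prod_encode ` \<tau>" "fst ` \<tau> \<in> K" "snd ` \<tau> \<in> L"
      "\<forall>(i, j)\<in>\<tau>. \<forall>(i', j')\<in>\<tau>. i < i' \<longrightarrow> j \<le> j'"
      unfolding prod_complex_def by blast
    obtain \<tau>' where \<tau>': "\<tau>' \<subseteq> \<tau>" "\<rho> = prod_encode ` \<tau>'" using \<rho> \<tau>(1) subset_image_iff[of \<rho> prod_encode \<tau>] by blast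
    have "\<tau>' \<noteq> {}" using \<rho> \<tau>' by blast
    then have "fst ` \<tau>' \<in> K" "snd ` \<tau>' \<in> L"
      using simplex_face[OF K \<tau>(2) image_mono[OF \<tau>'(1)]] simplex_face[OF L \<tau>(3) image_mono[OF \<tau>'(1)]] by simp_all
    moreover have "\<forall>(i, j)\<in>\<tau>'. \<forall>(i', j')\<in>\<tau>'. i < i' \<longrightarrow> j \<le> j'" using \<tau>(4) \<tau>'(1) by blast
    ultimately show "\<rho> \<in> prod_complex K L" unfolding prod_complex_def using \<tau>'(2) by blast
  qed
  show "complex_dim (prod_complex K L) \<le> complex_dim K + complex_dim L"
  proof (rule complex_dim_le[OF sc])
    fix \<sigma> assume "\<sigma> \<in> prod_complex K L"
    then obtain \<tau> where \<tau>: "\<sigma> = prod_encode ` \<tau>" "fst ` \<tau> \<in> K" "snd ` \<tau> \<in> L"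
      "\<forall>(i, j)\<in>\<tau>. \<forall>(i', j')\<in>\<tau>. i < i' \<longrightarrow> j \<le> j'"
      unfolding prod_complex_def by blast
    have "card \<sigma> = card \<tau>" unfolding \<tau>(1) by (intro card_image inj_prod_encode)
    moreover have "Suc (card \<tau>) \<le> card (fst ` \<tau>) + card (snd ` \<tau>)"
      by (rule card_chain) (use fin[OF \<tau>(2,3)] \<tau>(4) in auto)
    ultimately show "card \<sigma> \<le> Suc (complex_dim K + complex_dim L)"
      using card_simplex_le[OF K \<tau>(2)] card_simplex_le[OF L \<tau>(3)] by linarith
  qed
qed

text \<open>The intervals \<open>[Q j, Q (Suc j)]\<close> tile \<open>[Q 0, Q n]\<close>, so the
  overlaps of \<open>[a, b]\<close> with them add up to its overlap with the whole.\<close>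

lemma sum_interval_overlap:
  fixes Q :: "nat \<Rightarrow> real"
  assumes Q: "\<And>j. Q j \<le> Q (Suc j)" "Q 0 \<le> a" and "a \<le> b"
  shows "(\<Sum>j<n. max 0 (min b (Q (Suc j)) - max a (Q j))) = max 0 (min b (Q n) - a)"
proof (induction n)
  case 0
  then show ?case using Q(2) by simp
next
  case (Suc n)
  then show ?case using Q(1)[of n] \<open>a \<le> b\<close> by (simp add: max_def min_def)
qed

text \<open>The weights are the monotone coupling of two probability vectors. Its marginals give
  back \<open>p\<close> and, by symmetry, \<open>q\<close>, which is why \<open>prod_point\<close>
  loses no information.\<close>

lemma sum_prod_weight:
  assumes p: "\<And>i. 0 \<le> p i" and q: "\<And>j. 0 \<le> q j" and le: "sum p {..i} \<le> sum q {..<n}"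
  shows "(\<Sum>j<n. prod_weight p q (i, j)) = p i"
proof -
  have e: "prod_weight p q (i, j) = max 0 (min (sum p {..i}) (sum q {..<Suc j}) - max (sum p {..<i}) (sum q {..<j}))" for j
    by (simp add: prod_weight_def lessThan_Suc_atMost)
  have s: "sum p {..i} = sum p {..<i} + p i" by (simp add: lessThan_Suc_atMost[symmetric])
  have "(\<Sum>j<n. prod_weight p q (i, j)) = max 0 (min (sum p {..i}) (sum q {..<n}) - sum p {..<i})"
    unfolding e by (rule sum_interval_overlap) (use p q s in \<open>auto simp: sum_nonneg\<close>)
  then show ?thesis using le s p[of i] by simp
qed

lemma prod_weight_commute: "prod_weight p q (i, j) = prod_weight q p (j, i)"
  by (simp add: prod_weight_def min.commute max.commute)

definition prod_point :: "(nat \<Rightarrow> real) \<Rightarrow> (nat \<Rightarrow> real) \<Rightarrow> nat \<Rightarrow> real" where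
  "prod_point p q m = prod_weight p q (prod_decode m)"

lemma prod_weight_nonneg: "0 \<le> prod_weight p q u"
  by (cases u) (simp add: prod_weight_def)

lemma realization_bound:
  assumes "simplicial_complex K"
  shows "\<exists>n. \<forall>p\<in>realization K. sum p {..<n} = 1 \<and> (\<forall>i\<ge>n. p i = 0)"
proof -
  obtain n where n: "\<Union>K \<subseteq> {..<n}" using finite_vertices[OF assms] finite_nat_iff_bounded by blast
  have z: "p i = 0" if "p \<in> realization K" "n \<le> i" for p i
    by (rule realization_zero[OF that(1)]) (use n that(2) in force)
  have "sum p {..<n} = 1" if "p \<in> realization K" for p
    by (rule realization_sum[OF that]) (use z[OF that] in \<open>auto simp: not_le[symmetric]\<close>)
  with z show ?thesis by (intro exI[of _ n]) simp
qed

lemma realization_partial_sum: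
  assumes "simplicial_complex K" "p \<in> realization K"
  shows "sum p {..i} \<le> 1"
proof -
  obtain n where n: "sum p {..<n} = 1" "\<And>i. n \<le> i \<Longrightarrow> p i = 0"
    using realization_bound[OF assms(1)] assms(2) by blast
  have "sum p {..i} \<le> sum p {..<n + Suc i}"
    using realization_nonneg[OF assms(2)] by (intro sum_mono2) auto
  also have "\<dots> = sum p {..<n}"
    by (rule sum.mono_neutral_right) (use n(2) in auto)
  finally show ?thesis using n(1) by simp
qed

lemma prod_weight_marginal:
  assumes K: "simplicial_complex K" and p: "p \<in> realization K" and q: "q \<in> realization L"
    and n: "sum q {..<n} = 1"
  shows "(\<Sum>j<n. prod_weight p q (i, j)) = p i"
  by (rule sum_prod_weight) (use realization_nonneg[OF p] realization_nonneg[OF q] realization_partial_sum[OF K p] n in auto)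

lemma prod_point_inj:
  assumes K: "simplicial_complex K" and L: "simplicial_complex L"
    and p: "p \<in> realization K" "p' \<in> realization K" and q: "q \<in> realization L" "q' \<in> realization L"
    and e: "prod_point p q = prod_point p' q'"
  shows "p = p' \<and> q = q'"
proof -
  have e': "prod_weight p q (i, j) = prod_weight p' q' (i, j)" for i j
    using fun_cong[OF e, of "prod_encode (i, j)"] by (simp add: prod_point_def)
  have e'': "prod_weight q p (j, i) = prod_weight q' p' (j, i)" for i j
    using e'[of i j] prod_weight_commute[of p q i j] prod_weight_commute[of p' q' i j] by simp
  obtain n where n: "\<And>p. p \<in> realization K \<Longrightarrow> sum p {..<n} = 1" using realization_bound[OF K] by blast
  obtain m where m: "\<And>p. p \<in> realization L \<Longrightarrow> sum p {..<m} = 1" using realization_bound[OF L] by blast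
  have "p i = p' i" for i
    using prod_weight_marginal[OF K p(1) q(1) m[OF q(1)], of i]
      prod_weight_marginal[OF K p(2) q(2) m[OF q(2)], of i] e' by simp
  moreover have "q j = q' j" for j
    using prod_weight_marginal[OF L q(1) p(1) n[OF p(1)], of j]
      prod_weight_marginal[OF L q(2) p(2) n[OF p(2)], of j] e'' by simp
  ultimately show ?thesis by auto
qed

lemma prod_point_realization:
  assumes K: "simplicial_complex K" and L: "simplicial_complex L"
    and p: "p \<in> realization K" and q: "q \<in> realization L"
  shows "prod_point p q \<in> realization (prod_complex K L)"
proof -
  define \<tau> where "\<tau> = {u. prod_weight p q u \<noteq> 0}"
  obtain n where n: "sum p {..<n} = 1" "\<And>i. n \<le> i \<Longrightarrow> p i = 0" using realization_bound[OF K] p by blast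
  obtain m where m: "sum q {..<m} = 1" "\<And>i. m \<le> i \<Longrightarrow> q i = 0" using realization_bound[OF L] q by blast
  have s: "sum p {..i} = sum p {..<i} + p i" "sum q {..j} = sum q {..<j} + q j" for i j
    by (simp_all add: lessThan_Suc_atMost[symmetric])
  have pn: "0 \<le> p i" and qn: "0 \<le> q i" for i using realization_nonneg p q by blast+
  have lt: "max (sum p {..<i}) (sum q {..<j}) < min (sum p {..i}) (sum q {..j})" if "(i, j) \<in> \<tau>" for i j
    using that unfolding \<tau>_def prod_weight_def by (auto simp: max_def split: if_splits)
  have pos: "p i \<noteq> 0" "q j \<noteq> 0" if "(i, j) \<in> \<tau>" for i j
    using lt[OF that] s(1)[of i] s(2)[of j] by (auto simp: max_def min_def split: if_splits)
  have mono: "sum p {..i} \<le> sum p {..<i'}" "sum q {..i} \<le> sum q {..<i'}" if "i < i'" for i i'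
    by (intro sum_mono2; use that pn qn in auto)+
  \<comment> \<open>If \<open>i < i'\<close> but \<open>j' < j\<close>, the overlap belonging to
    \<open>(i, j)\<close> would lie to the left of the one belonging to \<open>(i', j')\<close> by
    the first partition and to its right by the second.\<close>
  have chain: "j \<le> j'" if "(i, j) \<in> \<tau>" "(i', j') \<in> \<tau>" "i < i'" for i j i' j'
  proof (rule ccontr)
    assume "\<not> j \<le> j'"
    then have "j' < j" by simp
    then show False using lt[OF that(1)] lt[OF that(2)] mono(1)[OF that(3)] mono(2)[of j' j] by simp
  qed
  have sub: "\<tau> \<subseteq> {..<n} \<times> {..<m}"
  proof
    fix u assume u: "u \<in> \<tau>"
    obtain i j where ij: "u = (i, j)" by (cases u)
    have "p i \<noteq> 0" "q j \<noteq> 0" using pos u ij by blast+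
    then have "i < n" "j < m" using n(2) m(2) not_le by blast+
    then show "u \<in> {..<n} \<times> {..<m}" using ij by simp
  qed
  then have f\<tau>: "finite \<tau>" by (rule finite_subset) simp
  have total: "sum (prod_weight p q) \<tau> = 1"
  proof -
    have "sum (prod_weight p q) \<tau> = sum (prod_weight p q) ({..<n} \<times> {..<m})"
      by (rule sum.mono_neutral_left) (use sub in \<open>auto simp: \<tau>_def\<close>)
    also have "\<dots> = (\<Sum>i<n. \<Sum>j<m. prod_weight p q (i, j))" by (simp add: sum.cartesian_product)
    also have "\<dots> = (\<Sum>i<n. p i)" by (simp add: prod_weight_marginal[OF K p q m(1)])
    finally show ?thesis using n(1) by simp
  qed
  then have "\<tau> \<noteq> {}" by auto
  have supp: "{k. prod_point p q k \<noteq> 0} = prod_encode ` \<tau>"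
  proof (intro equalityI subsetI)
    fix k assume "k \<in> {k. prod_point p q k \<noteq> 0}"
    then have "prod_decode k \<in> \<tau>" by (simp add: \<tau>_def prod_point_def)
    then show "k \<in> prod_encode ` \<tau>" by (metis image_eqI prod_decode_inverse)
  qed (auto simp: \<tau>_def prod_point_def)
  have "fst ` \<tau> \<in> K"
    by (rule simplex_face[OF K support_in_complex[OF K p]]) (use pos(1) \<open>\<tau> \<noteq> {}\<close> in auto)
  moreover have "snd ` \<tau> \<in> L"
    by (rule simplex_face[OF L support_in_complex[OF L q]]) (use pos(2) \<open>\<tau> \<noteq> {}\<close> in auto)
  ultimately have "prod_encode ` \<tau> \<in> prod_complex K L"
    unfolding prod_complex_def mem_Collect_eq using chain by (intro exI[of _ \<tau>]) auto
  moreover have "sum (prod_point p q) (prod_encode ` \<tau>) = 1"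
    using total by (subst sum.reindex) (auto simp: prod_point_def inj_prod_encode)
  ultimately show ?thesis
    unfolding realization_def mem_Collect_eq supp
    by (intro conjI allI bexI[of _ "prod_encode ` \<tau>"]) (simp_all add: prod_point_def prod_weight_nonneg)
qed

lemma continuous_on_prod_point:
  fixes f g :: "'a::topological_space \<Rightarrow> nat \<Rightarrow> real"
  assumes "continuous_on UNIV f" "continuous_on UNIV g"
  shows "continuous_on UNIV (\<lambda>x. prod_point (f x) (g x))"
proof (rule continuous_on_coordinatewise_then_product)
  fix k
  obtain i j where ij: "prod_decode k = (i, j)" by (cases "prod_decode k")
  have c: "continuous_on UNIV (\<lambda>x. f x v)" "continuous_on UNIV (\<lambda>x. g x v)" for v
    using assms[THEN continuous_on_product_then_coordinatewise] by auto
  show "continuous_on UNIV (\<lambda>x. prod_point (f x) (g x) k)"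
    unfolding prod_point_def ij prod_weight_def by (simp, intro continuous_intros c)
qed

section \<open>Maps with small fibres and subadditivity of the width dimension\<close>

lemma ddiam_less_iff:
  assumes "\<And>x y. d x y \<le> B" "0 < \<epsilon>"
  shows "ddiam d S < \<epsilon> \<longleftrightarrow> (\<exists>e<\<epsilon>. \<forall>x\<in>S. \<forall>y\<in>S. d x y \<le> e)"
proof (cases "S = {}")
  case True
  then show ?thesis using assms(2) unfolding ddiam_def by auto
next
  case False
  have bdd: "bdd_above ((\<lambda>p. d (fst p) (snd p)) ` (S \<times> S))"
    by (rule bdd_aboveI2[of _ _ B]) (use assms(1) in auto)
  have iff: "ddiam d S \<le> e \<longleftrightarrow> (\<forall>x\<in>S. \<forall>y\<in>S. d x y \<le> e)" for e
    unfolding ddiam_def using False by (subst if_not_P) (auto simp: cSUP_le_iff[OF _ bdd])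
  show ?thesis
  proof
    assume "ddiam d S < \<epsilon>"
    then show "\<exists>e<\<epsilon>. \<forall>x\<in>S. \<forall>y\<in>S. d x y \<le> e" using iff[of "ddiam d S"] by blast
  next
    assume "\<exists>e<\<epsilon>. \<forall>x\<in>S. \<forall>y\<in>S. d x y \<le> e"
    then obtain e where "e < \<epsilon>" "ddiam d S \<le> e" using iff by blast
    then show "ddiam d S < \<epsilon>" by simp
  qed
qed

definition widim_map :: "real \<Rightarrow> ('a::topological_space \<Rightarrow> 'a \<Rightarrow> real) \<Rightarrow> nat set set \<Rightarrow> ('a \<Rightarrow> nat \<Rightarrow> real) \<Rightarrow> bool" where
  "widim_map \<epsilon> d K f \<longleftrightarrow> simplicial_complex K \<and> continuous_on UNIV f \<and> range f \<subseteq> realization K \<and>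
     (\<forall>y. ddiam d {x. f x = y} < \<epsilon>)"

lemma widim_mapD:
  assumes "widim_map \<epsilon> d K f"
  shows "simplicial_complex K" "continuous_on UNIV f" "f x \<in> realization K"
proof -
  have "range f \<subseteq> realization K" using assms unfolding widim_map_def by simp
  then show "f x \<in> realization K" by blast
qed (use assms in \<open>simp_all add: widim_map_def\<close>)

lemma widim_eq: "widim \<epsilon> d = Inf {complex_dim K | K f. widim_map \<epsilon> d K f}"
  unfolding widim_def widim_map_def by simp

lemma widim_le: "widim_map \<epsilon> d K f \<Longrightarrow> widim \<epsilon> d \<le> complex_dim K"
  unfolding widim_eq by (rule cInf_lower) auto

text \<open>An infimum of naturals is attained only over a nonempty set, hence the demand for a
  first map \<open>f0\<close>; \<open>widim_map_exists\<close> supplies one.\<close>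

lemma widim_attained:
  assumes "widim_map \<epsilon> d K0 f0"
  obtains K f where "widim_map \<epsilon> d K f" "complex_dim K = widim \<epsilon> d"
proof -
  have "Inf {complex_dim K | K f. widim_map \<epsilon> d K f} \<in> {complex_dim K | K f. widim_map \<epsilon> d K f}"
    by (rule Inf_nat_def1) (use assms in blast)
  then have "\<exists>K f. widim_map \<epsilon> d K f \<and> complex_dim K = widim \<epsilon> d" unfolding widim_eq[symmetric] by auto
  then show ?thesis using that by blast
qed

lemma widim_map_fiber:
  assumes "widim_map \<epsilon> d K f" "\<And>x y. d x y \<le> B" "0 < \<epsilon>"
  shows "\<exists>e<\<epsilon>. \<forall>x y. f x = z \<longrightarrow> f y = z \<longrightarrow> d x y \<le> e"
proof -
  have "ddiam d {x. f x = z} < \<epsilon>" using assms(1) by (simp add: widim_map_def)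
  then have "\<exists>e<\<epsilon>. \<forall>x\<in>{x. f x = z}. \<forall>y\<in>{x. f x = z}. d x y \<le> e"
    by (subst (asm) ddiam_less_iff[OF assms(2,3)])
  then show ?thesis by (simp only: mem_Collect_eq Ball_def) blast
qed

lemma widim_mapI:
  assumes "simplicial_complex K" "continuous_on UNIV f" "range f \<subseteq> realization K"
    and "\<And>x y. d x y \<le> B" "0 < \<epsilon>" "\<And>z. \<exists>e<\<epsilon>. \<forall>x y. f x = z \<longrightarrow> f y = z \<longrightarrow> d x y \<le> e"
  shows "widim_map \<epsilon> d K f"
proof -
  have "ddiam d {x. f x = z} < \<epsilon>" for z
  proof (subst ddiam_less_iff[OF assms(4,5)])
    obtain e where "e < \<epsilon>" "\<forall>x y. f x = z \<longrightarrow> f y = z \<longrightarrow> d x y \<le> e" using assms(6)[of z] by blast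
    then show "\<exists>e<\<epsilon>. \<forall>x\<in>{x. f x = z}. \<forall>y\<in>{x. f x = z}. d x y \<le> e"
      by (intro exI[of _ e]) simp
  qed
  then show ?thesis using assms(1-3) by (simp add: widim_map_def)
qed

text \<open>Map to the nerve of a finite cover by small balls of \<open>d\<close>.\<close>

lemma widim_map_exists:
  fixes d :: "'a::topological_space \<Rightarrow> 'a \<Rightarrow> real"
  assumes "compact (UNIV :: 'a set)" and d: "\<And>x. d x x = 0" "\<And>x y. d x y = d y x"
    "\<And>x y z. d x z \<le> d x y + d y z" "\<And>x y. d x y \<le> B"
    and cont: "\<And>x. continuous_on UNIV (d x)" and "0 < \<epsilon>"
  shows "\<exists>K f. widim_map \<epsilon> d K f"
proof -
  define W where "W x = {y. d x y < \<epsilon> / 3}" for x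
  have "open (W x)" for x
    unfolding W_def using cont[of x] by (intro open_Collect_less continuous_intros) auto
  moreover have "x \<in> W x" for x using d(1) \<open>0 < \<epsilon>\<close> by (simp add: W_def)
  then have "UNIV \<subseteq> (\<Union>x. W x)" by blast
  ultimately obtain X where X: "finite X" "UNIV \<subseteq> (\<Union>x\<in>X. W x)"
    by (rule_tac compactE_image[OF assms(1), of UNIV W]) auto
  obtain xs where xs: "set xs = X" using X(1) finite_list by blast
  define n where "n = length xs"
  define b where "b i x = (if i < n then max 0 (\<epsilon> / 3 - d (xs ! i) x) else 0)" for i x
  define s where "s x = (\<Sum>i<n. b i x)" for x
  have bc: "continuous_on UNIV (b i)" for i
    unfolding b_def by (cases "i < n") (auto intro!: continuous_intros cont)
  have b0: "0 \<le> b i x" for i x by (simp add: b_def)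
  have s0: "0 < s x" for x
  proof -
    obtain y where "y \<in> X" "x \<in> W y" using X(2) by blast
    then obtain i where i: "i < n" "x \<in> W (xs ! i)" unfolding n_def xs[symmetric] by (metis in_set_conv_nth)
    then have "0 < b i x" by (simp add: b_def W_def)
    then show ?thesis unfolding s_def using i b0 by (intro sum_pos2[of _ i]) auto
  qed
  define f where "f x i = b i x / s x" for x i
  \<comment> \<open>The full simplex on the centres contains the nerve. Any finite dimension will
    do, since the map only has to show that the infimum in \<open>widim\<close> runs over a nonempty
    set.\<close>
  define K where "K = Pow {..<n} - {{}}"
  have K: "simplicial_complex K"
    unfolding simplicial_complex_def K_def by (auto intro: finite_subset)
  have fpos: "f x i \<noteq> 0 \<longleftrightarrow> b i x \<noteq> 0" for x i using s0[of x] by (simp add: f_def)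
  have supp: "{i. f x i \<noteq> 0} \<subseteq> {..<n}" for x unfolding fpos by (auto simp: b_def)
  have tot: "(\<Sum>i\<in>{i. f x i \<noteq> 0}. f x i) = 1" for x
  proof -
    have "(\<Sum>i\<in>{i. f x i \<noteq> 0}. f x i) = (\<Sum>i<n. f x i)"
      by (rule sum.mono_neutral_left) (use supp in auto)
    also have "\<dots> = s x / s x" unfolding f_def s_def by (simp only: sum_divide_distrib)
    finally show ?thesis using s0[of x] by simp
  qed
  have ne: "{i. f x i \<noteq> 0} \<noteq> {}" for x
  proof
    assume "{i. f x i \<noteq> 0} = {}"
    then show False using tot[of x] by simp
  qed
  have "range f \<subseteq> realization K"
  proof safe
    fix x
    have "0 \<le> f x i" for i using b0 s0[of x] by (simp add: f_def)
    moreover have "{i. f x i \<noteq> 0} \<in> K" using supp ne unfolding K_def by blast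
    ultimately show "f x \<in> realization K" 
      unfolding realization_def mem_Collect_eq using tot[of x] by (intro conjI allI bexI[of _ "{i. f x i \<noteq> 0}"]) auto
  qed
  moreover have "continuous_on UNIV f"
  proof (rule continuous_on_coordinatewise_then_product)
    fix i
    have "s x \<noteq> 0" for x using s0[of x] by simp
    then show "continuous_on UNIV (\<lambda>x. f x i)"
      unfolding f_def s_def by (intro continuous_intros bc) auto
  qed
  \<comment> \<open>Points of one fibre lie in a common ball of radius
    \<open>\<epsilon> / 3\<close>; the bound \<open>2 * \<epsilon> / 3\<close> leaves the strict
    slack that the supremum in \<open>ddiam\<close> requires.\<close>
  moreover have "\<exists>e<\<epsilon>. \<forall>x y. f x = z \<longrightarrow> f y = z \<longrightarrow> d x y \<le> e" for z
  proof (intro exI[of _ "2 * \<epsilon> / 3"] conjI allI impI)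
    fix x y assume xy: "f x = z" "f y = z"
    obtain i where "f x i \<noteq> 0" using ne by blast
    then have "b i x \<noteq> 0" "b i y \<noteq> 0" using xy fpos[of x i] fpos[of y i] by simp_all
    then have "d (xs ! i) x < \<epsilon> / 3" "d (xs ! i) y < \<epsilon> / 3" by (auto simp: b_def split: if_splits)
    then show "d x y \<le> 2 * \<epsilon> / 3" using d(3)[of x y "xs ! i"] d(2)[of x "xs ! i"] by linarith
  qed (use \<open>0 < \<epsilon>\<close> in auto)
  ultimately have "widim_map \<epsilon> d K f" by (intro widim_mapI[OF K _ _ d(4) \<open>0 < \<epsilon>\<close>]) auto
  then show ?thesis by blast
qed

text \<open>Optimal maps for \<open>d1\<close> and \<open>d2\<close> are paired into the product
  triangulation, whose dimension is at most the sum. Since \<open>prod_point\<close> is injective, a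
  fibre of the pair lies in a fibre of each map.\<close>

lemma widim_subadditive:
  fixes d1 d2 d :: "'a::topological_space \<Rightarrow> 'a \<Rightarrow> real"
  assumes "widim_map \<epsilon> d1 K1 f1" "widim_map \<epsilon> d2 K2 f2"
    and B: "\<And>x y. d1 x y \<le> B" "\<And>x y. d2 x y \<le> B" "\<And>x y. d x y \<le> B"
    and le: "\<And>x y. d x y \<le> max (d1 x y) (d2 x y)" and "0 < \<epsilon>"
  shows "widim \<epsilon> d \<le> widim \<epsilon> d1 + widim \<epsilon> d2"
proof -
  obtain K f where K: "widim_map \<epsilon> d1 K f" "complex_dim K = widim \<epsilon> d1" by (rule widim_attained[OF assms(1)])
  obtain L g where L: "widim_map \<epsilon> d2 L g" "complex_dim L = widim \<epsilon> d2" by (rule widim_attained[OF assms(2)])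
  note sK = widim_mapD[OF K(1)] and sL = widim_mapD[OF L(1)]
  have "widim_map \<epsilon> d (prod_complex K L) (\<lambda>x. prod_point (f x) (g x))"
  proof (rule widim_mapI[OF simplicial_complex_prod(1)[OF sK(1) sL(1)] continuous_on_prod_point[OF sK(2) sL(2)] _ B(3) \<open>0 < \<epsilon>\<close>])
    show "range (\<lambda>x. prod_point (f x) (g x)) \<subseteq> realization (prod_complex K L)"
      using prod_point_realization[OF sK(1) sL(1) sK(3) sL(3)] by auto
    fix z
    show "\<exists>e<\<epsilon>. \<forall>x y. prod_point (f x) (g x) = z \<longrightarrow> prod_point (f y) (g y) = z \<longrightarrow> d x y \<le> e"
    proof (cases "\<exists>x. prod_point (f x) (g x) = z")
      case True
      then obtain x0 where x0: "prod_point (f x0) (g x0) = z" by blast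
      obtain e1 where e1: "e1 < \<epsilon>" "\<And>x y. f x = f x0 \<Longrightarrow> f y = f x0 \<Longrightarrow> d1 x y \<le> e1"
        using widim_map_fiber[OF K(1) B(1) \<open>0 < \<epsilon>\<close>, of "f x0"] by blast
      obtain e2 where e2: "e2 < \<epsilon>" "\<And>x y. g x = g x0 \<Longrightarrow> g y = g x0 \<Longrightarrow> d2 x y \<le> e2"
        using widim_map_fiber[OF L(1) B(2) \<open>0 < \<epsilon>\<close>, of "g x0"] by blast
      have fib: "f x = f x0 \<and> g x = g x0" if "prod_point (f x) (g x) = z" for x
        by (rule prod_point_inj[OF sK(1) sL(1) sK(3) sK(3) sL(3) sL(3)]) (use that x0 in simp)
      have "d x y \<le> max e1 e2" if "prod_point (f x) (g x) = z" "prod_point (f y) (g y) = z" for x y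
        using fib[OF that(1)] fib[OF that(2)] e1(2)[of x y] e2(2)[of x y] le[of x y] by auto
      then show ?thesis using e1(1) e2(1) by (intro exI[of _ "max e1 e2"]) auto
    next
      case False
      then show ?thesis using \<open>0 < \<epsilon>\<close> by (intro exI[of _ 0]) auto
    qed
  qed
  then have "widim \<epsilon> d \<le> complex_dim (prod_complex K L)" by (rule widim_le)
  also have "\<dots> \<le> complex_dim K + complex_dim L" by (rule simplicial_complex_prod(2)[OF sK(1) sL(1)])
  finally show ?thesis using K(2) L(2) by simp
qed

section \<open>Width dimension along orbits\<close>

locale zk_system =
  fixes T :: "int^'k \<Rightarrow> 'a::metric_space \<Rightarrow> 'a"
  assumes compact_space: "compact (UNIV :: 'a set)" and action: "zk_action T"
begin

lemma T_0 [simp]: "T 0 x = x"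
  using action unfolding zk_action_def by simp

lemma T_add: "T (m + n) x = T m (T n x)"
  using action unfolding zk_action_def by simp

lemma T_T [simp]: "T m (T n x) = T (m + n) x"
  by (simp add: T_add)

lemma T_cont: "continuous_on A (T n)"
  using action continuous_on_subset unfolding zk_action_def by blast

lemma T_cont_comp: "continuous_on A f \<Longrightarrow> continuous_on A (\<lambda>x. T n (f x))"
  by (rule continuous_on_compose2[OF T_cont[of UNIV]]) auto

lemma dist_bounded: "\<exists>B. \<forall>x y :: 'a. dist x y \<le> B"
  using compact_imp_bounded[OF compact_space] unfolding bounded_two_points by blast

lemma dyn_dist_le_iff:
  assumes "finite A" "A \<noteq> {}"
  shows "dyn_dist T A x y \<le> e \<longleftrightarrow> (\<forall>n\<in>A. dist (T n x) (T n y) \<le> e)"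
  unfolding dyn_dist_def using assms by (intro cSUP_le_iff bdd_above_finite) auto

lemma dist_le_dyn_dist:
  assumes "finite A" "n \<in> A"
  shows "dist (T n x) (T n y) \<le> dyn_dist T A x y"
  using dyn_dist_le_iff[OF assms(1), of x y "dyn_dist T A x y"] assms(2) by blast

lemma dyn_dist_eq_Max:
  assumes "finite A" "A \<noteq> {}"
  shows "dyn_dist T A x y = Max ((\<lambda>n. dist (T n x) (T n y)) ` A)"
  unfolding dyn_dist_def using assms by (intro cSup_eq_Max) auto

lemma continuous_on_Max_image:
  fixes f :: "'i \<Rightarrow> 'b::topological_space \<Rightarrow> real"
  assumes "finite A" "A \<noteq> {}" "\<And>n. n \<in> A \<Longrightarrow> continuous_on S (f n)"
  shows "continuous_on S (\<lambda>x. Max ((\<lambda>n. f n x) ` A))"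
  using assms
proof (induction A rule: finite_ne_induct)
  case (insert n F)
  have "continuous_on S (\<lambda>x. max (f n x) (Max ((\<lambda>n. f n x) ` F)))"
    by (intro continuous_on_max insert.prems insert.IH) auto
  then show ?case using insert.hyps by simp
qed simp

lemma dyn_dist_props:
  assumes A: "finite A" "A \<noteq> {}"
  shows "dyn_dist T A x x = 0" "dyn_dist T A x y = dyn_dist T A y x"
    "dyn_dist T A x z \<le> dyn_dist T A x y + dyn_dist T A y z"
    "continuous_on UNIV (dyn_dist T A x)"
proof -
  show "dyn_dist T A x x = 0" using A unfolding dyn_dist_eq_Max[OF A] by simp
  show "dyn_dist T A x y = dyn_dist T A y x" by (simp add: dyn_dist_def dist_commute)
  show "dyn_dist T A x z \<le> dyn_dist T A x y + dyn_dist T A y z"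
    unfolding dyn_dist_le_iff[OF A]
  proof
    fix n assume n: "n \<in> A"
    show "dist (T n x) (T n z) \<le> dyn_dist T A x y + dyn_dist T A y z"
      using dist_triangle[of "T n x" "T n z" "T n y"] dist_le_dyn_dist[OF A(1) n, of x y]
        dist_le_dyn_dist[OF A(1) n, of y z] by linarith
  qed
  have "continuous_on UNIV (\<lambda>y. Max ((\<lambda>n. dist (T n x) (T n y)) ` A))"
    by (intro continuous_on_Max_image A continuous_intros T_cont)
  then show "continuous_on UNIV (dyn_dist T A x)" by (simp add: dyn_dist_eq_Max[OF A, abs_def])
qed

lemma dyn_dist_bounded:
  obtains B where "\<And>A x y. finite A \<Longrightarrow> A \<noteq> {} \<Longrightarrow> dyn_dist T A x y \<le> B"
  using dist_bounded dyn_dist_le_iff by metis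

lemma dyn_map_exists:
  assumes "finite A" "A \<noteq> {}" "0 < \<epsilon>"
  shows "\<exists>K f. widim_map \<epsilon> (dyn_dist T A) K f"
proof -
  obtain B where B: "\<And>A x y. finite A \<Longrightarrow> A \<noteq> {} \<Longrightarrow> dyn_dist T A x y \<le> B" using dyn_dist_bounded by blast
  show ?thesis
    by (rule widim_map_exists[OF compact_space dyn_dist_props(1-3)[OF assms(1,2)] B[OF assms(1,2)] dyn_dist_props(4)[OF assms(1,2)] assms(3)])
qed

lemma dyn_map_attained:
  assumes "finite A" "A \<noteq> {}" "0 < \<epsilon>"
  shows "\<exists>K f. widim_map \<epsilon> (dyn_dist T A) K f \<and> complex_dim K = widim \<epsilon> (dyn_dist T A)"
proof -
  obtain K f where "widim_map \<epsilon> (dyn_dist T A) K f" using dyn_map_exists[OF assms] by blast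
  then show ?thesis by (rule widim_attained) blast
qed

lemma widim_Un:
  assumes "finite A" "A \<noteq> {}" "finite B" "B \<noteq> {}" "0 < \<epsilon>"
  shows "widim \<epsilon> (dyn_dist T (A \<union> B)) \<le> widim \<epsilon> (dyn_dist T A) + widim \<epsilon> (dyn_dist T B)"
proof -
  obtain M where M: "\<And>A x y. finite A \<Longrightarrow> A \<noteq> {} \<Longrightarrow> dyn_dist T A x y \<le> M" using dyn_dist_bounded by blast
  obtain K f where 1: "widim_map \<epsilon> (dyn_dist T A) K f" using dyn_map_exists[OF assms(1,2,5)] by blast
  obtain L g where 2: "widim_map \<epsilon> (dyn_dist T B) L g" using dyn_map_exists[OF assms(3,4,5)] by blast
  have AB: "finite (A \<union> B)" "A \<union> B \<noteq> {}" using assms by auto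
  have "dyn_dist T (A \<union> B) x y \<le> max (dyn_dist T A x y) (dyn_dist T B x y)" for x y
    unfolding dyn_dist_le_iff[OF AB]
    using dist_le_dyn_dist[OF assms(1), of _ x y] dist_le_dyn_dist[OF assms(3), of _ x y] by (auto simp: le_max_iff_disj)
  from widim_subadditive[OF 1 2 M[OF assms(1,2)] M[OF assms(3,4)] M[OF AB] this \<open>0 < \<epsilon>\<close>]
  show ?thesis .
qed

text \<open>An optimal map for \<open>B\<close>, composed with \<open>T n\<close>, serves every
  window inside a translate of \<open>B\<close>. With \<open>n = 0\<close> this also gives
  monotonicity in the window and in \<open>\<epsilon>\<close>.\<close>

lemma widim_pullback:
  assumes A: "finite A" "A \<noteq> {}" and B: "finite B" "B \<noteq> {}" and "0 < \<epsilon>" "\<epsilon> \<le> \<epsilon>'"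
    and sub: "A \<subseteq> (+) n ` B"
  shows "widim \<epsilon>' (dyn_dist T A) \<le> widim \<epsilon> (dyn_dist T B)"
proof -
  obtain M where M: "\<And>A x y. finite A \<Longrightarrow> A \<noteq> {} \<Longrightarrow> dyn_dist T A x y \<le> M" using dyn_dist_bounded by blast
  obtain K f where K: "widim_map \<epsilon> (dyn_dist T B) K f" "complex_dim K = widim \<epsilon> (dyn_dist T B)"
    using dyn_map_attained[OF B \<open>0 < \<epsilon>\<close>] by blast
  have le: "dyn_dist T A x y \<le> dyn_dist T B (T n x) (T n y)" for x y
    unfolding dyn_dist_le_iff[OF A]
  proof
    fix m assume "m \<in> A"
    then obtain b where b: "b \<in> B" "m = n + b" using sub by blast
    then show "dist (T m x) (T m y) \<le> dyn_dist T B (T n x) (T n y)"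
      using dist_le_dyn_dist[OF B(1) b(1), of "T n x" "T n y"] by (simp add: add.commute)
  qed
  have "widim_map \<epsilon>' (dyn_dist T A) K (\<lambda>x. f (T n x))"
  proof (rule widim_mapI[OF widim_mapD(1)[OF K(1)] _ _ M[OF A]])
    show "continuous_on UNIV (\<lambda>x. f (T n x))"
      by (rule continuous_on_compose2[OF widim_mapD(2)[OF K(1)] T_cont]) auto
    show "range (\<lambda>x. f (T n x)) \<subseteq> realization K" using widim_mapD(3)[OF K(1)] by auto
    show "0 < \<epsilon>'" using assms by simp
    fix z
    obtain e where e: "e < \<epsilon>" "\<And>x y. f x = z \<Longrightarrow> f y = z \<Longrightarrow> dyn_dist T B x y \<le> e"
      using widim_map_fiber[OF K(1) M[OF B] \<open>0 < \<epsilon>\<close>, of z] by blast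
    have "dyn_dist T A x y \<le> e" if "f (T n x) = z" "f (T n y) = z" for x y
      using le[of x y] e(2)[OF that] by linarith
    then show "\<exists>e<\<epsilon>'. \<forall>x y. f (T n x) = z \<longrightarrow> f (T n y) = z \<longrightarrow> dyn_dist T A x y \<le> e"
      using e(1) \<open>\<epsilon> \<le> \<epsilon>'\<close> by (intro exI[of _ e]) auto
  qed
  then show ?thesis using widim_le K(2) by metis
qed

lemma widim_UNION:
  assumes "finite I" "I \<noteq> {}" "finite B" "B \<noteq> {}" "0 < \<epsilon>"
  shows "widim \<epsilon> (dyn_dist T (\<Union>i\<in>I. (+) i ` B)) \<le> card I * widim \<epsilon> (dyn_dist T B)"
  using assms(1,2)
proof (induction I rule: finite_ne_induct)
  case (singleton i)
  show ?case using widim_pullback[of "(+) i ` B" B \<epsilon> \<epsilon> i] assms(3-5) by simp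
next
  case (insert i I)
  have "widim \<epsilon> (dyn_dist T ((+) i ` B \<union> (\<Union>i\<in>I. (+) i ` B)))
     \<le> widim \<epsilon> (dyn_dist T ((+) i ` B)) + widim \<epsilon> (dyn_dist T (\<Union>i\<in>I. (+) i ` B))"
    by (rule widim_Un) (use insert.hyps assms in auto)
  also have "\<dots> \<le> widim \<epsilon> (dyn_dist T B) + card I * widim \<epsilon> (dyn_dist T B)"
    using widim_pullback[of "(+) i ` B" B \<epsilon> \<epsilon> i] assms(3-5) insert.IH by (intro add_mono) auto
  finally show ?case using insert.hyps by simp
qed

end

section \<open>Boxes and the growth of their width dimension\<close>

lemma bij_box_N: "bij_betw (\<lambda>n. \<lambda>i\<in>UNIV. n $ i) (box_N N :: (int^'k) set) (PiE UNIV (\<lambda>_. {0..<int N}))"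
proof (rule bij_betw_byWitness[where f' = "\<lambda>g. \<chi> i. g i"])
qed (auto simp: box_N_def vec_eq_iff)

lemma finite_box_N [simp]: "finite (box_N N :: (int^'k) set)"
  using bij_betw_finite[OF bij_box_N[of N]] by (simp add: finite_PiE)

lemma card_box_N [simp]: "card (box_N N :: (int^'k) set) = N ^ CARD('k)"
  using bij_betw_same_card[OF bij_box_N[of N, where ?'k='k]] by (simp add: card_PiE)

lemma box_N_eq_empty_iff [simp]: "(box_N N :: (int^'k) set) = {} \<longleftrightarrow> N = 0"
proof -
  have "(box_N N :: (int^'k) set) = {} \<longleftrightarrow> card (box_N N :: (int^'k) set) = 0"
    by (rule card_0_eq[OF finite_box_N, symmetric])
  also have "\<dots> \<longleftrightarrow> N = 0" unfolding card_box_N by simp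
  finally show ?thesis .
qed

lemma box_N_cover:
  assumes "0 < M"
  shows "(box_N N :: (int^'k) set) \<subseteq> (\<Union>i\<in>(\<lambda>v. \<chi> j. int M * v $ j) ` box_N (N div M + 1). (+) i ` box_N M)"
proof
  fix n :: "int^'k" assume n: "n \<in> box_N N"
  define v where "v = (\<chi> j. n $ j div int M)"
  define b where "b = (\<chi> j. n $ j mod int M)"
  have v: "v \<in> box_N (N div M + 1)"
  proof -
    have "0 \<le> n $ j div int M \<and> n $ j div int M < int (N div M + 1)" for j
    proof -
      have nj: "0 \<le> n $ j" "n $ j < int N" using n by (auto simp: box_N_def)
      have "n $ j div int M \<le> int N div int M" using nj assms by (intro zdiv_mono1) auto
      then show ?thesis using nj assms by (simp add: zdiv_int pos_imp_zdiv_nonneg_iff)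
    qed
    then show ?thesis by (simp add: box_N_def v_def)
  qed
  moreover have "b \<in> box_N M" using assms by (simp add: box_N_def b_def)
  moreover have "n = (\<chi> j. int M * v $ j) + b" by (simp add: vec_eq_iff v_def b_def)
  ultimately show "n \<in> (\<Union>i\<in>(\<lambda>v. \<chi> j. int M * v $ j) ` box_N (N div M + 1). (+) i ` box_N M)" by blast
qed

context zk_system
begin

abbreviation box_widim :: "real \<Rightarrow> nat \<Rightarrow> nat" where
  "box_widim \<epsilon> N \<equiv> widim \<epsilon> (dyn_dist T (box_N N))"

lemma box_widim_le:
  assumes "0 < \<epsilon>" "0 < M" "0 < N"
  shows "box_widim \<epsilon> N \<le> (N div M + 1) ^ CARD('k) * box_widim \<epsilon> M"
proof -
  define I where "I = (\<lambda>v::int^'k. \<chi> j. int M * v $ j) ` box_N (N div M + 1)"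
  have I: "finite I" "I \<noteq> {}" by (simp_all add: I_def)
  have cI: "card I \<le> (N div M + 1) ^ CARD('k)"
    unfolding I_def by (rule order_trans[OF card_image_le]) simp_all
  have "box_widim \<epsilon> N \<le> widim \<epsilon> (dyn_dist T (\<Union>i\<in>I. (+) i ` box_N M))"
    by (rule widim_pullback[where n=0]) (use assms I box_N_cover[OF assms(2), of N] in \<open>auto simp: I_def\<close>)
  also have "\<dots> \<le> card I * box_widim \<epsilon> M"
    by (rule widim_UNION) (use assms I in auto)
  also have "\<dots> \<le> (N div M + 1) ^ CARD('k) * box_widim \<epsilon> M" by (intro mult_right_mono cI) simp
  finally show ?thesis .
qed

text \<open>\<^const>\<open>mdim\<close> is built from \<^const>\<open>Lim\<close>, which is meaningful only if the limits exist; this needs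
  subadditivity of \<^const>\<open>widim\<close>.\<close>

lemma box_widim_convergent:
  assumes "0 < \<epsilon>"
  shows "\<exists>L. (\<lambda>N. real (box_widim \<epsilon> N) / real N ^ CARD('k)) \<longlonglongrightarrow> L"
proof -
  define s where "s N = real (box_widim \<epsilon> N) / real N ^ CARD('k)" for N
  \<comment> \<open>As in Fekete's lemma the limit is the infimum. \<open>N = 0\<close> is left out
    because division by zero would make the quotient 0 there.\<close>
  define L where "L = (INF N\<in>{0<..}. s N)"
  have bb: "bdd_below (s ` {0<..})" by (rule bdd_belowI2[of _ 0]) (simp add: s_def)
  have L: "L \<le> s N" if "0 < N" for N unfolding L_def by (rule cINF_lower[OF bb]) (use that in auto)
  have "s \<longlonglongrightarrow> L"
  proof (rule LIMSEQ_I)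
    fix r :: real assume "0 < r"
    have "\<exists>M\<in>{0<..}. s M < L + r"
      using cINF_less_iff[OF _ bb, of "L + r"] \<open>0 < r\<close> unfolding L_def[symmetric] by auto
    then obtain M where M: "0 < M" "s M < L + r" by auto
    have lim: "(\<lambda>N. (1 / real M + 1 / real N) ^ CARD('k) * real (box_widim \<epsilon> M)) \<longlonglongrightarrow> (1 / real M + 0) ^ CARD('k) * real (box_widim \<epsilon> M)"
      by (intro tendsto_intros lim_1_over_n)
    have "(1 / real M + 0) ^ CARD('k) * real (box_widim \<epsilon> M) = s M" by (simp add: s_def power_divide)
    then have "\<forall>\<^sub>F N in sequentially. (1 / real M + 1 / real N) ^ CARD('k) * real (box_widim \<epsilon> M) < L + r"
      using order_tendstoD(2)[OF lim] M(2) by simp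
    then obtain N0 where N0: "\<And>N. N0 \<le> N \<Longrightarrow> (1 / real M + 1 / real N) ^ CARD('k) * real (box_widim \<epsilon> M) < L + r"
      unfolding eventually_sequentially by blast
    show "\<exists>no. \<forall>n\<ge>no. norm (s n - L) < r"
    proof (intro exI[of _ "max N0 1"] allI impI)
      fix N assume N: "max N0 1 \<le> N"
      then have N1: "0 < N" by simp
      have "real (box_widim \<epsilon> N) \<le> real (N div M + 1) ^ CARD('k) * real (box_widim \<epsilon> M)"
        using box_widim_le[OF assms M(1) N1] by (metis of_nat_le_iff of_nat_mult of_nat_power)
      then have "s N \<le> real (N div M + 1) ^ CARD('k) * real (box_widim \<epsilon> M) / real N ^ CARD('k)"
        unfolding s_def by (rule divide_right_mono) simp
      also have "\<dots> = (real (N div M + 1) / real N) ^ CARD('k) * real (box_widim \<epsilon> M)"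
        by (simp add: power_divide)
      also have "\<dots> \<le> (1 / real M + 1 / real N) ^ CARD('k) * real (box_widim \<epsilon> M)"
      proof (intro mult_right_mono power_mono)
        have "real (N div M) \<le> real N / real M" by (rule of_nat_div_le_of_nat)
        then have "real (N div M + 1) / real N \<le> (real N / real M + 1) / real N"
          by (intro divide_right_mono) auto
        then show "real (N div M + 1) / real N \<le> 1 / real M + 1 / real N"
          using N1 M(1) by (simp add: add_divide_distrib)
      qed simp_all
      also have "\<dots> < L + r" using N0 N by simp
      finally show "norm (s N - L) < r" using L[OF N1] by simp
    qed
  qed
  then show ?thesis unfolding s_def by blast
qed

text \<open>The growth rate \<open>L\<close> is antitone in \<open>\<epsilon>\<close>, so its limit
  at 0 is a supremum and dominates the rate at every scale. Mean dimension enters the construction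
  only through this bound.\<close>

lemma box_widim_eventually:
  assumes mdim: "mdim T < ereal c" and "0 < \<epsilon>"
  shows "\<forall>\<^sub>F N in sequentially. real (box_widim \<epsilon> N) \<le> c * real N ^ CARD('k)"
proof -
  define L where "L e = lim (\<lambda>N. real (box_widim e N) / real N ^ CARD('k))" for e
  have L: "(\<lambda>N. real (box_widim e N) / real N ^ CARD('k)) \<longlonglongrightarrow> L e" if "0 < e" for e
    using box_widim_convergent[OF that] unfolding L_def by (simp add: convergent_def convergent_LIMSEQ_iff[symmetric])
  have anti: "L e' \<le> L e" if "0 < e" "e \<le> e'" for e e'
  proof (rule tendsto_le[OF _ L[OF that(1)] L])
    show "0 < e'" using that by simp
    show "\<forall>\<^sub>F N in sequentially. real (box_widim e' N) / real N ^ CARD('k) \<le> real (box_widim e N) / real N ^ CARD('k)"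
      using eventually_gt_at_top[of 0]
    proof eventually_elim
      case (elim N)
      have "box_widim e' N \<le> box_widim e N"
        by (rule widim_pullback[where n=0]) (use elim that in auto)
      then show ?case by (intro divide_right_mono) auto
    qed
  qed simp
  define S where "S = (SUP e\<in>{0<..}. ereal (L e))"
  have "((\<lambda>e. ereal (L e)) \<longlongrightarrow> S) (at_right 0)"
  proof (rule order_tendstoI)
    fix a assume "a < S"
    then obtain e where e: "0 < e" "a < ereal (L e)" unfolding S_def less_SUP_iff by auto
    have "\<forall>\<^sub>F x in at_right 0. x \<in> {0<..<e}" using e(1) by (rule eventually_at_right_real)
    then show "\<forall>\<^sub>F x in at_right 0. a < ereal (L x)"
    proof eventually_elim
      case (elim x)
      then have "ereal (L e) \<le> ereal (L x)" using anti[of x e] by simp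
      with e(2) show ?case by (rule order.strict_trans2)
    qed
  next
    fix a assume "S < a"
    have "\<forall>\<^sub>F x in at_right (0::real). x \<in> {0<..<1}" by (rule eventually_at_right_real) simp
    then show "\<forall>\<^sub>F x in at_right 0. ereal (L x) < a"
    proof eventually_elim
      case (elim x)
      then have "ereal (L x) \<le> S" unfolding S_def by (intro SUP_upper) auto
      then show ?case using \<open>S < a\<close> by simp
    qed
  qed
  then have "Lim (at_right 0) (\<lambda>e. ereal (L e)) = S"
    by (intro tendsto_Lim) (simp_all add: trivial_limit_at_right_real)
  then have "mdim T = S" unfolding mdim_def L_def lim_def[symmetric] by (simp add: lim_def t2_space_class.Lim_def)
  moreover have "ereal (L \<epsilon>) \<le> S" unfolding S_def by (rule SUP_upper) (use \<open>0 < \<epsilon>\<close> in simp)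
  ultimately have "ereal (L \<epsilon>) < ereal c" using mdim by (simp only: order.strict_trans1)
  then have "L \<epsilon> < c" by simp
  then have "\<forall>\<^sub>F N in sequentially. real (box_widim \<epsilon> N) / real N ^ CARD('k) < c"
    using order_tendstoD(2)[OF L[OF \<open>0 < \<epsilon>\<close>]] by blast
  then show ?thesis using eventually_gt_at_top[of 0]
    by eventually_elim (simp add: divide_less_eq split: if_splits)
qed

end

section \<open>Finite-dimensional approximation on windows\<close>

lemma continuous_on_dominated:
  fixes \<psi> :: "'a::topological_space \<Rightarrow> real"
  assumes "\<And>x y. \<bar>\<psi> y - \<psi> x\<bar> \<le> m y x" "\<And>x. continuous_on UNIV (\<lambda>y. m y x)" "\<And>x. m x x = 0"
  shows "continuous_on UNIV \<psi>"
proof -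
  have "(\<psi> \<longlongrightarrow> \<psi> x) (at x)" for x
  proof -
    have "((\<lambda>y. m y x) \<longlongrightarrow> m x x) (at x)"
      using assms(2)[of x] unfolding continuous_on_def by blast
    then have "((\<lambda>y. m y x) \<longlongrightarrow> 0) (at x)" unfolding assms(3) .
    then have "((\<lambda>y. \<psi> y - \<psi> x) \<longlongrightarrow> 0) (at x)"
      by (rule Lim_null_comparison[rotated]) (simp add: assms(1))
    then show ?thesis by (simp add: LIM_zero_iff)
  qed
  then show ?thesis unfolding continuous_on_def by simp
qed

lemma continuous_on_lipschitz_wrt:
  fixes P :: "'a::topological_space \<Rightarrow> nat \<Rightarrow> real"
  assumes "lipschitz_wrt (l1dist V P) \<psi>" and P: "\<And>v. continuous_on UNIV (\<lambda>x. P x v)"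
  shows "continuous_on UNIV \<psi>"
proof -
  obtain \<Lambda> where \<Lambda>: "\<And>x y. \<bar>\<psi> x - \<psi> y\<bar> \<le> \<Lambda> * l1dist V P x y"
    using assms(1) unfolding lipschitz_wrt_def by blast
  show ?thesis
  proof (rule continuous_on_dominated[OF \<Lambda>])
    show "continuous_on UNIV (\<lambda>y. \<Lambda> * l1dist V P y x)" for x
      unfolding l1dist_def by (intro continuous_intros P)
  qed simp
qed

context zk_system
begin

text \<open>The coordinates are those of an optimal map to a complex. Its fibre condition speaks of
  equal images only; compactness of the set of pairs that are \<open>\<epsilon>\<close> apart
  somewhere in the window turns it into the tolerance \<open>\<rho>\<close>.\<close>

lemma window_coordinates:
  assumes A: "finite A" "A \<noteq> {}" and "0 < \<epsilon>"
  shows "\<exists>P V \<rho>. finite V \<and> 0 < \<rho> \<and> (\<forall>x v. \<bar>P x v\<bar> \<le> 1) \<and> (\<forall>v. continuous_on UNIV (\<lambda>x. P x v)) \<and>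
    covering_exponent (l1dist V P) (widim \<epsilon> (dyn_dist T A)) \<and>
    (\<forall>x y. l1dist V P x y < \<rho> \<longrightarrow> (\<forall>n\<in>A. dist (T n x) (T n y) < \<epsilon>))"
proof -
  obtain M where M: "\<And>A x y. finite A \<Longrightarrow> A \<noteq> {} \<Longrightarrow> dyn_dist T A x y \<le> M" using dyn_dist_bounded by blast
  obtain K f where K: "widim_map \<epsilon> (dyn_dist T A) K f" "complex_dim K = widim \<epsilon> (dyn_dist T A)"
    using dyn_map_attained[OF assms] by blast
  note f = widim_mapD[OF K(1)]
  define V where "V = \<Union>K"
  have fV: "finite V" unfolding V_def by (rule finite_vertices[OF f(1)])
  have cf: "continuous_on UNIV (\<lambda>x. f x v)" for v by (rule continuous_on_product_then_coordinatewise[OF f(2)])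
  have inj: "f x = f y" if "l1dist V f x y = 0" for x y
  proof
    fix v
    show "f x v = f y v"
    proof (cases "v \<in> V")
      case True
      then show ?thesis using coord_le_l1dist[OF fV True, of f x y] that by simp
    next
      case False
      then show ?thesis using realization_zero[OF f(3)] unfolding V_def by simp
    qed
  qed
  define S where "S = (\<Union>n\<in>A. {z. \<epsilon> \<le> dist (T n (fst z)) (T n (snd z))})"
  have "closed {z. \<epsilon> \<le> dist (T n (fst z)) (T n (snd z))}" for n
    by (intro closed_Collect_le continuous_intros T_cont_comp)
  then have "closed S" unfolding S_def using A(1) by blast
  moreover have "compact (UNIV :: ('a \<times> 'a) set)"
    using compact_Times[OF compact_space compact_space] by simp
  ultimately have cS: "compact S" using compact_Int_closed by fastforce
  have pos: "0 < l1dist V f (fst z) (snd z)" if zS: "z \<in> S" for z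
  proof (rule ccontr)
    assume "\<not> ?thesis"
    then have "l1dist V f (fst z) (snd z) = 0" using l1dist_nonneg[of V f "fst z" "snd z"] by simp
    then have eq: "f (fst z) = f (snd z)" by (rule inj)
    obtain e where e: "e < \<epsilon>" "\<And>x y. f x = f (fst z) \<Longrightarrow> f y = f (fst z) \<Longrightarrow> dyn_dist T A x y \<le> e"
      using widim_map_fiber[OF K(1) M[OF A] \<open>0 < \<epsilon>\<close>, of "f (fst z)"] by blast
    obtain n where n: "n \<in> A" "\<epsilon> \<le> dist (T n (fst z)) (T n (snd z))" using zS unfolding S_def by blast
    show False
      using e(1) e(2)[OF refl eq[symmetric]] dist_le_dyn_dist[OF A(1) n(1), of "fst z" "snd z"] n(2) by simp
  qed
  have "\<exists>\<rho>>0. \<forall>z\<in>S. \<rho> \<le> l1dist V f (fst z) (snd z)"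
  proof (cases "S = {}")
    case True
    then show ?thesis by (intro exI[of _ 1]) simp
  next
    case False
    have "continuous_on S (\<lambda>z. l1dist V f (fst z) (snd z))"
      unfolding l1dist_def
      by (intro continuous_intros continuous_on_compose2[OF cf]) auto
    then obtain z0 where "z0 \<in> S" "\<forall>z\<in>S. l1dist V f (fst z0) (snd z0) \<le> l1dist V f (fst z) (snd z)"
      using continuous_attains_inf[OF cS False] by blast
    then show ?thesis using pos by blast
  qed
  then obtain \<rho> where \<rho>: "0 < \<rho>" "\<And>z. z \<in> S \<Longrightarrow> \<rho> \<le> l1dist V f (fst z) (snd z)" by blast
  have small: "dist (T n x) (T n y) < \<epsilon>" if "l1dist V f x y < \<rho>" "n \<in> A" for x y n
  proof (rule ccontr)
    assume "\<not> ?thesis"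
    then have "(x, y) \<in> S" using that(2) by (force simp: S_def)
    then show False using \<rho>(2) that(1) by force
  qed
  have "covering_exponent (l1dist V f) (widim \<epsilon> (dyn_dist T A))"
    using covering_exponent_realization[OF f(1), of f] f(3) unfolding V_def K(2) by blast
  moreover have "\<bar>f x v\<bar> \<le> 1" for x v
    using realization_nonneg[OF f(3)] realization_le_1[OF f(1) f(3)] by simp
  ultimately show ?thesis using fV \<rho>(1) cf small
    by (intro exI[of _ f] exI[of _ V] exI[of _ \<rho>] conjI) blast+
qed

text \<open>Points with close coordinates are \<open>\<epsilon>\<close>-close along the window, so
  \<open>\<phi> i\<close> at time \<open>t i\<close> varies by at most \<open>\<eta>\<close> between
  them. That is the hypothesis of \<open>lipschitz_regularization\<close> for the pseudometric of
  the coordinates.\<close>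

lemma window_approximation:
  fixes \<phi> :: "'i \<Rightarrow> 'a \<Rightarrow> real"
  assumes A: "finite A" "A \<noteq> {}" and "0 < \<epsilon>"
    and t: "\<forall>i\<in>I. t i \<in> A"
    and \<phi>: "\<forall>i\<in>I. \<forall>x. 0 \<le> \<phi> i x \<and> \<phi> i x \<le> 1"
      "\<forall>i\<in>I. \<forall>x y. dist x y < \<epsilon> \<longrightarrow> \<bar>\<phi> i x - \<phi> i y\<bar> \<le> \<eta>" and "0 \<le> \<eta>"
  shows "\<exists>P V \<rho> \<psi>. finite V \<and> 0 < \<rho> \<and> (\<forall>x v. \<bar>P x v\<bar> \<le> 1) \<and> (\<forall>v. continuous_on UNIV (\<lambda>x. P x v)) \<and>
    covering_exponent (l1dist V P) (widim \<epsilon> (dyn_dist T A)) \<and>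
    (\<forall>x y. l1dist V P x y < \<rho> \<longrightarrow> (\<forall>n\<in>A. dist (T n x) (T n y) < \<epsilon>)) \<and>
    (\<forall>i\<in>I. lipschitz_wrt (l1dist V P) (\<psi> i) \<and> (\<forall>x. \<bar>\<psi> i x - \<phi> i (T (t i) x)\<bar> \<le> \<eta>))"
proof -
  obtain P V \<rho> where P: "finite V" "0 < \<rho>" "\<forall>x v. \<bar>P x v\<bar> \<le> 1" "\<forall>v. continuous_on UNIV (\<lambda>x. P x v)"
    "covering_exponent (l1dist V P) (widim \<epsilon> (dyn_dist T A))"
    "\<forall>x y. l1dist V P x y < \<rho> \<longrightarrow> (\<forall>n\<in>A. dist (T n x) (T n y) < \<epsilon>)"
    using window_coordinates[OF assms(1-3)] by (elim exE conjE) rule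
  have "\<exists>\<psi>. lipschitz_wrt (l1dist V P) \<psi> \<and> (\<forall>x. \<bar>\<psi> x - \<phi> i (T (t i) x)\<bar> \<le> \<eta>)" if i: "i \<in> I" for i
  proof (rule lipschitz_regularization[OF l1dist_nonneg l1dist_same l1dist_commute l1dist_triangle])
    show "0 \<le> \<phi> i (T (t i) x)" "\<phi> i (T (t i) x) \<le> 1" for x using \<phi>(1) i by blast+
    fix x y assume "l1dist V P x y < \<rho>"
    then have "dist (T (t i) x) (T (t i) y) < \<epsilon>" using P(6) t i by blast
    then show "\<bar>\<phi> i (T (t i) x) - \<phi> i (T (t i) y)\<bar> \<le> \<eta>" using \<phi>(2) i by blast
  qed (use P(2) \<open>0 \<le> \<eta>\<close> in auto)
  then obtain \<psi> where "\<forall>i\<in>I. lipschitz_wrt (l1dist V P) (\<psi> i) \<and> (\<forall>x. \<bar>\<psi> i x - \<phi> i (T (t i) x)\<bar> \<le> \<eta>)"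
    by metis
  with P show ?thesis by (intro exI[of _ P] exI[of _ V] exI[of _ \<rho>] exI[of _ \<psi>] conjI) assumption+
qed

text \<open>For the markers: a pattern of any point stays away by \<open>\<tau>\<close> from the
  translated patterns of all points. One \<open>\<eta>\<close> of the error pays for Lipschitz
  regularity and one for the separating constants.\<close>

lemma signature_maps:
  fixes \<phi> :: "'i \<Rightarrow> 'a \<Rightarrow> real" and J :: "'n \<Rightarrow> 'i set"
  assumes A: "finite A" "A \<noteq> {}" and "0 < \<epsilon>"
    and t: "\<forall>i\<in>I. t i \<in> A"
    and \<phi>: "\<forall>i\<in>I. \<forall>x. 0 \<le> \<phi> i x \<and> \<phi> i x \<le> 1"
      "\<forall>i\<in>I. \<forall>x y. dist x y < \<epsilon> \<longrightarrow> \<bar>\<phi> i x - \<phi> i y\<bar> \<le> \<eta>" and "0 < \<eta>"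
    and I: "finite I" and "finite F"
    and J: "\<forall>n\<in>F. J n \<subseteq> I \<and> \<sigma> n ` J n \<subseteq> I \<and> inj_on (\<sigma> n) (J n) \<and>
      J n \<inter> \<sigma> n ` J n = {} \<and> 2 * widim \<epsilon> (dyn_dist T A) < card (J n)"
  shows "\<exists>\<Psi> \<tau>. 0 < \<tau> \<and> (\<forall>i\<in>I. continuous_on UNIV (\<Psi> i) \<and> (\<forall>x. \<bar>\<Psi> i x - \<phi> i (T (t i) x)\<bar> \<le> 2 * \<eta>)) \<and>
    (\<forall>n\<in>F. \<forall>x y. \<exists>j\<in>J n. \<tau> \<le> \<bar>\<Psi> (\<sigma> n j) x - \<Psi> j y\<bar>)"
proof -
  obtain P V \<rho> \<psi> where P: "finite V" "0 < \<rho>" "\<forall>x v. \<bar>P x v\<bar> \<le> 1" "\<forall>v. continuous_on UNIV (\<lambda>x. P x v)"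
    "covering_exponent (l1dist V P) (widim \<epsilon> (dyn_dist T A))"
    "\<forall>x y. l1dist V P x y < \<rho> \<longrightarrow> (\<forall>n\<in>A. dist (T n x) (T n y) < \<epsilon>)"
    "\<forall>i\<in>I. lipschitz_wrt (l1dist V P) (\<psi> i) \<and> (\<forall>x. \<bar>\<psi> i x - \<phi> i (T (t i) x)\<bar> \<le> \<eta>)"
    using window_approximation[where \<phi>=\<phi> and t=t and I=I, OF A \<open>0 < \<epsilon>\<close> t \<phi> less_imp_le[OF \<open>0 < \<eta>\<close>]]
    by (elim exE conjE) rule
  have lip: "lipschitz_wrt (l1dist V P) (\<psi> i)" if "i \<in> I" for i using P(7) that by blast
  have "\<exists>c \<tau>. 0 < \<tau> \<and> (\<forall>i. \<bar>c i\<bar> < \<eta>) \<and>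
    (\<forall>n\<in>F. \<forall>x y. \<exists>j\<in>J n. \<tau> \<le> \<bar>(\<psi> (\<sigma> n j) x + c (\<sigma> n j)) - (\<psi> j y + c j)\<bar>)"
    by (rule separate_shifted[OF P(5) l1dist_nonneg lip I \<open>finite F\<close> bspec[OF J] \<open>0 < \<eta>\<close>])
  then obtain c \<tau> where c: "0 < \<tau>" "\<forall>i. \<bar>c i\<bar> < \<eta>"
    "\<forall>n\<in>F. \<forall>x y. \<exists>j\<in>J n. \<tau> \<le> \<bar>(\<psi> (\<sigma> n j) x + c (\<sigma> n j)) - (\<psi> j y + c j)\<bar>"
    by (elim exE conjE) rule
  have "continuous_on UNIV (\<lambda>x. \<psi> i x + c i)" if "i \<in> I" for i
    by (intro continuous_intros continuous_on_lipschitz_wrt[OF lip[OF that]]) (use P(4) in blast)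
  moreover have "\<bar>\<psi> i x + c i - \<phi> i (T (t i) x)\<bar> \<le> 2 * \<eta>" if "i \<in> I" for i x
  proof -
    have "\<bar>\<psi> i x - \<phi> i (T (t i) x)\<bar> \<le> \<eta>" "\<bar>c i\<bar> < \<eta>" using P(7) c(2) that by blast+
    then show ?thesis by linarith
  qed
  ultimately show ?thesis using c(1,3)
    by (intro exI[of _ "\<lambda>i x. \<psi> i x + c i"] exI[of _ \<tau>] conjI ballI allI) auto
qed

text \<open>A quantitative Menger-Noebeling theorem: more than \<open>2 * widim\<close> functions
  can be perturbed so that they determine the window coordinates up to a tolerance, and thereby the
  orbit along the window up to \<open>\<epsilon>\<close>.\<close>

lemma encoding_maps:
  fixes \<phi> :: "'i \<Rightarrow> 'a \<Rightarrow> real"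
  assumes A: "finite A" "A \<noteq> {}" and "0 < \<epsilon>"
    and t: "\<forall>i\<in>I. t i \<in> A"
    and \<phi>: "\<forall>i\<in>I. \<forall>x. 0 \<le> \<phi> i x \<and> \<phi> i x \<le> 1"
      "\<forall>i\<in>I. \<forall>x y. dist x y < \<epsilon> \<longrightarrow> \<bar>\<phi> i x - \<phi> i y\<bar> \<le> \<eta>" and "0 < \<eta>"
    and I: "finite I" "2 * widim \<epsilon> (dyn_dist T A) < card I"
  shows "\<exists>\<Psi>. (\<forall>i\<in>I. continuous_on UNIV (\<Psi> i) \<and> (\<forall>x. \<bar>\<Psi> i x - \<phi> i (T (t i) x)\<bar> \<le> 2 * \<eta>)) \<and>
    (\<forall>x y. (\<forall>i\<in>I. \<Psi> i x = \<Psi> i y) \<longrightarrow> (\<forall>n\<in>A. dist (T n x) (T n y) < \<epsilon>))"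
proof -
  obtain P V \<rho> \<psi> where P: "finite V" "0 < \<rho>" "\<forall>x v. \<bar>P x v\<bar> \<le> 1" "\<forall>v. continuous_on UNIV (\<lambda>x. P x v)"
    "covering_exponent (l1dist V P) (widim \<epsilon> (dyn_dist T A))"
    "\<forall>x y. l1dist V P x y < \<rho> \<longrightarrow> (\<forall>n\<in>A. dist (T n x) (T n y) < \<epsilon>)"
    "\<forall>i\<in>I. lipschitz_wrt (l1dist V P) (\<psi> i) \<and> (\<forall>x. \<bar>\<psi> i x - \<phi> i (T (t i) x)\<bar> \<le> \<eta>)"
    using window_approximation[where \<phi>=\<phi> and t=t and I=I, OF A \<open>0 < \<epsilon>\<close> t \<phi> less_imp_le[OF \<open>0 < \<eta>\<close>]]
    by (elim exE conjE) rule
  have lip: "lipschitz_wrt (l1dist V P) (\<psi> i)" if "i \<in> I" for i using P(7) that by blast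
  have lipP: "lipschitz_wrt (l1dist V P) (\<lambda>x. P x v)" if "v \<in> V" for v
    unfolding lipschitz_wrt_def using coord_le_l1dist[OF P(1) that, of P] by (intro exI[of _ 1]) auto
  have bdP: "\<bar>P x v\<bar> \<le> 1" for x v using P(3) by blast
  have bd: "\<bar>\<psi> i x\<bar> \<le> 1 + \<eta>" if "i \<in> I" for i x
  proof -
    have "\<bar>\<psi> i x - \<phi> i (T (t i) x)\<bar> \<le> \<eta>" using P(7) that by blast
    moreover have "0 \<le> \<phi> i (T (t i) x) \<and> \<phi> i (T (t i) x) \<le> 1" using \<phi>(1) that by blast
    ultimately show ?thesis by linarith
  qed
  \<comment> \<open>Coordinates that agree up to \<open>\<kappa>\<close> at each vertex have l1
    distance at most \<open>card V * \<kappa> < \<rho>\<close>.\<close>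
  define \<kappa> where "\<kappa> = \<rho> / (real (card V) + 1)"
  have "0 < \<kappa>" using P(2) by (simp add: \<kappa>_def)
  have "\<exists>\<psi>' \<tau>. 0 < \<tau> \<and> (\<forall>i\<in>I. lipschitz_wrt (l1dist V P) (\<psi>' i) \<and> (\<forall>x. \<bar>\<psi>' i x - \<psi> i x\<bar> < \<eta>)) \<and>
    (\<forall>v\<in>V. \<forall>x y. \<kappa> \<le> \<bar>P x v - P y v\<bar> \<longrightarrow> (\<exists>i\<in>I. \<tau> \<le> \<bar>\<psi>' i x - \<psi>' i y\<bar>))"
    by (rule separate_points_coords[OF P(5) l1dist_nonneg I lip lipP bdP bd P(1) \<open>0 < \<kappa>\<close> \<open>0 < \<eta>\<close>])
  then obtain \<psi>' \<tau> where \<psi>': "0 < \<tau>" "\<forall>i\<in>I. lipschitz_wrt (l1dist V P) (\<psi>' i) \<and> (\<forall>x. \<bar>\<psi>' i x - \<psi> i x\<bar> < \<eta>)"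
    "\<forall>v\<in>V. \<forall>x y. \<kappa> \<le> \<bar>P x v - P y v\<bar> \<longrightarrow> (\<exists>i\<in>I. \<tau> \<le> \<bar>\<psi>' i x - \<psi>' i y\<bar>)"
    by (elim exE conjE) rule
  have "continuous_on UNIV (\<psi>' i)" if "i \<in> I" for i
    by (rule continuous_on_lipschitz_wrt[of V P]) (use P(4) \<psi>'(2) that in blast)+
  moreover have "\<bar>\<psi>' i x - \<phi> i (T (t i) x)\<bar> \<le> 2 * \<eta>" if "i \<in> I" for i x
  proof -
    have "\<bar>\<psi> i x - \<phi> i (T (t i) x)\<bar> \<le> \<eta>" "\<bar>\<psi>' i x - \<psi> i x\<bar> < \<eta>" using P(7) \<psi>'(2) that by blast+
    then show ?thesis by linarith
  qed
  moreover have "\<forall>n\<in>A. dist (T n x) (T n y) < \<epsilon>" if eq: "\<forall>i\<in>I. \<psi>' i x = \<psi>' i y" for x y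
  proof -
    have "\<bar>P x v - P y v\<bar> \<le> \<kappa>" if v: "v \<in> V" for v
    proof (rule ccontr)
      assume "\<not> ?thesis"
      then obtain i where "i \<in> I" "\<tau> \<le> \<bar>\<psi>' i x - \<psi>' i y\<bar>" using \<psi>'(3) v by (metis linear)
      then show False using eq \<psi>'(1) by simp
    qed
    then have "l1dist V P x y \<le> real (card V) * \<kappa>" unfolding l1dist_def by (rule sum_bounded_above)
    also have "\<dots> < \<rho>" using P(2) by (simp add: \<kappa>_def field_simps)
    finally show ?thesis using P(6) by blast
  qed
  ultimately show ?thesis by (intro exI[of _ \<psi>'] conjI ballI allI impI) blast+
qed

lemma marker_function:
  assumes mp: "marker_property T" and F: "finite F" "m \<in> F" "m \<noteq> 0"
  shows "\<exists>\<omega> B. continuous_on UNIV \<omega> \<and> (\<forall>x. 0 \<le> \<omega> x \<and> \<omega> x \<le> (1::real)) \<and> finite B \<and>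
    (\<forall>x. \<exists>n\<in>B. \<omega> (T n x) = 1) \<and> (\<forall>x. \<forall>n\<in>F. n \<noteq> 0 \<longrightarrow> \<omega> x = 0 \<or> \<omega> (T n x) = 0)"
proof -
  from mp have "finite F \<longrightarrow> (\<exists>U. open U \<and> (\<Union>n. T n ` U) = UNIV \<and> (\<forall>n\<in>F. n \<noteq> 0 \<longrightarrow> U \<inter> T n ` U = {}))"
    unfolding marker_property_def by (rule spec)
  then obtain U where UU: "open U" "(\<Union>n. T n ` U) = UNIV" "\<forall>n\<in>F. n \<noteq> 0 \<longrightarrow> U \<inter> T n ` U = {}"
    using F(1) by (elim impE exE conjE) simp_all
  then have U: "open U" "\<And>x. \<exists>n. x \<in> T n ` U" "\<And>n. n \<in> F \<Longrightarrow> n \<noteq> 0 \<Longrightarrow> U \<inter> T n ` U = {}"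
    by (simp_all add: set_eq_iff)
  \<comment> \<open>A nonzero \<open>m \<in> F\<close> keeps \<open>U\<close> from being the whole
    space; \<open>infdist\<close> to the empty set is 0 and would not detect
    \<open>U\<close>.\<close>
  have ne: "- U \<noteq> {}"
  proof
    assume "- U = {}"
    then have "U = UNIV" by auto
    then show False using U(3)[OF F(2,3)] by simp
  qed
  define s where "s x = infdist x (- U)" for x
  have sc: "continuous_on UNIV s" unfolding s_def by (intro continuous_intros)
  have sU: "0 < s x \<longleftrightarrow> x \<in> U" for x
  proof -
    have "closed (- U)" using U(1) by auto
    then have "x \<in> - U \<longleftrightarrow> s x = 0" unfolding s_def by (rule in_closed_iff_infdist_zero[OF _ ne])
    moreover have "0 \<le> s x" unfolding s_def by (rule infdist_nonneg)
    ultimately show ?thesis by auto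
  qed
  \<comment> \<open>Indexing by a time and a threshold lets one appeal to compactness provide both
    the finite set of times and a uniform lower bound for \<open>s\<close>.\<close>
  define W where "W = (\<lambda>(n, i::nat). {x. 1 / (real i + 1) < s (T n x)})"
  have "open (W p)" for p
  proof (cases p)
    case (Pair n i)
    have "continuous_on UNIV (\<lambda>x. s (T n x))" by (rule continuous_on_compose2[OF sc T_cont]) simp
    then show ?thesis unfolding Pair W_def prod.case by (rule open_Collect_less[OF continuous_on_const])
  qed
  moreover have "UNIV \<subseteq> (\<Union>p. W p)"
  proof
    fix x
    obtain n u where nu: "u \<in> U" "x = T n u" using U(2)[of x] by blast
    then have "0 < s (T (- n) x)" using sU by simp
    then obtain i where "inverse (real (Suc i)) < s (T (- n) x)" using reals_Archimedean by blast
    then have "x \<in> W (- n, i)" by (simp add: W_def inverse_eq_divide add.commute)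
    then show "x \<in> (\<Union>p. W p)" by blast
  qed
  ultimately obtain Q where Q: "finite Q" "UNIV \<subseteq> (\<Union>p\<in>Q. W p)"
    by (rule_tac compactE_image[OF compact_space, of UNIV W]) auto
  define m where "m = 1 / (real (Max (snd ` Q)) + 1)"
  have m: "0 < m" by (simp add: m_def)
  have cov: "\<exists>n\<in>fst ` Q. m \<le> s (T n x)" for x
  proof -
    obtain p where p: "p \<in> Q" "x \<in> W p" using Q(2) by blast
    obtain n i where pni: "p = (n, i)" by (cases p)
    have ni: "(n, i) \<in> Q" "1 / (real i + 1) < s (T n x)" using p unfolding pni W_def by simp_all
    have "i \<in> snd ` Q" using ni(1) by force
    then have "i \<le> Max (snd ` Q)" using Q(1) by simp
    then have "m \<le> 1 / (real i + 1)" unfolding m_def by (intro divide_left_mono) auto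
    then have "m \<le> s (T n x)" using ni(2) by linarith
    moreover have "n \<in> fst ` Q" using ni(1) by force
    ultimately show ?thesis by blast
  qed
  define \<omega> where "\<omega> x = min 1 (s x / m)" for x
  have "continuous_on UNIV \<omega>" unfolding \<omega>_def using m by (intro continuous_intros sc) auto
  moreover have "0 \<le> \<omega> x \<and> \<omega> x \<le> 1" for x using m by (simp add: \<omega>_def s_def infdist_nonneg)
  moreover have "\<exists>n\<in>fst ` Q. \<omega> (T n x) = 1" for x
    using cov[of x] m by (auto simp: \<omega>_def min_def pos_le_divide_eq split: if_splits)
  moreover have "\<omega> x = 0 \<or> \<omega> (T n x) = 0" if n: "n \<in> F" "n \<noteq> 0" for x n
  proof -
    have z: "\<omega> y = 0" if "y \<notin> U" for y
    proof -
      have "0 \<le> s y" by (simp add: s_def infdist_nonneg)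
      then have "s y = 0" using sU[of y] that by linarith
      then show ?thesis by (simp add: \<omega>_def)
    qed
    have "x \<notin> U \<or> T n x \<notin> U" using U(3)[OF n] by blast
    then show ?thesis using z by blast
  qed
  ultimately show ?thesis using Q(1) by (intro exI[of _ \<omega>] exI[of _ "fst ` Q"]) auto
qed

end

section \<open>Markers that can be read off from orbits\<close>

lemma sum_single_term:
  assumes "finite A" "a \<in> A" "\<And>b. b \<in> A \<Longrightarrow> b \<noteq> a \<Longrightarrow> f b = 0"
  shows "sum f A = (f a :: real)"
  using assms sum.remove[OF assms(1,2), of f] by (simp add: sum.neutral)

text \<open>Applied to sums over windows of which at most one is active at each point, so that
  errors do not accumulate.\<close>

lemma abs_sum_le_single:
  assumes "finite A" "\<And>a b. a \<in> A \<Longrightarrow> b \<in> A \<Longrightarrow> a \<noteq> b \<Longrightarrow> f a = 0 \<or> f b = 0"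
    "\<And>a. a \<in> A \<Longrightarrow> \<bar>f a\<bar> \<le> \<eta>" "0 \<le> \<eta>"
  shows "\<bar>sum f A\<bar> \<le> (\<eta> :: real)"
proof (cases "\<exists>a\<in>A. f a \<noteq> 0")
  case True
  then obtain a where a: "a \<in> A" "f a \<noteq> 0" by blast
  have "sum f A = f a" by (rule sum_single_term[OF assms(1) a(1)]) (use assms(2)[OF _ a(1)] a(2) in blast)
  then show ?thesis using assms(3) a(1) by simp
next
  case False
  then show ?thesis using assms(4) by simp
qed

definition sup_ball :: "nat \<Rightarrow> (int^'k) set" where
  "sup_ball L = {n. \<forall>i. \<bar>n $ i\<bar> \<le> int L}"

lemma finite_sup_ball [simp]: "finite (sup_ball L)"
proof (rule finite_subset)
  show "sup_ball L \<subseteq> (+) (\<chi> i. - int L) ` (box_N (2 * L + 1) :: (int^'a) set)"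
  proof
    fix n :: "int^'a" assume "n \<in> sup_ball L"
    then have n: "\<bar>n $ i\<bar> \<le> int L" for i by (simp add: sup_ball_def)
    have "0 \<le> n $ i + int L \<and> n $ i + int L < int (2 * L + 1)" for i using n[of i] by linarith
    then have "n + (\<chi> i. int L) \<in> box_N (2 * L + 1)" by (simp add: box_N_def)
    moreover have "n = (\<chi> i. - int L) + (n + (\<chi> i. int L))" by (simp add: vec_eq_iff)
    ultimately show "n \<in> (+) (\<chi> i. - int L) ` (box_N (2 * L + 1) :: (int^'a) set)" by blast
  qed
qed simp

text \<open>Stripes of width \<open>|n $ i|\<close>, for a coordinate with
  \<open>n $ i \<noteq> 0\<close>: translation by \<open>n\<close> changes the parity of the stripe,
  so the even and the odd stripes are each disjoint from their translates. One of the two families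
  fills at least half of the box trimmed by \<open>L\<close> on each side.\<close>

lemma shift_disjoint_half:
  fixes n :: "int^'k"
  assumes "n \<noteq> 0" "n \<in> sup_ball L" "2 * L \<le> R"
  shows "\<exists>J. J \<subseteq> box_N R \<and> (+) n ` J \<subseteq> box_N R \<and> J \<inter> (+) n ` J = {} \<and> (R - 2 * L) ^ CARD('k) \<le> 2 * card J"
proof -
  define e where "e = (\<chi> i::'k. int L)"
  define B where "B = (+) e ` (box_N (R - 2 * L) :: (int^'k) set)"
  have cB: "card B = (R - 2 * L) ^ CARD('k)" unfolding B_def by (subst card_image) auto
  have fB: "finite B" by (simp add: B_def)
  have Bi: "int L \<le> j $ i \<and> j $ i < int R - int L" if "j \<in> B" for j i
  proof -
    obtain b where "b \<in> box_N (R - 2 * L)" "j = e + b" using \<open>j \<in> B\<close> unfolding B_def by blast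
    then have "0 \<le> b $ i" "b $ i < int (R - 2 * L)" "j $ i = int L + b $ i"
      by (simp_all add: box_N_def e_def)
    then show ?thesis using assms(3) by linarith
  qed
  have ni: "- int L \<le> n $ i \<and> n $ i \<le> int L" for i
  proof -
    have "\<bar>n $ i\<bar> \<le> int L" using assms(2) by (simp add: sup_ball_def)
    then show ?thesis by linarith
  qed
  have inB: "j \<in> box_N R" "n + j \<in> box_N R" if "j \<in> B" for j
  proof -
    have "0 \<le> j $ i \<and> j $ i < int R" "0 \<le> (n + j) $ i \<and> (n + j) $ i < int R" for i
      using Bi[OF that, of i] ni[of i] by auto
    then show "j \<in> box_N R" "n + j \<in> box_N R" unfolding box_N_def by blast+
  qed
  obtain i where i: "n $ i \<noteq> 0" using assms(1) by (auto simp: vec_eq_iff)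
  define s where "s = \<bar>n $ i\<bar>"
  have s: "s \<noteq> 0" using i by (simp add: s_def)
  define E where "E = {j \<in> B. even (j $ i div s)}"
  define Od where "Od = {j \<in> B. odd (j $ i div s)}"
  have flip: "odd ((n + j) $ i div s) \<longleftrightarrow> even (j $ i div s)" for j
  proof -
    have "n $ i = s \<or> n $ i = - s" by (auto simp: s_def)
    then have "(n + j) $ i div s = j $ i div s + 1 \<or> (n + j) $ i div s = j $ i div s - 1"
    proof
      assume "n $ i = s"
      then have "(n + j) $ i div s = (j $ i + 1 * s) div s" by (simp add: add.commute)
      also have "\<dots> = j $ i div s + 1" using s by (subst div_mult_self1) auto
      finally show ?thesis by simp
    next
      assume "n $ i = - s"
      then have "(n + j) $ i div s = (j $ i + (-1) * s) div s" by simp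
      also have "\<dots> = j $ i div s - 1" using s by (subst div_mult_self1) auto
      finally show ?thesis by simp
    qed
    then show ?thesis by (elim disjE) simp_all
  qed
  have "B = E \<union> Od" "E \<inter> Od = {}" "finite E" "finite Od" using fB by (auto simp: E_def Od_def)
  then have cEO: "card B = card E + card Od" by (simp add: card_Un_disjoint)
  have half: "J \<subseteq> box_N R \<and> (+) n ` J \<subseteq> box_N R \<and> J \<inter> (+) n ` J = {}" if JE: "J = E \<or> J = Od" for J
  proof -
    have JB: "J \<subseteq> B" using JE unfolding E_def Od_def by blast
    have "j \<in> box_N R \<and> n + j \<in> box_N R" if "j \<in> J" for j
      using inB[of j] JB that by blast
    then have sub: "J \<subseteq> box_N R \<and> (+) n ` J \<subseteq> box_N R" by auto
    have "n + j \<notin> J" if j: "j \<in> J" for j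
    proof
      assume nj: "n + j \<in> J"
      show False using JE
      proof
        assume "J = E"
        then have "even (j $ i div s)" "even ((n + j) $ i div s)" using j nj by (simp_all add: E_def)
        then show False using flip[of j] by simp
      next
        assume "J = Od"
        then have "odd (j $ i div s)" "odd ((n + j) $ i div s)" using j nj by (simp_all add: Od_def)
        then show False using flip[of j] by simp
      qed
    qed
    then have "J \<inter> (+) n ` J = {}" by blast
    with sub show ?thesis by simp
  qed
  have *: "E \<subseteq> box_N R \<and> (+) n ` E \<subseteq> box_N R \<and> E \<inter> (+) n ` E = {}"
    "Od \<subseteq> box_N R \<and> (+) n ` Od \<subseteq> box_N R \<and> Od \<inter> (+) n ` Od = {}"
    by (rule half, simp)+
  have "card B \<le> 2 * card E \<or> card B \<le> 2 * card Od" using cEO by linarith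
  then show ?thesis
  proof
    assume "card B \<le> 2 * card E"
    then show ?thesis using *(1) unfolding cB by (intro exI[of _ E]) simp
  next
    assume "card B \<le> 2 * card Od"
    then show ?thesis using *(2) unfolding cB by (intro exI[of _ Od]) simp
  qed
qed

text \<open>Trimming a fixed margin off a large box costs only lower order terms, so a strict
  inequality of leading coefficients survives.\<close>

lemma eventually_power_shift:
  fixes c d :: real
  assumes "c < d"
  shows "\<forall>\<^sub>F N in sequentially. c * real N ^ k < d * real (N - m) ^ k"
proof -
  have "(\<lambda>N. d * (1 - real m * (1 / real N)) ^ k) \<longlonglongrightarrow> d * (1 - real m * 0) ^ k"
    by (intro tendsto_intros lim_1_over_n)
  then have "\<forall>\<^sub>F N in sequentially. c < d * (1 - real m * (1 / real N)) ^ k"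
    by (rule order_tendstoD(1)) (use assms in simp)
  then show ?thesis using eventually_gt_at_top[of m]
  proof eventually_elim
    case (elim N)
    have N: "0 < real N" using elim(2) by simp
    have "real (N - m) = (1 - real m * (1 / real N)) * real N"
      using elim(2) N by (simp add: of_nat_diff field_simps)
    then have "d * real (N - m) ^ k = d * (1 - real m * (1 / real N)) ^ k * real N ^ k"
      by (simp add: power_mult_distrib)
    moreover have "c * real N ^ k < d * (1 - real m * (1 / real N)) ^ k * real N ^ k"
      using elim(1) N by (intro mult_strict_right_mono) simp_all
    ultimately show ?case by (simp only:)
  qed
qed

context zk_system
begin

lemma uniform_modulus:
  fixes f :: "'c \<Rightarrow> 'a \<Rightarrow> real"
  assumes "finite S" "\<And>c. c \<in> S \<Longrightarrow> continuous_on UNIV (f c)" "0 < \<eta>"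
  shows "\<exists>\<epsilon>>0. \<forall>c\<in>S. \<forall>x y. dist x y < \<epsilon> \<longrightarrow> \<bar>f c x - f c y\<bar> \<le> \<eta>"
  using assms(1,2)
proof (induction S rule: finite_induct)
  case (insert c S)
  have "\<exists>\<epsilon>>0. \<forall>c\<in>S. \<forall>x y. dist x y < \<epsilon> \<longrightarrow> \<bar>f c x - f c y\<bar> \<le> \<eta>"
    by (rule insert.IH) (use insert.prems in simp)
  then obtain \<epsilon>1 where 1: "\<epsilon>1 > 0" "\<forall>c\<in>S. \<forall>x y. dist x y < \<epsilon>1 \<longrightarrow> \<bar>f c x - f c y\<bar> \<le> \<eta>"
    by blast
  have "uniformly_continuous_on UNIV (f c)"
    by (rule compact_uniformly_continuous[OF _ compact_space]) (use insert.prems in simp)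
  then have "\<exists>\<epsilon>>0. \<forall>x y. dist y x < \<epsilon> \<longrightarrow> dist (f c y) (f c x) < \<eta>"
    unfolding uniformly_continuous_on_def using \<open>0 < \<eta>\<close> by simp
  then obtain \<epsilon>2 where 2: "\<epsilon>2 > 0" "\<forall>x y. dist y x < \<epsilon>2 \<longrightarrow> dist (f c y) (f c x) < \<eta>" by blast
  have 3: "\<bar>f c x - f c y\<bar> \<le> \<eta>" if "dist x y < \<epsilon>2" for x y
    using 2(2)[rule_format, OF that] by (simp add: dist_real_def)
  show ?case
  proof (intro exI[of _ "min \<epsilon>1 \<epsilon>2"] conjI ballI allI impI)
    fix c' and x y :: 'a assume "c' \<in> insert c S" "dist x y < min \<epsilon>1 \<epsilon>2"
    then show "\<bar>f c' x - f c' y\<bar> \<le> \<eta>" using 1(2) 3[of x y] by auto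
  qed (use 1(1) 2(1) in simp)
qed (auto intro: exI[of _ 1])

text \<open>Near a marker, \<open>g\<close> follows a pattern \<open>\<Psi> z\<close>, with \<open>z\<close> the marked point, and the patterns are chosen so
  that no \<open>\<Psi> z\<close> agrees with a translate of a \<open>\<Psi> z'\<close> by a nonzero vector of \<^term>\<open>sup_ball L\<close>. The new markers
  are the places where the orbit of \<open>g\<close> comes close to some \<open>\<Psi> z\<close>: accidental occurrences are allowed, since
  two occurrences can never be close to each other.\<close>

lemma separated_equivariant_markers:
  fixes f :: "'c \<Rightarrow> 'a \<Rightarrow> real" and c :: real
  assumes mp: "marker_property T" and S: "finite S" "S \<noteq> {}"
    and c: "4 * c < card S" "\<And>\<epsilon>. 0 < \<epsilon> \<Longrightarrow> \<forall>\<^sub>F N in sequentially. real (box_widim \<epsilon> N) \<le> c * real N ^ CARD('k)"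
    and f: "\<And>s. s \<in> S \<Longrightarrow> continuous_on UNIV (f s)" "\<And>s x. s \<in> S \<Longrightarrow> 0 \<le> f s x \<and> f s x \<le> 1"
    and "0 < \<eta>"
  shows "\<exists>g h B. (\<forall>s\<in>S. continuous_on UNIV (g s) \<and> (\<forall>x. \<bar>g s x - f s x\<bar> \<le> \<eta>)) \<and>
    continuous_on UNIV h \<and> (\<forall>x. 0 \<le> h x \<and> h x \<le> (1::real)) \<and> finite B \<and> (\<forall>x. \<exists>n\<in>B. h (T n x) = 1) \<and>
    (\<forall>x. \<forall>n\<in>sup_ball L. n \<noteq> 0 \<longrightarrow> h x = 0 \<or> h (T n x) = 0) \<and>
    (\<forall>x y. (\<forall>n. \<forall>s\<in>S. g s (T n x) = g s (T n y)) \<longrightarrow> h x = h y)"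
proof -
  have "\<exists>\<epsilon>>0. \<forall>s\<in>S. \<forall>x y. dist x y < \<epsilon> \<longrightarrow> \<bar>f s x - f s y\<bar> \<le> \<eta> / 2"
    by (rule uniform_modulus[OF S(1) f(1)]) (use \<open>0 < \<eta>\<close> in simp_all)
  then obtain \<epsilon> where \<epsilon>: "0 < \<epsilon>" "\<forall>s\<in>S. \<forall>x y. dist x y < \<epsilon> \<longrightarrow> \<bar>f s x - f s y\<bar> \<le> \<eta> / 2"
    by blast
  have "\<forall>\<^sub>F R in sequentially. real (box_widim \<epsilon> R) \<le> c * real R ^ CARD('k) \<and>
      4 * c * real R ^ CARD('k) < card S * real (R - 2 * L) ^ CARD('k) \<and> 2 * L + 1 \<le> R"
    using c(2)[OF \<epsilon>(1)] eventually_power_shift[OF c(1), of "CARD('k)" "2 * L"] eventually_ge_at_top[of "2 * L + 1"]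
    by eventually_elim simp
  then obtain R where R: "real (box_widim \<epsilon> R) \<le> c * real R ^ CARD('k)"
      "4 * c * real R ^ CARD('k) < card S * real (R - 2 * L) ^ CARD('k)" "2 * L + 1 \<le> R"
    unfolding eventually_sequentially by blast
  define F where "F = (sup_ball L :: (int^'k) set) - {0}"
  have "\<exists>J. J \<subseteq> box_N R \<and> (+) n ` J \<subseteq> box_N R \<and> J \<inter> (+) n ` J = {} \<and> (R - 2 * L) ^ CARD('k) \<le> 2 * card J"
    if "n \<in> F" for n :: "int^'k"
    by (rule shift_disjoint_half) (use that R(3) in \<open>auto simp: F_def\<close>)
  then obtain J :: "int^'k \<Rightarrow> (int^'k) set" where J: "\<And>n. n \<in> F \<Longrightarrow>
      J n \<subseteq> box_N R \<and> (+) n ` J n \<subseteq> box_N R \<and> J n \<inter> (+) n ` J n = {} \<and> (R - 2 * L) ^ CARD('k) \<le> 2 * card (J n)"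
    by metis
  define I where "I = (box_N R :: (int^'k) set) \<times> S"
  have I: "finite I" "I \<noteq> {}" using S R(3) by (auto simp: I_def)
  define \<sigma> where "\<sigma> n = (\<lambda>(j, s). (n + j, s :: 'c))" for n :: "int^'k"
  \<comment> \<open>Half of the trimmed box, times \<open>S\<close>, has to beat
    \<open>2 * box_widim \<epsilon> R\<close>; this consumes \<open>4 * c < card S\<close> and the
    choice of \<open>R\<close>.\<close>
  have JI: "J n \<times> S \<subseteq> I \<and> \<sigma> n ` (J n \<times> S) \<subseteq> I \<and> inj_on (\<sigma> n) (J n \<times> S) \<and>
      (J n \<times> S) \<inter> \<sigma> n ` (J n \<times> S) = {} \<and> 2 * box_widim \<epsilon> R < card (J n \<times> S)" if n: "n \<in> F" for n
  proof (intro conjI)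
    show "J n \<times> S \<subseteq> I" "\<sigma> n ` (J n \<times> S) \<subseteq> I" "(J n \<times> S) \<inter> \<sigma> n ` (J n \<times> S) = {}"
      using J[OF n] by (auto simp: I_def \<sigma>_def)
    show "inj_on (\<sigma> n) (J n \<times> S)" by (auto simp: inj_on_def \<sigma>_def)
    have "4 * real (box_widim \<epsilon> R) \<le> 4 * c * real R ^ CARD('k)" using R(1) by simp
    also have "\<dots> < card S * real (R - 2 * L) ^ CARD('k)" by (rule R(2))
    also have "\<dots> \<le> card S * real (2 * card (J n))"
      using J[OF n] by (intro mult_left_mono) (simp_all only: of_nat_power[symmetric] of_nat_le_iff of_nat_0_le_iff)
    finally have "4 * real (box_widim \<epsilon> R) < real (card S * (2 * card (J n)))" by simp
    then have "4 * box_widim \<epsilon> R < card S * (2 * card (J n))" by linarith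
    then show "2 * box_widim \<epsilon> R < card (J n \<times> S)" by (simp add: card_cartesian_product mult.commute)
  qed
  have "\<exists>\<Psi> \<tau>. 0 < \<tau> \<and> (\<forall>i\<in>I. continuous_on UNIV (\<Psi> i) \<and> (\<forall>x. \<bar>\<Psi> i x - f (snd i) (T (fst i) x)\<bar> \<le> 2 * (\<eta> / 2))) \<and>
    (\<forall>n\<in>F. \<forall>x y. \<exists>j\<in>J n \<times> S. \<tau> \<le> \<bar>\<Psi> (\<sigma> n j) x - \<Psi> j y\<bar>)"
  proof (rule signature_maps[where A = "box_N R" and \<epsilon> = \<epsilon>])
    show "\<forall>n\<in>F. J n \<times> S \<subseteq> I \<and> \<sigma> n ` (J n \<times> S) \<subseteq> I \<and> inj_on (\<sigma> n) (J n \<times> S) \<and>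
      (J n \<times> S) \<inter> \<sigma> n ` (J n \<times> S) = {} \<and> 2 * box_widim \<epsilon> R < card (J n \<times> S)" using JI by blast
    show "\<forall>i\<in>I. \<forall>x. 0 \<le> f (snd i) x \<and> f (snd i) x \<le> 1" using f(2) by (auto simp: I_def)
    show "\<forall>i\<in>I. \<forall>x y. dist x y < \<epsilon> \<longrightarrow> \<bar>f (snd i) x - f (snd i) y\<bar> \<le> \<eta> / 2" using \<epsilon>(2) by (auto simp: I_def)
    show "\<forall>i\<in>I. fst i \<in> box_N R" by (auto simp: I_def)
  qed (use \<epsilon>(1) \<open>0 < \<eta>\<close> I R(3) in \<open>auto simp: F_def\<close>)
  then obtain \<Psi> \<tau> where \<Psi>: "0 < \<tau>"
    "\<forall>i\<in>I. continuous_on UNIV (\<Psi> i) \<and> (\<forall>x. \<bar>\<Psi> i x - f (snd i) (T (fst i) x)\<bar> \<le> 2 * (\<eta> / 2))"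
    "\<forall>n\<in>F. \<forall>x y. \<exists>j\<in>J n \<times> S. \<tau> \<le> \<bar>\<Psi> (\<sigma> n j) x - \<Psi> j y\<bar>"
    by (elim exE conjE) rule
  have \<Psi>c: "continuous_on UNIV (\<Psi> (j, s))" and \<Psi>f: "\<bar>\<Psi> (j, s) x - f s (T j x)\<bar> \<le> \<eta>"
    if "j \<in> box_N R" "s \<in> S" for j s x
    using bspec[OF \<Psi>(2), of "(j, s)"] that by (auto simp: I_def)
  define one where "one = (\<chi> i::'k. (1::int))"
  have one: "one \<in> sup_ball R" "one \<noteq> 0" using R(3) by (auto simp: one_def sup_ball_def vec_eq_iff)
  obtain \<omega> B where \<omega>: "continuous_on UNIV \<omega>" "\<forall>x. 0 \<le> \<omega> x \<and> \<omega> x \<le> (1::real)" "finite B"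
    "\<forall>x. \<exists>n\<in>B. \<omega> (T n x) = 1" "\<forall>x. \<forall>n\<in>sup_ball R. n \<noteq> 0 \<longrightarrow> \<omega> x = 0 \<or> \<omega> (T n x) = 0"
    using marker_function[OF mp finite_sup_ball one] by (elim exE conjE) rule
  \<comment> \<open>Two marked points whose windows of side \<open>R\<close> both reach
    \<open>x\<close> would differ by a nonzero vector of \<open>sup_ball R\<close>, so at most one
    summand of \<open>g\<close> is active at \<open>x\<close>.\<close>
  have excl: "\<omega> (T (- j) x) = 0 \<or> \<omega> (T (- j') x) = 0"
    if jj: "j \<in> box_N R" "j' \<in> box_N R" "j \<noteq> j'" for j j' x
  proof -
    have "\<bar>(j - j') $ i\<bar> \<le> int R" for i
    proof -
      have "0 \<le> j $ i" "j $ i < int R" "0 \<le> j' $ i" "j' $ i < int R" using jj(1,2) by (auto simp: box_N_def)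
      then show ?thesis by simp
    qed
    then have "j - j' \<in> sup_ball R" by (simp add: sup_ball_def)
    then have "\<omega> (T (- j) x) = 0 \<or> \<omega> (T (j - j') (T (- j) x)) = 0" using \<omega>(5) jj(3) by force
    then show ?thesis by simp
  qed
  \<comment> \<open>If \<open>T (- j) x\<close> is marked, \<open>x\<close> is position
    \<open>j\<close> of its window and receives that entry of the pattern; a fractional
    \<open>\<omega>\<close> interpolates with \<open>f\<close>.\<close>
  define g where "g s x = f s x + (\<Sum>j\<in>box_N R. \<omega> (T (- j) x) * (\<Psi> (j, s) (T (- j) x) - f s x))" for s x
  have gc: "continuous_on UNIV (g s)" if "s \<in> S" for s
    unfolding g_def
    by (intro continuous_intros f(1) that continuous_on_compose2[OF \<omega>(1) T_cont] continuous_on_compose2[OF \<Psi>c T_cont]) auto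
  have gf: "\<bar>g s x - f s x\<bar> \<le> \<eta>" if s: "s \<in> S" for s x
  proof -
    have "\<bar>\<Sum>j\<in>box_N R. \<omega> (T (- j) x) * (\<Psi> (j, s) (T (- j) x) - f s x)\<bar> \<le> \<eta>"
    proof (rule abs_sum_le_single)
      fix j assume j: "j \<in> (box_N R :: (int^'k) set)"
      have "\<bar>\<omega> (T (- j) x) * (\<Psi> (j, s) (T (- j) x) - f s x)\<bar> \<le> 1 * \<eta>"
        unfolding abs_mult using \<omega>(2) \<Psi>f[OF j s, of "T (- j) x"] by (intro mult_mono) auto
      then show "\<bar>\<omega> (T (- j) x) * (\<Psi> (j, s) (T (- j) x) - f s x)\<bar> \<le> \<eta>" by simp
    next
      fix j j' assume "j \<in> (box_N R :: (int^'k) set)" "j' \<in> box_N R" "j \<noteq> j'"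
      then show "\<omega> (T (- j) x) * (\<Psi> (j, s) (T (- j) x) - f s x) = 0 \<or>
         \<omega> (T (- j') x) * (\<Psi> (j', s) (T (- j') x) - f s x) = 0" using excl[of j j' x] by auto
    qed (use \<open>0 < \<eta>\<close> in auto)
    then show ?thesis by (simp add: g_def)
  qed
  have g\<Psi>: "g s (T j x) = \<Psi> (j, s) x" if "\<omega> x = 1" "j \<in> box_N R" "s \<in> S" for s j x
  proof -
    have "(\<Sum>j'\<in>box_N R. \<omega> (T (- j') (T j x)) * (\<Psi> (j', s) (T (- j') (T j x)) - f s (T j x)))
      = \<omega> (T (- j) (T j x)) * (\<Psi> (j, s) (T (- j) (T j x)) - f s (T j x))"
    proof (rule sum_single_term)
      fix j' assume "j' \<in> (box_N R :: (int^'k) set)" "j' \<noteq> j"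
      then have "\<omega> (T (- j') (T j x)) = 0" using excl[of j j' "T j x"] that by auto
      then show "\<omega> (T (- j') (T j x)) * (\<Psi> (j', s) (T (- j') (T j x)) - f s (T j x)) = 0" by simp
    qed (use that in auto)
    then show ?thesis using that(1) by (simp add: g_def)
  qed
  define G where "G i x = g (snd i) (T (fst i) x)" for i x
  have Gc: "continuous_on UNIV (G i)" if "i \<in> I" for i
    unfolding G_def by (rule continuous_on_compose2[OF gc T_cont]) (use that in \<open>auto simp: I_def\<close>)
  \<comment> \<open>\<open>\<rho> x\<close> is the distance from the window of \<open>g\<close> at
    \<open>x\<close> to the set of all patterns. It depends on the orbit of \<open>g\<close> alone,
    whereas \<open>\<omega>\<close> need not be recoverable from \<open>g\<close>.\<close>
  define \<delta> where "\<delta> x z = (\<Sum>i\<in>I. \<bar>G i x - \<Psi> i z\<bar>)" for x z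
  define \<rho> where "\<rho> x = (INF z. \<delta> x z)" for x
  have \<delta>0: "0 \<le> \<delta> x z" for x z by (simp add: \<delta>_def sum_nonneg)
  have bb: "bdd_below (range (\<delta> x))" for x by (rule bdd_belowI2[of _ 0]) (rule \<delta>0)
  have \<rho>0: "0 \<le> \<rho> x" for x unfolding \<rho>_def by (rule cINF_greatest) (simp_all add: \<delta>0)
  have \<rho>le: "\<rho> x \<le> \<delta> x z" for x z unfolding \<rho>_def by (rule cINF_lower[OF bb]) simp
  have \<rho>d: "\<rho> x \<le> \<rho> y + (\<Sum>i\<in>I. \<bar>G i x - G i y\<bar>)" for x y
  proof -
    have "\<rho> x - (\<Sum>i\<in>I. \<bar>G i x - G i y\<bar>) \<le> \<rho> y" unfolding \<rho>_def[of y]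
    proof (rule cINF_greatest)
      fix z
      have "\<delta> x z \<le> (\<Sum>i\<in>I. \<bar>G i x - G i y\<bar>) + \<delta> y z"
        unfolding \<delta>_def sum.distrib[symmetric] by (intro sum_mono) linarith
      then show "\<rho> x - (\<Sum>i\<in>I. \<bar>G i x - G i y\<bar>) \<le> \<delta> y z" using \<rho>le[of x z] by linarith
    qed simp
    then show ?thesis by linarith
  qed
  have \<rho>c: "continuous_on UNIV \<rho>"
  proof (rule continuous_on_dominated)
    show "\<bar>\<rho> y - \<rho> x\<bar> \<le> (\<Sum>i\<in>I. \<bar>G i y - G i x\<bar>)" for x y
      using \<rho>d[of x y] \<rho>d[of y x] by (simp add: abs_minus_commute abs_le_iff)
    show "continuous_on UNIV (\<lambda>y. \<Sum>i\<in>I. \<bar>G i y - G i x\<bar>)" for x by (intro continuous_intros Gc)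
  qed simp
  \<comment> \<open>\<open>h\<close> vanishes once \<open>\<rho> \<ge> \<tau> / 2\<close>. Two
    places with \<open>h \<noteq> 0\<close> that differ by a nonzero vector of
    \<open>sup_ball L\<close> would bring a pattern within \<open>\<tau>\<close> of a translated
    one.\<close>
  define h where "h x = max 0 (1 - \<rho> x * (2 / \<tau>))" for x
  have "continuous_on UNIV h" unfolding h_def by (intro continuous_intros \<rho>c)
  moreover have "0 \<le> h x \<and> h x \<le> 1" for x using \<rho>0[of x] \<Psi>(1) by (simp add: h_def)
  moreover have "\<exists>n\<in>B. h (T n x) = 1" for x
  proof -
    obtain n where n: "n \<in> B" "\<omega> (T n x) = 1" using \<omega>(4) by blast
    have "\<delta> (T n x) (T n x) = 0"
      unfolding \<delta>_def G_def using g\<Psi>[OF n(2)] by (intro sum.neutral) (auto simp: I_def)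
    then have "\<rho> (T n x) = 0" using \<rho>le[of "T n x" "T n x"] \<rho>0[of "T n x"] by simp
    then show ?thesis using n(1) by (intro bexI[of _ n]) (simp_all add: h_def)
  qed
  moreover have "h x = 0 \<or> h (T n x) = 0" if n: "n \<in> sup_ball L" "n \<noteq> 0" for x n
  proof (rule ccontr)
    assume neg: "\<not> ?thesis"
    have near: "\<exists>z. \<forall>i\<in>I. \<bar>G i y - \<Psi> i z\<bar> < \<tau> / 2" if "h y \<noteq> 0" for y
    proof -
      have "\<rho> y < \<tau> / 2"
      proof (rule ccontr)
        assume "\<not> \<rho> y < \<tau> / 2"
        then have "1 \<le> \<rho> y * (2 / \<tau>)" using \<Psi>(1) by (simp add: field_simps)
        then show False using that by (simp add: h_def)
      qed
      then obtain z where z: "\<delta> y z < \<tau> / 2"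
        using cINF_less_iff[OF _ bb, of y "\<tau> / 2"] unfolding \<rho>_def[symmetric] by auto
      have "\<bar>G i y - \<Psi> i z\<bar> \<le> \<delta> y z" if "i \<in> I" for i
        unfolding \<delta>_def by (rule member_le_sum) (use that I(1) in auto)
      then show ?thesis using z by (intro exI[of _ z]) force
    qed
    obtain z where z: "\<forall>i\<in>I. \<bar>G i x - \<Psi> i z\<bar> < \<tau> / 2" using near[of x] neg by blast
    obtain z' where z': "\<forall>i\<in>I. \<bar>G i (T n x) - \<Psi> i z'\<bar> < \<tau> / 2" using near[of "T n x"] neg by blast
    have nF: "n \<in> F" using n by (simp add: F_def)
    obtain i where i: "i \<in> J n \<times> S" "\<tau> \<le> \<bar>\<Psi> (\<sigma> n i) z - \<Psi> i z'\<bar>" using \<Psi>(3) nF by blast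
    have "i \<in> I" "\<sigma> n i \<in> I" using JI[OF nF] i(1) by blast+
    \<comment> \<open>One and the same value of \<open>g\<close>, read in the window at
      \<open>x\<close> and in the window at \<open>T n x\<close>.\<close>
    moreover have "G (\<sigma> n i) x = G i (T n x)" by (cases i) (simp add: G_def \<sigma>_def add.commute)
    moreover have "\<bar>G (\<sigma> n i) x - \<Psi> (\<sigma> n i) z\<bar> < \<tau> / 2" "\<bar>G i (T n x) - \<Psi> i z'\<bar> < \<tau> / 2"
      using z z' calculation by blast+
    ultimately have "\<bar>\<Psi> (\<sigma> n i) z - \<Psi> i z'\<bar> < \<tau>" by linarith
    then show False using i(2) by simp
  qed
  moreover have "h x = h y" if "\<forall>n. \<forall>s\<in>S. g s (T n x) = g s (T n y)" for x y
  proof -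
    have "\<delta> x = \<delta> y" unfolding \<delta>_def G_def using that by (intro ext sum.cong) (auto simp: I_def)
    then show ?thesis by (simp add: h_def \<rho>_def)
  qed
  ultimately show ?thesis using gc gf \<omega>(3)
    by (intro exI[of _ g] exI[of _ h] exI[of _ B] conjI ballI allI impI) simp_all
qed

end

section \<open>Encoding orbits in the cells of a power diagram\<close>

definition sqn :: "int^'k \<Rightarrow> real" where
  "sqn n = (\<Sum>i\<in>UNIV. (real_of_int (n $ i))\<^sup>2)"

definition scaled :: "nat \<Rightarrow> int^'k \<Rightarrow> int^'k" where
  "scaled N v = (\<chi> i. int N * v $ i)"

lemma scaled_nth [simp]: "scaled N v $ i = int N * v $ i"
  by (simp add: scaled_def)

lemma sqn_nonneg: "0 \<le> sqn n"
  by (simp add: sqn_def sum_nonneg)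

lemma sqn_minus [simp]: "sqn (- n) = sqn n"
  by (simp add: sqn_def)

lemma coord_le_sqn: "\<bar>real_of_int (n $ i)\<bar> \<le> sqn n"
proof -
  have "(real_of_int (n $ i))\<^sup>2 \<le> sqn n" unfolding sqn_def by (rule member_le_sum) auto
  moreover have "\<bar>n $ i\<bar> \<le> (n $ i)\<^sup>2"
  proof (cases "n $ i = 0")
    case False
    then have "\<bar>n $ i\<bar> * 1 \<le> \<bar>n $ i\<bar> * \<bar>n $ i\<bar>" by (intro mult_left_mono) auto
    then show ?thesis by (simp add: power2_eq_square)
  qed simp
  then have "real_of_int \<bar>n $ i\<bar> \<le> real_of_int ((n $ i)\<^sup>2)" by (simp only: of_int_le_iff)
  ultimately show ?thesis by simp
qed

lemma finite_sqn_le: "finite {n :: int^'k. sqn n \<le> A}"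
proof (rule finite_subset)
  show "{n :: int^'k. sqn n \<le> A} \<subseteq> sup_ball (nat \<lceil>A\<rceil>)"
  proof
    fix n :: "int^'k" assume "n \<in> {n. sqn n \<le> A}"
    then have A: "sqn n \<le> A" by simp
    have "\<bar>n $ i\<bar> \<le> int (nat \<lceil>A\<rceil>)" for i
    proof -
      have "real_of_int \<bar>n $ i\<bar> \<le> A" using coord_le_sqn[of n i] A by simp
      then have "\<bar>n $ i\<bar> \<le> \<lceil>A\<rceil>" by (simp add: le_ceiling_iff)
      then show ?thesis by linarith
    qed
    then show "n \<in> sup_ball (nat \<lceil>A\<rceil>)" by (simp add: sup_ball_def)
  qed
qed simp

text \<open>The two inequalities say that \<open>u\<close> lies (up to a slack) in the cell of the marker \<open>0\<close>, and \<open>m + u'\<close> in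
  the cell of the marker \<open>m\<close>, of one power diagram. Moving both points towards their markers by the factor
  \<open>(N - 1) / N\<close> separates them by about \<open>\<bar>m\<bar> / N\<close>, so if the contracted cubes still meet then
  \<open>\<bar>m\<bar> = O(N\<^sup>2)\<close>.\<close>

lemma contracted_cells_meet:
  fixes m u u' v v' a a' b b' :: "int^'k"
  assumes N: "1 \<le> N"
    and box: "a \<in> box_N N" "a' \<in> box_N N" "b \<in> box_N N" "b' \<in> box_N N"
    and u: "u = scaled N v + a" "u' = scaled N v' + a'"
    and meet: "scaled (N - 1) v + b = m + (scaled (N - 1) v' + b')"
    and cell: "sqn u + w - 1 < sqn (m - u) + w'" "sqn u' + w' - 1 < sqn (m + u') + w"
  shows "m \<in> sup_ball (2 * CARD('k) * N^2 + N)"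
proof (rule ccontr)
  assume notin: "\<not> ?thesis"
  define M where "M = Max (range (\<lambda>i. \<bar>m $ i\<bar>))"
  have M: "\<bar>m $ i\<bar> \<le> M" for i unfolding M_def by (rule Max_ge) auto
  have "M \<in> range (\<lambda>i. \<bar>m $ i\<bar>)" unfolding M_def by (rule Max_in) auto
  then obtain i0 where i0: "M = \<bar>m $ i0\<bar>" by auto
  have Mbig: "int (2 * CARD('k) * N^2 + N) < M"
  proof (rule ccontr)
    assume "\<not> int (2 * CARD('k) * N^2 + N) < M"
    then have "\<bar>m $ i\<bar> \<le> int (2 * CARD('k) * N^2 + N)" for i using M[of i] by linarith
    then show False using notin unfolding sup_ball_def by blast
  qed
  \<comment> \<open>The rounding error left when \<open>v\<close> and \<open>v'\<close> are
    eliminated: up to \<open>e\<close>, the vector \<open>(N - 1) * (u - u')\<close> equals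
    \<open>N * m\<close>.\<close>
  define e where "e i = int N * (b' $ i - b $ i) + int (N - 1) * (a $ i - a' $ i)" for i
  have e: "\<bar>e i\<bar> \<le> 2 * int N ^ 2" for i
  proof -
    have r: "0 \<le> a $ i" "a $ i < int N" "0 \<le> a' $ i" "a' $ i < int N"
      "0 \<le> b $ i" "b $ i < int N" "0 \<le> b' $ i" "b' $ i < int N"
      using box by (auto simp: box_N_def)
    have "\<bar>int N * (b' $ i - b $ i)\<bar> \<le> int N * int N"
      unfolding abs_mult using r by (intro mult_mono) auto
    moreover have "\<bar>int (N - 1) * (a $ i - a' $ i)\<bar> \<le> int N * int N"
      unfolding abs_mult using r by (intro mult_mono) auto
    ultimately show ?thesis unfolding e_def power2_eq_square by linarith
  qed
  have diff: "int (N - 1) * (u $ i - u' $ i) = int N * m $ i + e i" for i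
  proof -
    have "int (N - 1) * v $ i + b $ i = m $ i + (int (N - 1) * v' $ i + b' $ i)"
      using meet by (metis scaled_nth vector_add_component)
    then have mm: "m $ i = int (N - 1) * v $ i + b $ i - int (N - 1) * v' $ i - b' $ i" by simp
    show ?thesis unfolding u e_def mm by (simp add: algebra_simps)
  qed
  \<comment> \<open>\<open>sq\<close> is the squared length of \<open>m\<close> and
    \<open>ip\<close> its inner product with \<open>u - u'\<close>. Adding the two cell inequalities
    cancels the weights and gives \<open>ip < sq + 1\<close>; by integrality the slack disappears.
    With \<open>diff\<close>, the square of the sup norm \<open>M\<close> is then bounded by a
    linear function of \<open>M\<close>.\<close>
  define sq where "sq = (\<Sum>i\<in>UNIV. (m $ i)\<^sup>2)"
  define ip where "ip = (\<Sum>i\<in>UNIV. m $ i * (u $ i - u' $ i))"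
  have "sqn (m - u) + sqn (m + u') - sqn u - sqn u' = real_of_int (2 * sq - 2 * ip)"
    unfolding sqn_def sq_def ip_def
    by (simp add: power2_eq_square algebra_simps sum.distrib sum_subtractf sum_distrib_left)
  then have "real_of_int (-2) < real_of_int (2 * sq - 2 * ip)" using cell by simp
  then have "ip < sq + 1" by linarith
  then have 1: "int (N - 1) * ip \<le> int (N - 1) * sq" by (intro mult_left_mono) auto
  have "int (N - 1) * ip = (\<Sum>i\<in>UNIV. m $ i * (int (N - 1) * (u $ i - u' $ i)))"
    unfolding ip_def by (simp add: sum_distrib_left mult.left_commute)
  also have "\<dots> = int N * sq + (\<Sum>i\<in>UNIV. m $ i * e i)"
    unfolding diff sq_def by (simp add: algebra_simps power2_eq_square sum.distrib sum_distrib_left)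
  finally have "int N * sq + (\<Sum>i\<in>UNIV. m $ i * e i) \<le> int (N - 1) * sq" using 1 by simp
  moreover have "int (N - 1) * sq = int N * sq - sq" using N by (simp add: of_nat_diff algebra_simps)
  ultimately have "sq \<le> - (\<Sum>i\<in>UNIV. m $ i * e i)" by linarith
  also have "\<dots> \<le> (\<Sum>i\<in>UNIV. \<bar>m $ i * e i\<bar>)" using sum_abs[of "\<lambda>i. m $ i * e i" UNIV] by linarith
  also have "\<dots> \<le> (\<Sum>i\<in>(UNIV :: 'k set). M * (2 * int N ^ 2))"
    unfolding abs_mult using M e i0 by (intro sum_mono mult_mono) auto
  also have "\<dots> = int (2 * CARD('k) * N^2) * M" by (simp add: power2_eq_square)
  finally have "sq \<le> int (2 * CARD('k) * N^2) * M" .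
  moreover have "M * M \<le> sq"
    unfolding i0 sq_def by (simp add: abs_mult_self_eq flip: power2_eq_square) (rule member_le_sum; simp)
  ultimately have "M * M \<le> int (2 * CARD('k) * N^2) * M" by linarith
  moreover have "0 < M" using Mbig by linarith
  ultimately have "M \<le> int (2 * CARD('k) * N^2)" by (simp add: mult_le_cancel_right)
  then show False using Mbig by simp
qed

lemma scaled_add_inj:
  assumes "b \<in> box_N N" "b' \<in> box_N N" "scaled N v + b = scaled N v' + b'"
  shows "v = v' \<and> b = b'"
proof -
  have "v $ i = v' $ i \<and> b $ i = b' $ i" for i
  proof -
    have r: "0 \<le> b $ i" "b $ i < int N" "0 \<le> b' $ i" "b' $ i < int N"
      using assms(1,2) by (auto simp: box_N_def)
    have e: "int N * v $ i + b $ i = int N * v' $ i + b' $ i"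
      using assms(3) by (metis scaled_nth vector_add_component)
    have "(b $ i + int N * v $ i) div int N = (b' $ i + int N * v' $ i) div int N" using e by (simp add: add.commute)
    then have "v $ i = v' $ i" using r by (simp add: div_pos_pos_trivial)
    then show ?thesis using e by simp
  qed
  then show ?thesis by (simp add: vec_eq_iff)
qed

context zk_system
begin

text \<open>The cube \<open>C v\<close> of side \<open>N\<close>, relative to a marker, is encoded in the cube \<open>q v ` box_N (N - 1)\<close> of side
  \<open>N - 1\<close>; \<open>\<theta> v x\<close> measures how far \<open>C v\<close> reaches into the power diagram cell of the marker of \<open>x\<close> at \<open>0\<close>.
  Markers carry the weight \<open>w\<close>, which is \<open>0\<close> when \<open>h = 1\<close> and so large that the cell is empty when \<open>h = 0\<close>.\<close>

lemma encoding_with_markers: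
  fixes f :: "'c \<Rightarrow> 'a \<Rightarrow> real" and h :: "'a \<Rightarrow> real"
  assumes N: "2 \<le> N" and S: "finite S" and "0 < \<epsilon>" "0 < \<eta>"
    and f: "\<And>s. s \<in> S \<Longrightarrow> continuous_on UNIV (f s)" "\<And>s x. s \<in> S \<Longrightarrow> 0 \<le> f s x \<and> f s x \<le> 1"
    and modulus: "\<And>s x y. s \<in> S \<Longrightarrow> dist x y < \<epsilon> \<Longrightarrow> \<bar>f s x - f s y\<bar> \<le> \<eta> / 2"
    and capacity: "2 * (box_widim \<epsilon> N + box_widim \<epsilon> (N - 1)) < card S * (N - 1) ^ CARD('k)"
    and h: "continuous_on UNIV h" "\<And>x. 0 \<le> h x \<and> h x \<le> 1"
    and B: "finite B" "\<And>x. \<exists>n\<in>B. h (T n x) = 1"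
    and sep: "\<And>x n. n \<in> sup_ball (2 * CARD('k) * N^2 + N) \<Longrightarrow> n \<noteq> 0 \<Longrightarrow> h x = 0 \<or> h (T n x) = 0"
  shows "\<exists>g. (\<forall>s\<in>S. continuous_on UNIV (g s) \<and> (\<forall>x. \<bar>g s x - f s x\<bar> \<le> \<eta>)) \<and>
    (\<forall>x y. (\<forall>n. h (T n x) = h (T n y)) \<longrightarrow> (\<forall>n. \<forall>s\<in>S. g s (T n x) = g s (T n y)) \<longrightarrow> dist x y < \<epsilon>)"
proof -
  have Bne: "B \<noteq> {}" using B(2) by blast
  define A0 where "A0 = Max (sqn ` B)"
  have A0: "sqn n \<le> A0" if "n \<in> B" for n unfolding A0_def using B(1) that by (intro Max_ge) auto
  \<comment> \<open>Every point sees a marker of weight 0 at squared distance at most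
    \<open>A0\<close>. A marker with \<open>h = 0\<close> has weight \<open>A0 + 1\<close> and loses
    every point even with a slack of 1.\<close>
  define w where "w x = (A0 + 1) * (1 - h x)" for x
  have A00: "0 \<le> A0"
  proof -
    obtain n where "n \<in> B" using Bne by blast
    then show ?thesis using A0[of n] sqn_nonneg[of n] by linarith
  qed
  have w0: "0 \<le> w x" for x using h(2)[of x] A00 by (simp add: w_def)
  have wc: "continuous_on UNIV w" unfolding w_def by (intro continuous_intros h(1))
  define D where "D = {n :: int^'k. sqn n \<le> A0}"
  have D: "finite D" "D \<noteq> {}" using finite_sqn_le[of A0] A0 Bne by (auto simp: D_def)
  \<comment> \<open>\<open>- \<nu> z\<close> is the power distance from the position of
    \<open>z\<close> to the nearest marker. Markers outside the finite set \<open>D\<close> cannot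
    win, so finitely many competitors suffice and \<open>\<nu>\<close> is continuous.\<close>
  define \<nu> where "\<nu> z = Max ((\<lambda>n. - sqn n - w (T n z)) ` D)" for z
  have \<nu>c: "continuous_on UNIV \<nu>"
    unfolding \<nu>_def by (intro continuous_on_Max_image D continuous_intros continuous_on_compose2[OF wc T_cont]) auto
  have \<nu>D: "- sqn n - w (T n z) \<le> \<nu> z" if "n \<in> D" for n z
    unfolding \<nu>_def using D(1) that by (intro Max_ge) auto
  have \<nu>A0: "- A0 \<le> \<nu> z" for z
  proof -
    obtain n where n: "n \<in> B" "h (T n z) = 1" using B(2) by blast
    then have "n \<in> D" "w (T n z) = 0" using A0 by (simp_all add: D_def w_def)
    then show ?thesis using \<nu>D[of n z] A0[OF n(1)] by linarith
  qed
  have \<nu>: "- sqn n - w (T n z) \<le> \<nu> z" for n z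
  proof (cases "n \<in> D")
    case False
    then show ?thesis using \<nu>A0[of z] w0[of "T n z"] by (simp add: D_def)
  qed (rule \<nu>D)
  have \<nu>attained: "\<exists>n\<in>D. \<nu> z = - sqn n - w (T n z)" for z
  proof -
    have "\<nu> z \<in> (\<lambda>n. - sqn n - w (T n z)) ` D" unfolding \<nu>_def using D by (intro Max_in) auto
    then show ?thesis by blast
  qed
  define C where "C v = (+) (scaled N v) ` (box_N N :: (int^'k) set)" for v
  have C: "finite (C v)" "C v \<noteq> {}" for v using N by (auto simp: C_def)
  \<comment> \<open>The term for \<open>u\<close> is the least power distance at position
    \<open>u\<close> minus the power distance to the marker of \<open>x\<close>: nonpositive, and 0
    exactly if \<open>u\<close> lies in that cell. Thus \<open>\<theta> v x = 1\<close> if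
    \<open>C v\<close> meets the cell, and \<open>\<theta>\<close> has faded to 0 once
    \<open>C v\<close> misses it by 1.\<close>
  define M where "M v x = Max ((\<lambda>u. - \<nu> (T u x) - sqn u - w x) ` C v)" for v x
  define \<theta> where "\<theta> v x = max 0 (1 + M v x)" for v x
  have \<theta>c: "continuous_on UNIV (\<theta> v)" for v
    unfolding \<theta>_def M_def
    by (intro continuous_on_Max_image C continuous_intros continuous_on_compose2[OF \<nu>c T_cont] wc) auto
  have le0: "- \<nu> (T u x) - sqn u - w x \<le> 0" for u x
    using \<nu>[of "- u" "T u x"] by simp
  have Mle: "M v x \<le> 0" for v x
    unfolding M_def using C le0 by (subst Max_le_iff) auto
  have \<theta>01: "0 \<le> \<theta> v x" "\<theta> v x \<le> 1" for v x using Mle[of v x] by (auto simp: \<theta>_def)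
  have \<theta>pos: "\<exists>u\<in>C v. sqn u + w x - 1 < - \<nu> (T u x)" if "\<theta> v x \<noteq> 0" for v x
  proof -
    have "- 1 < M v x" using that by (simp add: \<theta>_def max_def split: if_splits)
    moreover have "M v x \<in> (\<lambda>u. - \<nu> (T u x) - sqn u - w x) ` C v" unfolding M_def using C by (intro Max_in) auto
    then obtain u where "u \<in> C v" "M v x = - \<nu> (T u x) - sqn u - w x" by blast
    ultimately show ?thesis by (intro bexI[of _ u]) auto
  qed
  have hpos: "h x \<noteq> 0" if \<theta>: "\<theta> v x \<noteq> 0" for v x
  proof -
    obtain u where "sqn u + w x - 1 < - \<nu> (T u x)" using \<theta>pos[OF \<theta>] by blast
    then have "w x < A0 + 1" using \<nu>A0[of "T u x"] sqn_nonneg[of u] by linarith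
    then show ?thesis by (auto simp: w_def)
  qed
  \<comment> \<open>Relative to the marker at \<open>n\<close>, the given point has position
    \<open>- n\<close>, and a winning marker has \<open>n \<in> D\<close>. So the cubes that contain
    some \<open>- n\<close> with \<open>n \<in> D\<close> cover every point from the marker of its
    cell.\<close>
  define V where "V = (\<lambda>n. (\<chi> i. (- n $ i) div int N) :: int^'k) ` D"
  have fV: "finite V" using D(1) by (simp add: V_def)
  have covered: "\<exists>n. \<exists>v\<in>V. - n \<in> C v \<and> \<theta> v (T n x) = 1" for x
  proof -
    obtain n where n: "n \<in> D" "\<nu> x = - sqn n - w (T n x)" using \<nu>attained by blast
    define v where "v = ((\<chi> i. (- n $ i) div int N) :: int^'k)"
    have "v \<in> V" using n(1) by (auto simp: V_def v_def)
    define b where "b = ((\<chi> i. (- n $ i) mod int N) :: int^'k)"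
    have "b \<in> box_N N" using N by (simp add: b_def box_N_def)
    moreover have "- n = scaled N v + b" by (simp add: vec_eq_iff v_def b_def)
    ultimately have nC: "- n \<in> C v" by (auto simp: C_def)
    have "- \<nu> (T (- n) (T n x)) - sqn (- n) - w (T n x) = 0" using n(2) by simp
    then have "0 \<le> M v (T n x)" unfolding M_def using C nC by (subst Max_ge_iff) force+
    then have "\<theta> v (T n x) = 1" using Mle[of v "T n x"] by (simp add: \<theta>_def)
    then show ?thesis using \<open>v \<in> V\<close> nC by blast
  qed
  define q where "q v b = scaled (N - 1) v + b" for v b :: "int^'k"
  \<comment> \<open>Two active contracted cubes containing \<open>x\<close> belong to markers that
    differ by \<open>m\<close>. Then \<open>contracted_cells_meet\<close> bounds \<open>m\<close>,
    separation of the markers forces \<open>m = 0\<close>, and the contracted cubes of one marker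
    are disjoint.\<close>
  have exclusive: "(v, b) = (v', b')"
    if bb: "b \<in> box_N (N - 1)" "b' \<in> box_N (N - 1)"
      and nz: "\<theta> v (T (- q v b) x) \<noteq> 0" "\<theta> v' (T (- q v' b') x) \<noteq> 0" for v v' b b' x
  proof -
    define m where "m = q v b - q v' b'"
    define z where "z = T (- q v b) x"
    have z': "T (- q v' b') x = T m z" by (simp add: m_def z_def)
    have nz': "\<theta> v z \<noteq> 0" "\<theta> v' (T m z) \<noteq> 0" using nz unfolding z' z_def by simp_all
    obtain u where u: "u \<in> C v" "sqn u + w z - 1 < - \<nu> (T u z)" using \<theta>pos[OF nz'(1)] by blast
    obtain u' where u': "u' \<in> C v'" "sqn u' + w (T m z) - 1 < - \<nu> (T u' (T m z))" using \<theta>pos[OF nz'(2)] by blast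
    obtain a where a: "a \<in> box_N N" "u = scaled N v + a" using u(1) by (auto simp: C_def)
    obtain a' where a': "a' \<in> box_N N" "u' = scaled N v' + a'" using u'(1) by (auto simp: C_def)
    have sub: "(box_N (N - 1) :: (int^'k) set) \<subseteq> box_N N"
    proof
      fix n :: "int^'k" assume n: "n \<in> box_N (N - 1)"
      have "0 \<le> n $ i \<and> n $ i < int N" for i
      proof -
        have "0 \<le> n $ i \<and> n $ i < int (N - 1)" using n unfolding box_N_def by blast
        then show ?thesis by linarith
      qed
      then show "n \<in> box_N N" by (simp add: box_N_def)
    qed
    have "m \<in> sup_ball (2 * CARD('k) * N^2 + N)"
    proof (rule contracted_cells_meet)
      show "sqn u + w z - 1 < sqn (m - u) + w (T m z)" using u(2) \<nu>[of "m - u" "T u z"] by simp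
      have "- m - u' = - (m + u')" by simp
      then have "sqn (- m - u') = sqn (m + u')" by (simp only: sqn_minus)
      then show "sqn u' + w (T m z) - 1 < sqn (m + u') + w z"
        using u'(2) \<nu>[of "- m - u'" "T u' (T m z)"] by simp
      show "scaled (N - 1) v + b = m + (scaled (N - 1) v' + b')" by (simp add: m_def q_def)
    qed (use N a a' bb sub in auto)
    moreover have "h z \<noteq> 0" "h (T m z) \<noteq> 0" using hpos nz' by blast+
    ultimately have "m = 0" using sep by blast
    then have "scaled (N - 1) v + b = scaled (N - 1) v' + b'" by (simp add: m_def q_def)
    then show ?thesis using scaled_add_inj[OF bb] by simp
  qed
  define I where "I = (box_N (N - 1) :: (int^'k) set) \<times> S"
  \<comment> \<open>The values are written on the contracted cube and the orbit is recovered on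
    \<open>C v\<close>. With both in the window, the encoding can stay close to \<open>f\<close> on
    the former and determine the latter.\<close>
  define encodes where "encodes v \<Psi> \<longleftrightarrow>
    (\<forall>i\<in>I. continuous_on UNIV (\<Psi> i) \<and> (\<forall>x. \<bar>\<Psi> i x - f (snd i) (T (q v (fst i)) x)\<bar> \<le> 2 * (\<eta> / 2))) \<and>
    (\<forall>x y. (\<forall>i\<in>I. \<Psi> i x = \<Psi> i y) \<longrightarrow> (\<forall>n\<in>C v \<union> q v ` box_N (N - 1). dist (T n x) (T n y) < \<epsilon>))"
    for v and \<Psi> :: "(int^'k) \<times> 'c \<Rightarrow> 'a \<Rightarrow> real"
  have "\<exists>\<Psi>. encodes v \<Psi>" for v
    unfolding encodes_def
  proof (rule encoding_maps)
    have Q: "finite (q v ` box_N (N - 1))" "q v ` box_N (N - 1) \<noteq> {}" using N by auto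
    show "finite (C v \<union> q v ` box_N (N - 1))" "C v \<union> q v ` box_N (N - 1) \<noteq> {}" using C Q(1) by auto
    show "\<forall>i\<in>I. q v (fst i) \<in> C v \<union> q v ` box_N (N - 1)" by (auto simp: I_def)
    show "\<forall>i\<in>I. \<forall>x. 0 \<le> f (snd i) x \<and> f (snd i) x \<le> 1" using f(2) by (auto simp: I_def)
    show "\<forall>i\<in>I. \<forall>x y. dist x y < \<epsilon> \<longrightarrow> \<bar>f (snd i) x - f (snd i) y\<bar> \<le> \<eta> / 2" using modulus by (auto simp: I_def)
    show "finite I" using S by (simp add: I_def)
    have "widim \<epsilon> (dyn_dist T (C v \<union> q v ` box_N (N - 1)))
        \<le> widim \<epsilon> (dyn_dist T (C v)) + widim \<epsilon> (dyn_dist T (q v ` box_N (N - 1)))"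
      by (rule widim_Un[OF C Q \<open>0 < \<epsilon>\<close>])
    also have "\<dots> \<le> box_widim \<epsilon> N + box_widim \<epsilon> (N - 1)"
    proof (rule add_mono)
      show "widim \<epsilon> (dyn_dist T (C v)) \<le> box_widim \<epsilon> N"
        by (rule widim_pullback[where n = "scaled N v"]) (use C N \<open>0 < \<epsilon>\<close> in \<open>auto simp: C_def\<close>)
      show "widim \<epsilon> (dyn_dist T (q v ` box_N (N - 1))) \<le> box_widim \<epsilon> (N - 1)"
        by (rule widim_pullback[where n = "scaled (N - 1) v"]) (use Q N \<open>0 < \<epsilon>\<close> in \<open>auto simp: q_def\<close>)
    qed
    finally show "2 * widim \<epsilon> (dyn_dist T (C v \<union> q v ` box_N (N - 1))) < card I"
      using capacity by (simp add: I_def card_cartesian_product mult.commute)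
  qed (use \<open>0 < \<epsilon>\<close> \<open>0 < \<eta>\<close> in auto)
  then have "\<forall>v. \<exists>\<Psi>. encodes v \<Psi>" by blast
  from choice[OF this] obtain \<Psi> where \<Psi>: "\<forall>v. encodes v (\<Psi> v)" by blast
  have \<Psi>I: "\<forall>i\<in>I. continuous_on UNIV (\<Psi> v i) \<and> (\<forall>x. \<bar>\<Psi> v i x - f (snd i) (T (q v (fst i)) x)\<bar> \<le> 2 * (\<eta> / 2))"
    "\<forall>x y. (\<forall>i\<in>I. \<Psi> v i x = \<Psi> v i y) \<longrightarrow> (\<forall>n\<in>C v \<union> q v ` box_N (N - 1). dist (T n x) (T n y) < \<epsilon>)" for v
    using spec[OF \<Psi>, of v] unfolding encodes_def by simp_all
  have \<Psi>c: "continuous_on UNIV (\<Psi> v (b, s))" and \<Psi>f: "\<bar>\<Psi> v (b, s) x - f s (T (q v b) x)\<bar> \<le> \<eta>"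
    if "b \<in> box_N (N - 1)" "s \<in> S" for v b s x
    using bspec[OF \<Psi>I(1), of "(b, s)"] that by (auto simp: I_def)
  have \<Psi>inj: "dist (T n x) (T n y) < \<epsilon>" if "\<And>i. i \<in> I \<Longrightarrow> \<Psi> v i x = \<Psi> v i y" "n \<in> C v" for v x y n
    using \<Psi>I(2)[of v, rule_format, of x y n] that by blast
  define W where "W = V \<times> (box_N (N - 1) :: (int^'k) set)"
  have fW: "finite W" by (simp add: W_def fV)
  define term' where "term' s x p = \<theta> (fst p) (T (- q (fst p) (snd p)) x) *
     (\<Psi> (fst p) (snd p, s) (T (- q (fst p) (snd p)) x) - f s x)" for s x p
  define g where "g s x = f s x + sum (term' s x) W" for s x
  have gc: "continuous_on UNIV (g s)" if "s \<in> S" for s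
    unfolding g_def term'_def
    by (intro continuous_intros f(1) that continuous_on_compose2[OF \<theta>c T_cont] continuous_on_compose2[OF \<Psi>c T_cont])
      (auto simp: W_def that)
  have gf: "\<bar>g s x - f s x\<bar> \<le> \<eta>" if s: "s \<in> S" for s x
  proof -
    have "\<bar>sum (term' s x) W\<bar> \<le> \<eta>"
    proof (rule abs_sum_le_single[OF fW])
      fix p assume p: "p \<in> W"
      then have b: "snd p \<in> box_N (N - 1)" by (auto simp: W_def)
      have "\<bar>term' s x p\<bar> \<le> 1 * \<eta>"
        unfolding term'_def abs_mult
        using \<theta>01 \<Psi>f[OF b s, of "fst p" "T (- q (fst p) (snd p)) x"] by (intro mult_mono) auto
      then show "\<bar>term' s x p\<bar> \<le> \<eta>" by simp
    next
      fix p p' assume p: "p \<in> W" "p' \<in> W" "p \<noteq> p'"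
      have b: "snd p \<in> box_N (N - 1)" "snd p' \<in> box_N (N - 1)" using p by (auto simp: W_def)
      show "term' s x p = 0 \<or> term' s x p' = 0"
        using exclusive[OF b, of "fst p" x "fst p'"] p(3) by (auto simp: term'_def)
    qed (use \<open>0 < \<eta>\<close> in auto)
    then show ?thesis by (simp add: g_def)
  qed
  have g\<Psi>: "g s (T (q v b) x) = \<Psi> v (b, s) x"
    if one: "\<theta> v x = 1" and vb: "v \<in> V" "b \<in> box_N (N - 1)" and s: "s \<in> S" for s v b x
  proof -
    have "sum (term' s (T (q v b) x)) W = term' s (T (q v b) x) (v, b)"
    proof (rule sum_single_term[OF fW])
      show "(v, b) \<in> W" using vb by (simp add: W_def)
      fix p assume p: "p \<in> W" "p \<noteq> (v, b)"
      have "snd p \<in> box_N (N - 1)" using p by (auto simp: W_def)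
      then have "\<theta> (fst p) (T (- q (fst p) (snd p)) (T (q v b) x)) = 0"
        using exclusive[of "snd p" b "fst p" "T (q v b) x" v] vb p(2) one by auto
      then show "term' s (T (q v b) x) p = 0" by (simp add: term'_def)
    qed
    then show ?thesis using one by (simp add: g_def term'_def)
  qed
  \<comment> \<open>Equality of \<open>h\<close> passes to \<open>w\<close>, \<open>\<nu>\<close>
    and \<open>\<theta>\<close>, so \<open>x\<close> and \<open>y\<close> have the same diagram.
    Some cube with \<open>\<theta> = 1\<close> contains the position \<open>- n\<close> of
    \<open>x\<close>; it is decoded from \<open>g\<close> on its contraction, and time
    \<open>- n\<close> leads from the marker back to \<open>x\<close> and \<open>y\<close>.\<close>
  have "dist x y < \<epsilon>" if hh: "\<And>n. h (T n x) = h (T n y)" and gg: "\<And>n s. s \<in> S \<Longrightarrow> g s (T n x) = g s (T n y)" for x y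
  proof -
    have ww: "w (T n x) = w (T n y)" for n by (simp only: w_def hh)
    have \<nu>\<nu>: "\<nu> (T n x) = \<nu> (T n y)" for n by (simp add: \<nu>_def ww)
    have \<theta>\<theta>: "\<theta> v (T n x) = \<theta> v (T n y)" for v n by (simp add: \<theta>_def M_def ww \<nu>\<nu>)
    obtain n v where nv: "v \<in> V" "- n \<in> C v" "\<theta> v (T n x) = 1" using covered by blast
    have "dist (T (- n) (T n x)) (T (- n) (T n y)) < \<epsilon>"
    proof (rule \<Psi>inj[OF _ nv(2)])
      fix i assume "i \<in> I"
      then obtain b s where i: "i = (b, s)" "b \<in> box_N (N - 1)" "s \<in> S" by (auto simp: I_def)
      have "\<Psi> v i (T n x) = g s (T (q v b) (T n x))"
        using g\<Psi>[OF nv(3) nv(1) i(2,3)] i(1) by simp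
      also have "\<dots> = g s (T (q v b) (T n y))" using gg[OF i(3)] by simp
      also have "\<dots> = \<Psi> v i (T n y)"
        using g\<Psi>[OF _ nv(1) i(2,3), of "T n y"] nv(3) \<theta>\<theta> i(1) by simp
      finally show "\<Psi> v i (T n x) = \<Psi> v i (T n y)" .
    qed
    then show ?thesis by simp
  qed
  then show ?thesis using gc gf
    by (intro exI[of _ g] conjI ballI allI impI) simp_all
qed

end

section \<open>Density of embeddings\<close>

context zk_system
begin

lemma dense_approximate_embeddings:
  fixes f :: "'a \<Rightarrow> real^'m" and D :: nat
  assumes mp: "marker_property T" and D: "0 < D" "CARD('m) = 2 * D" and c: "4 * c < real D"
    and growth: "\<And>\<epsilon>. 0 < \<epsilon> \<Longrightarrow> \<forall>\<^sub>F N in sequentially. real (box_widim \<epsilon> N) \<le> c * real N ^ CARD('k)"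
    and f: "continuous_on UNIV f" "\<And>x i. 0 \<le> f x $ i \<and> f x $ i \<le> 1"
    and "0 < \<epsilon>" "0 < \<delta>"
  shows "\<exists>g. continuous_on UNIV g \<and> (\<forall>x i. 0 \<le> g x $ i \<and> g x $ i \<le> 1) \<and> (\<forall>x i. \<bar>g x $ i - f x $ i\<bar> \<le> \<delta>) \<and>
    (\<forall>x y. (\<forall>n. g (T n x) = g (T n y)) \<longrightarrow> dist x y < \<epsilon>)"
proof -
  \<comment> \<open>\<open>F\<close> squeezes \<open>f\<close> into
    \<open>[\<eta>, 1 - \<eta>]\<close>, so that errors up to \<open>\<eta>\<close> stay inside the
    cube. One \<open>\<eta>\<close> is spent on squeezing and one on encoding, hence
    \<open>\<delta> / 2\<close>; the bound \<open>1 / 4\<close> keeps \<open>1 - 2 * \<eta>\<close>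
    positive.\<close>
  define \<eta> where "\<eta> = min (\<delta> / 2) (1 / 4)"
  have \<eta>: "0 < \<eta>" "\<eta> \<le> 1 / 4" "2 * \<eta> \<le> \<delta>" using \<open>0 < \<delta>\<close> by (auto simp: \<eta>_def)
  define F where "F i x = \<eta> + (1 - 2 * \<eta>) * f x $ i" for i x
  have Fc: "continuous_on UNIV (F i)" for i unfolding F_def by (intro continuous_intros f(1))
  have Fb: "\<eta> \<le> F i x \<and> F i x \<le> 1 - \<eta>" for i x
  proof -
    define p where "p = (1 - 2 * \<eta>) * f x $ i"
    have "0 \<le> p" using f(2)[of x i] \<eta> by (simp add: p_def)
    moreover have "p \<le> (1 - 2 * \<eta>) * 1" unfolding p_def using f(2)[of x i] \<eta> by (intro mult_left_mono) auto
    ultimately show ?thesis unfolding F_def p_def[symmetric] by simp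
  qed
  have F01: "0 \<le> F i x \<and> F i x \<le> 1" for i x using Fb[of i x] \<eta>(1) by (intro conjI) linarith+
  have Ff: "\<bar>F i x - f x $ i\<bar> \<le> \<eta>" for i x
  proof -
    have "0 \<le> \<eta> * f x $ i" "\<eta> * f x $ i \<le> \<eta> * 1" using f(2)[of x i] \<eta> by (auto intro!: mult_left_mono)
    moreover have "F i x - f x $ i = \<eta> - 2 * (\<eta> * f x $ i)" by (simp add: F_def algebra_simps)
    ultimately show ?thesis unfolding abs_le_iff by linarith
  qed
  obtain S1 :: "'m set" where S1: "card S1 = D"
    using obtain_subset_with_card_n[of D "UNIV :: 'm set"] D(2) by auto
  define S2 where "S2 = - S1"
  have S2: "card S2 = D" using S1 D(2) by (simp add: S2_def Compl_eq_Diff_UNIV card_Diff_subset)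
  have fin: "finite S1" "finite S2" "S1 \<noteq> {}" using S1 D(1) by auto
  have "\<exists>\<epsilon>>0. \<forall>i\<in>S2. \<forall>x y. dist x y < \<epsilon> \<longrightarrow> \<bar>F i x - F i y\<bar> \<le> \<eta> / 2"
    by (rule uniform_modulus[OF fin(2) Fc]) (use \<eta>(1) in simp)
  then obtain \<epsilon>1 where \<epsilon>1: "0 < \<epsilon>1" "\<forall>i\<in>S2. \<forall>x y. dist x y < \<epsilon>1 \<longrightarrow> \<bar>F i x - F i y\<bar> \<le> \<eta> / 2" by blast
  define \<epsilon>0 where "\<epsilon>0 = min \<epsilon> \<epsilon>1"
  have \<epsilon>0: "0 < \<epsilon>0" "\<epsilon>0 \<le> \<epsilon>" "\<epsilon>0 \<le> \<epsilon>1" using \<open>0 < \<epsilon>\<close> \<epsilon>1(1) by (auto simp: \<epsilon>0_def)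
  obtain N0 where N0: "\<And>N. N0 \<le> N \<Longrightarrow> real (box_widim \<epsilon>0 N) \<le> c * real N ^ CARD('k)"
    using growth[OF \<epsilon>0(1)] unfolding eventually_sequentially by blast
  obtain N1 where N1: "\<And>N. N1 \<le> N \<Longrightarrow> 4 * c * real N ^ CARD('k) < real D * real (N - 1) ^ CARD('k)"
    using eventually_power_shift[OF c, of "CARD('k)" 1] unfolding eventually_sequentially by blast
  \<comment> \<open>The offset 2 places \<open>N - 1\<close> beyond \<open>N0\<close> as well and
    gives \<open>2 \<le> N\<close>.\<close>
  define N where "N = N0 + N1 + 2"
  have N: "2 \<le> N" by (simp add: N_def)
  have a: "real (box_widim \<epsilon>0 N) \<le> c * real N ^ CARD('k)" "real (box_widim \<epsilon>0 (N - 1)) \<le> c * real (N - 1) ^ CARD('k)"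
    by (intro N0; simp add: N_def)+
  \<comment> \<open>Width dimension is nonnegative, so the bound at \<open>N\<close> fixes the sign
    of \<open>c\<close>; then \<open>c * (N - 1) ^ k\<close> may be enlarged to
    \<open>c * N ^ k\<close>.\<close>
  have "0 \<le> c"
  proof (rule ccontr)
    assume "\<not> 0 \<le> c"
    then have "c * real N ^ CARD('k) < 0" using N by (intro mult_neg_pos) auto
    then show False using a(1) by simp
  qed
  have "real (N - 1) ^ CARD('k) \<le> real N ^ CARD('k)" by (intro power_mono) auto
  then have "c * real (N - 1) ^ CARD('k) \<le> c * real N ^ CARD('k)" using \<open>0 \<le> c\<close> by (rule mult_left_mono)
  then have "real (box_widim \<epsilon>0 N) + real (box_widim \<epsilon>0 (N - 1)) \<le> c * real N ^ CARD('k) + c * real N ^ CARD('k)"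
    by (intro add_mono a(1) order_trans[OF a(2)])
  then have "2 * (real (box_widim \<epsilon>0 N) + real (box_widim \<epsilon>0 (N - 1))) \<le> 4 * c * real N ^ CARD('k)" by simp
  also have "\<dots> < real D * real (N - 1) ^ CARD('k)" by (rule N1) (simp add: N_def)
  finally have "real (2 * (box_widim \<epsilon>0 N + box_widim \<epsilon>0 (N - 1))) < real (card S2 * (N - 1) ^ CARD('k))"
    by (simp add: S2)
  then have capacity: "2 * (box_widim \<epsilon>0 N + box_widim \<epsilon>0 (N - 1)) < card S2 * (N - 1) ^ CARD('k)"
    by (simp only: of_nat_less_iff)
  \<comment> \<open>The separation demanded by \<open>encoding_with_markers\<close>. Markers can be
    made readable at any finite separation, so \<open>N\<close> may be fixed before them.\<close>
  define L where "L = 2 * CARD('k) * N^2 + N"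
  have "\<exists>g h B. (\<forall>i\<in>S1. continuous_on UNIV (g i) \<and> (\<forall>x. \<bar>g i x - F i x\<bar> \<le> \<eta>)) \<and>
    continuous_on UNIV h \<and> (\<forall>x. 0 \<le> h x \<and> h x \<le> (1::real)) \<and> finite B \<and> (\<forall>x. \<exists>n\<in>B. h (T n x) = 1) \<and>
    (\<forall>x. \<forall>n\<in>sup_ball L. n \<noteq> 0 \<longrightarrow> h x = 0 \<or> h (T n x) = 0) \<and>
    (\<forall>x y. (\<forall>n. \<forall>i\<in>S1. g i (T n x) = g i (T n y)) \<longrightarrow> h x = h y)"
    by (rule separated_equivariant_markers[OF mp fin(1,3) _ growth Fc F01 \<eta>(1)]) (use S1 c in simp)
  then obtain g1 h B where 1: "\<forall>i\<in>S1. continuous_on UNIV (g1 i) \<and> (\<forall>x. \<bar>g1 i x - F i x\<bar> \<le> \<eta>)"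
    "continuous_on UNIV h" "\<forall>x. 0 \<le> h x \<and> h x \<le> (1::real)" "finite B" "\<forall>x. \<exists>n\<in>B. h (T n x) = 1"
    "\<forall>x. \<forall>n\<in>sup_ball L. n \<noteq> 0 \<longrightarrow> h x = 0 \<or> h (T n x) = 0"
    "\<forall>x y. (\<forall>n. \<forall>i\<in>S1. g1 i (T n x) = g1 i (T n y)) \<longrightarrow> h x = h y"
    by (elim exE conjE) rule
  have "\<exists>g. (\<forall>i\<in>S2. continuous_on UNIV (g i) \<and> (\<forall>x. \<bar>g i x - F i x\<bar> \<le> \<eta>)) \<and>
    (\<forall>x y. (\<forall>n. h (T n x) = h (T n y)) \<longrightarrow> (\<forall>n. \<forall>i\<in>S2. g i (T n x) = g i (T n y)) \<longrightarrow> dist x y < \<epsilon>0)"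
  proof (rule encoding_with_markers[OF N fin(2) \<epsilon>0(1) \<eta>(1) Fc F01 _ capacity 1(2) _ 1(4)])
    show "\<bar>F i x - F i y\<bar> \<le> \<eta> / 2" if "i \<in> S2" "dist x y < \<epsilon>0" for i x y
      using \<epsilon>1(2) that \<epsilon>0(3) by auto
    show "0 \<le> h x \<and> h x \<le> 1" "\<exists>n\<in>B. h (T n x) = 1" for x using 1(3,5) by blast+
    show "h x = 0 \<or> h (T n x) = 0" if "n \<in> sup_ball (2 * CARD('k) * N^2 + N)" "n \<noteq> 0" for x n
      using 1(6) that unfolding L_def by blast
  qed
  then obtain g2 where 2: "\<forall>i\<in>S2. continuous_on UNIV (g2 i) \<and> (\<forall>x. \<bar>g2 i x - F i x\<bar> \<le> \<eta>)"
    "\<forall>x y. (\<forall>n. h (T n x) = h (T n y)) \<longrightarrow> (\<forall>n. \<forall>i\<in>S2. g2 i (T n x) = g2 i (T n y)) \<longrightarrow> dist x y < \<epsilon>0"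
    by (elim exE conjE) rule
  define G where "G i = (if i \<in> S1 then g1 i else g2 i)" for i
  have G: "continuous_on UNIV (G i) \<and> (\<forall>x. \<bar>G i x - F i x\<bar> \<le> \<eta>)" for i
    using 1(1) 2(1) by (cases "i \<in> S1") (simp_all add: G_def S2_def)
  define g where "g x = (\<chi> i. G i x)" for x
  have "continuous_on UNIV g" unfolding g_def by (intro continuous_on_vec_lambda) (use G in blast)
  moreover have "0 \<le> g x $ i \<and> g x $ i \<le> 1" for x i
  proof -
    have "\<bar>G i x - F i x\<bar> \<le> \<eta>" using G by blast
    then show ?thesis using Fb[of i x] by (simp add: g_def abs_le_iff)
  qed
  moreover have "\<bar>g x $ i - f x $ i\<bar> \<le> \<delta>" for x i
  proof -
    have "\<bar>G i x - F i x\<bar> \<le> \<eta>" using G by blast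
    then show ?thesis using Ff[of i x] \<eta>(3) by (simp add: g_def)
  qed
  moreover have "dist x y < \<epsilon>" if eq: "\<And>n. g (T n x) = g (T n y)" for x y
  proof -
    have Geq: "G i (T n x) = G i (T n y)" for i n
      using arg_cong[OF eq[of n], of "\<lambda>v. v $ i"] by (simp add: g_def)
    have g1eq: "g1 i (T n x) = g1 i (T n y)" if "i \<in> S1" for i n using Geq[of i n] that by (simp add: G_def)
    have g2eq: "g2 i (T n x) = g2 i (T n y)" if "i \<in> S2" for i n using Geq[of i n] that by (simp add: G_def S2_def)
    have "h (T n x) = h (T n y)" for n
      by (rule 1(7)[rule_format]) (use g1eq in simp)
    then have "dist x y < \<epsilon>0" using 2(2) g2eq by blast
    then show ?thesis using \<epsilon>0(2) by simp
  qed
  ultimately show ?thesis by (intro exI[of _ g] conjI allI impI) simp_all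
qed

end

section \<open>Topology of the space of maps and the Baire category argument\<close>

lemma continuous_on_eval_bcontfun: "continuous_on UNIV (\<lambda>f :: 'a::topological_space \<Rightarrow>\<^sub>C 'b::metric_space. apply_bcontfun f x)"
proof (rule continuous_onI)
  fix f :: "'a \<Rightarrow>\<^sub>C 'b" and e :: real assume "0 < e"
  then show "\<exists>d>0. \<forall>g\<in>UNIV. dist g f < d \<longrightarrow> dist (apply_bcontfun g x) (apply_bcontfun f x) \<le> e"
    using dist_fun_lt_imp_dist_val_lt[of _ f e x] by (intro exI[of _ e]) (auto intro: less_imp_le)
qed

lemma closed_cube_maps: "closed (cube_maps :: ('a::topological_space \<Rightarrow>\<^sub>C (real^'m)) set)"
proof -
  have eq: "(cube_maps :: ('a \<Rightarrow>\<^sub>C (real^'m)) set) = (\<Inter>x. \<Inter>i. {f. 0 \<le> apply_bcontfun f x $ i} \<inter> {f. apply_bcontfun f x $ i \<le> 1})"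
    by (auto simp: cube_maps_def)
  have c1: "closed {f :: 'a \<Rightarrow>\<^sub>C (real^'m). 0 \<le> apply_bcontfun f x $ i}" for x i
    by (intro closed_Collect_le continuous_on_const continuous_on_component continuous_on_eval_bcontfun)
  have c2: "closed {f :: 'a \<Rightarrow>\<^sub>C (real^'m). apply_bcontfun f x $ i \<le> 1}" for x i
    by (intro closed_Collect_le continuous_on_const continuous_on_component continuous_on_eval_bcontfun)
  show ?thesis unfolding eq by (intro closed_INT ballI closed_Int c1 c2)
qed

definition approx_embeddings :: "(int^'k \<Rightarrow> 'a::metric_space \<Rightarrow> 'a) \<Rightarrow> real \<Rightarrow> ('a \<Rightarrow>\<^sub>C (real^'m)) set" where
  "approx_embeddings T \<epsilon> = {f \<in> cube_maps. \<forall>x y. orbit_map T f x = orbit_map T f y \<longrightarrow> dist x y < \<epsilon>}"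

context zk_system
begin

lemma orbit_map_eq_iff: "orbit_map T f x = orbit_map T f y \<longleftrightarrow> (\<forall>n. apply_bcontfun f (T n x) = apply_bcontfun f (T n y))"
  by (simp add: orbit_map_def fun_eq_iff)

text \<open>By compactness, finitely many times and thresholds \<open>1 / (i + 1)\<close> suffice
  for \<open>f\<close> to distinguish all pairs at distance at least \<open>\<epsilon>\<close>, with
  a common margin \<open>\<tau>\<close>. A map within \<open>\<tau> / 2\<close> of \<open>f\<close>
  still distinguishes them.\<close>

lemma openin_approx_embeddings:
  "openin (subtopology euclidean cube_maps) (approx_embeddings T \<epsilon> :: ('a \<Rightarrow>\<^sub>C (real^'m)) set)"
  unfolding openin_euclidean_subtopology_iff
proof (intro conjI ballI)
  show "approx_embeddings T \<epsilon> \<subseteq> (cube_maps :: ('a \<Rightarrow>\<^sub>C (real^'m)) set)" by (auto simp: approx_embeddings_def)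
  fix f :: "'a \<Rightarrow>\<^sub>C (real^'m)" assume f: "f \<in> approx_embeddings T \<epsilon>"
  define S where "S = {z :: 'a \<times> 'a. \<epsilon> \<le> dist (fst z) (snd z)}"
  have "closed S" unfolding S_def by (intro closed_Collect_le continuous_intros)
  moreover have "compact (UNIV :: ('a \<times> 'a) set)"
    using compact_Times[OF compact_space compact_space] by simp
  ultimately have cS: "compact S" using compact_Int_closed by fastforce
  define W where "W = (\<lambda>(n, i::nat). {z. 1 / (real i + 1) < dist (apply_bcontfun f (T n (fst z))) (apply_bcontfun f (T n (snd z)))})"
  have fT: "continuous_on UNIV (\<lambda>x. apply_bcontfun f (T n x))" for n
    by (rule continuous_on_compose2[OF continuous_on_apply_bcontfun[of UNIV] T_cont]) simp
  have "open (W p)" for p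
  proof (cases p)
    case (Pair n i)
    have "continuous_on UNIV (\<lambda>z. dist (apply_bcontfun f (T n (fst z))) (apply_bcontfun f (T n (snd z))))"
      by (intro continuous_on_dist continuous_on_compose2[OF fT continuous_on_fst[OF continuous_on_id]]
          continuous_on_compose2[OF fT continuous_on_snd[OF continuous_on_id]]) auto
    then show ?thesis unfolding Pair W_def prod.case by (rule open_Collect_less[OF continuous_on_const])
  qed
  moreover have "S \<subseteq> (\<Union>p. W p)"
  proof
    fix z assume z: "z \<in> S"
    have "\<exists>n. apply_bcontfun f (T n (fst z)) \<noteq> apply_bcontfun f (T n (snd z))"
    proof (rule ccontr)
      assume "\<not> ?thesis"
      then have "dist (fst z) (snd z) < \<epsilon>" using f unfolding approx_embeddings_def orbit_map_eq_iff by blast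
      then show False using z by (simp add: S_def)
    qed
    then obtain n where "0 < dist (apply_bcontfun f (T n (fst z))) (apply_bcontfun f (T n (snd z)))" by auto
    then obtain i where "inverse (real (Suc i)) < dist (apply_bcontfun f (T n (fst z))) (apply_bcontfun f (T n (snd z)))"
      using reals_Archimedean by blast
    then have "z \<in> W (n, i)" by (simp add: W_def inverse_eq_divide add.commute)
    then show "z \<in> (\<Union>p. W p)" by blast
  qed
  ultimately obtain Q where Q: "finite Q" "S \<subseteq> (\<Union>p\<in>Q. W p)"
    by (rule_tac compactE_image[OF cS, of UNIV W]) auto
  define \<tau> where "\<tau> = 1 / (real (Max (snd ` Q)) + 1)"
  have \<tau>: "0 < \<tau>" by (simp add: \<tau>_def)
  have sep: "\<exists>n. \<tau> < dist (apply_bcontfun f (T n x)) (apply_bcontfun f (T n y))" if xy: "\<epsilon> \<le> dist x y" for x y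
  proof -
    have "(x, y) \<in> S" using xy by (simp add: S_def)
    then obtain p where p: "p \<in> Q" "(x, y) \<in> W p" using Q(2) by blast
    obtain n i where pni: "p = (n, i)" by (cases p)
    have ni: "(n, i) \<in> Q" "1 / (real i + 1) < dist (apply_bcontfun f (T n x)) (apply_bcontfun f (T n y))"
      using p unfolding pni W_def by simp_all
    have "i \<in> snd ` Q" using ni(1) by force
    then have "i \<le> Max (snd ` Q)" using Q(1) by simp
    then have "\<tau> \<le> 1 / (real i + 1)" unfolding \<tau>_def by (intro divide_left_mono) auto
    then show ?thesis using ni(2) by (intro exI[of _ n]) linarith
  qed
  have "g \<in> approx_embeddings T \<epsilon>" if g: "g \<in> cube_maps" "dist g f < \<tau> / 2" for g :: "'a \<Rightarrow>\<^sub>C (real^'m)"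
  proof -
    have "dist x y < \<epsilon>" if eq: "\<forall>n. apply_bcontfun g (T n x) = apply_bcontfun g (T n y)" for x y
    proof (rule ccontr)
      assume "\<not> ?thesis"
      then obtain n where n: "\<tau> < dist (apply_bcontfun f (T n x)) (apply_bcontfun f (T n y))" using sep[of x y] by auto
      have "dist (apply_bcontfun g (T n x)) (apply_bcontfun f (T n x)) < \<tau> / 2"
        "dist (apply_bcontfun g (T n y)) (apply_bcontfun f (T n y)) < \<tau> / 2"
        using dist_fun_lt_imp_dist_val_lt[OF g(2)] by blast+
      moreover have "apply_bcontfun g (T n x) = apply_bcontfun g (T n y)" using eq by blast
      ultimately show False
        using n dist_triangle3[of "apply_bcontfun f (T n x)" "apply_bcontfun f (T n y)" "apply_bcontfun g (T n x)"]
        by simp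
    qed
    then show ?thesis using g(1) unfolding approx_embeddings_def orbit_map_eq_iff by blast
  qed
  then show "\<exists>e>0. \<forall>g\<in>cube_maps. dist g f < e \<longrightarrow> g \<in> approx_embeddings T \<epsilon>"
    using \<tau> by (intro exI[of _ "\<tau> / 2"]) auto
qed

text \<open>A continuous map from a compact space to a Hausdorff space is closed; the function type
  carries the product topology.\<close>

lemma embedding_map_orbit_map:
  fixes f :: "'a \<Rightarrow>\<^sub>C (real^'m)"
  assumes "inj (orbit_map T f)"
  shows "embedding_map euclidean euclidean (orbit_map T f)"
proof -
  have "continuous_on UNIV (orbit_map T f)"
    unfolding orbit_map_def
    by (intro continuous_on_coordinatewise_then_product continuous_on_compose2[OF continuous_on_apply_bcontfun[of UNIV] T_cont]) simp
  then have c: "continuous_map euclidean euclidean (orbit_map T f)" by simp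
  have "Hausdorff_space (product_topology (\<lambda>n :: int^'k. euclidean :: (real^'m) topology) UNIV)"
    by (simp add: Hausdorff_space_product_topology)
  then have "Hausdorff_space (euclidean :: (int^'k \<Rightarrow> real^'m) topology)"
    by (simp add: euclidean_product_topology)
  moreover have "compact_space (euclidean :: 'a topology)" using compact_space by (simp add: compact_space_def)
  ultimately have "closed_map euclidean euclidean (orbit_map T f)" using c by (intro continuous_imp_closed_map_gen Hausdorff_imp_kc_space)
  then show ?thesis using c assms by (intro injective_closed_imp_embedding_map) auto
qed

end

theorem theorem7p1:
  fixes T :: "int^'k \<Rightarrow> 'a::metric_space \<Rightarrow> 'a"
    and D :: nat
  assumes "compact (UNIV :: 'a set)"
    and "zk_action T"
    and "marker_property T"
    and "D > 0"
    and "CARD('m) = 2 * D"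
    and "mdim T < ereal (real D / 2 ^ (CARD('k) + 1))"
  shows "\<exists>G. G \<subseteq> (cube_maps :: ('a \<Rightarrow>\<^sub>C (real^'m)) set) \<and>
             gdelta_in (subtopology euclidean cube_maps) G \<and>
             (subtopology euclidean cube_maps) closure_of G = cube_maps \<and>
             (\<forall>f\<in>G. embedding_map euclidean euclidean (orbit_map T f))"
proof -
  interpret zk_system T using assms(1,2) by unfold_locales
  obtain c where c: "mdim T < ereal c" "ereal c < ereal (real D / 2 ^ (CARD('k) + 1))"
    using ereal_dense2[OF assms(6)] by blast
  \<comment> \<open>Since \<open>k \<ge> 1\<close>, the assumed bound is at most the threshold
    \<open>D / 4\<close> of the construction.\<close>
  have "(2::real) ^ 2 \<le> 2 ^ (CARD('k) + 1)" by (rule power_increasing) (simp_all add: Suc_leI)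
  then have "real D / 2 ^ (CARD('k) + 1) \<le> real D / 4" by (intro divide_left_mono) auto
  then have c4: "4 * c < real D" using c(2) by simp
  note growth = box_widim_eventually[OF c(1)]
  define X where "X = subtopology euclidean (cube_maps :: ('a \<Rightarrow>\<^sub>C (real^'m)) set)"
  have tX: "topspace X = cube_maps" by (simp add: X_def)
  define \<G> where "\<G> = range (\<lambda>i::nat. approx_embeddings T (1 / (real i + 1)) :: ('a \<Rightarrow>\<^sub>C (real^'m)) set)"
  have op: "openin X (approx_embeddings T \<epsilon>)" for \<epsilon> unfolding X_def by (rule openin_approx_embeddings)
  have dense: "X closure_of (approx_embeddings T \<epsilon>) = topspace X" if \<epsilon>: "0 < \<epsilon>" for \<epsilon>
    unfolding dense_intersects_open
  proof (intro allI impI)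
    fix U assume U: "openin X U \<and> U \<noteq> {}"
    then obtain f where f: "f \<in> U" by blast
    then obtain e where e: "0 < e" "\<And>g. g \<in> cube_maps \<Longrightarrow> dist g f < e \<Longrightarrow> g \<in> U" and fc: "f \<in> cube_maps"
      using U unfolding X_def openin_euclidean_subtopology_iff by blast
    \<comment> \<open>An error of \<open>\<delta>\<close> in each coordinate is at most
      \<open>e / 2\<close> in norm, strictly below \<open>e\<close>.\<close>
    define \<delta> where "\<delta> = e / (2 * real CARD('m))"
    have m0: "0 < real CARD('m)" by simp
    have \<delta>: "0 < \<delta>" using e(1) m0 by (simp add: \<delta>_def)
    have f01: "0 \<le> apply_bcontfun f x $ i \<and> apply_bcontfun f x $ i \<le> 1" for x i
      using fc by (simp add: cube_maps_def)
    have fcont: "continuous_on UNIV (apply_bcontfun f)" by (rule continuous_on_apply_bcontfun)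
    have "\<exists>g. continuous_on UNIV g \<and> (\<forall>x i. 0 \<le> g x $ i \<and> g x $ i \<le> 1) \<and>
      (\<forall>x i. \<bar>g x $ i - apply_bcontfun f x $ i\<bar> \<le> \<delta>) \<and> (\<forall>x y. (\<forall>n. g (T n x) = g (T n y)) \<longrightarrow> dist x y < \<epsilon>)"
      by (rule dense_approximate_embeddings[OF assms(3-5) c4 growth fcont f01 \<epsilon> \<delta>])
    then obtain g where g: "continuous_on UNIV g" "\<forall>x i. 0 \<le> g x $ i \<and> g x $ i \<le> 1"
      "\<forall>x i. \<bar>g x $ i - apply_bcontfun f x $ i\<bar> \<le> \<delta>" "\<forall>x y. (\<forall>n. g (T n x) = g (T n y)) \<longrightarrow> dist x y < \<epsilon>"
      by (elim exE conjE) rule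
    have "bounded (range g)" by (rule compact_imp_bounded[OF compact_continuous_image[OF g(1) compact_space]])
    then have gb: "g \<in> bcontfun" using g(1) by (simp add: bcontfun_def)
    define G where "G = Bcontfun g"
    have G: "apply_bcontfun G = g" unfolding G_def by (rule Bcontfun_inverse[OF gb])
    have Gc: "G \<in> cube_maps" using g(2) by (simp add: cube_maps_def G)
    have "dist G f \<le> e / 2"
    proof (rule dist_bound)
      fix x
      have "dist (apply_bcontfun G x) (apply_bcontfun f x) = norm (g x - apply_bcontfun f x)" by (simp add: G dist_norm)
      also have "\<dots> \<le> (\<Sum>i\<in>UNIV. \<bar>(g x - apply_bcontfun f x) $ i\<bar>)" by (rule norm_le_l1_cart)
      also have "\<dots> \<le> real CARD('m) * \<delta>" by (rule sum_bounded_above) (use g(3) in simp)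
      also have "\<dots> = e / 2" using m0 by (simp add: \<delta>_def)
      finally show "dist (apply_bcontfun G x) (apply_bcontfun f x) \<le> e / 2" .
    qed
    then have "G \<in> U" using e(1) by (intro e(2)[OF Gc]) linarith
    moreover have "G \<in> approx_embeddings T \<epsilon>"
      using Gc g(4) by (simp add: approx_embeddings_def orbit_map_eq_iff G)
    ultimately show "approx_embeddings T \<epsilon> \<inter> U \<noteq> {}" by blast
  qed
  have \<G>: "openin X S \<and> X closure_of S = topspace X" if "S \<in> \<G>" for S
    using that op dense by (auto simp: \<G>_def)
  \<comment> \<open>\<open>cube_maps\<close> is closed in the complete space of bounded continuous
    maps, so Baire's theorem applies to the countable family \<open>\<G>\<close>.\<close>
  have "completely_metrizable_space X"
    unfolding X_def
    by (rule completely_metrizable_space_closedin[OF completely_metrizable_space_euclidean])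
      (simp add: closed_cube_maps flip: closed_closedin)
  then have "X closure_of \<Inter>\<G> = topspace X"
    by (intro Baire_category) (use \<G> in \<open>auto simp: \<G>_def\<close>)
  moreover have "gdelta_in X (\<Inter>\<G>)"
    by (rule gdelta_in_Inter) (use \<G> open_imp_gdelta_in in \<open>auto simp: \<G>_def\<close>)
  moreover have "\<Inter>\<G> \<subseteq> cube_maps" by (auto simp: \<G>_def approx_embeddings_def)
  moreover have "embedding_map euclidean euclidean (orbit_map T f)" if f: "f \<in> \<Inter>\<G>" for f
  proof (rule embedding_map_orbit_map, rule injI, rule ccontr)
    fix x y assume xy: "orbit_map T f x = orbit_map T f y" "x \<noteq> y"
    then have "0 < dist x y" by simp
    then obtain i where "inverse (real (Suc i)) < dist x y" using reals_Archimedean by blast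
    then have i: "1 / (real i + 1) < dist x y" by (simp add: inverse_eq_divide add.commute)
    have "f \<in> approx_embeddings T (1 / (real i + 1))" using f by (simp add: \<G>_def)
    then have "dist x y < 1 / (real i + 1)" using xy(1) unfolding approx_embeddings_def by blast
    then show False using i by simp
  qed
  ultimately show ?thesis unfolding X_def[symmetric] tX by (intro exI[of _ "\<Inter>\<G>"]) blast
qed

end
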